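(* Let $M,N$ be positive integers with $N\ge M$, $\lambda_S,\lambda_R,\mu>0$, and $\rho$ a probability density on $[-\pi,\pi]$ with absolutely convergent Fourier series and $\int_{-\pi}^\pi\rho(\theta)\sin\theta\cos\theta\,\mathrm{d}\theta=0$. Let $h_0\ge0$ on $\mathbb{R}^M$ with $\int h_0(\mathbf v)e^{-\pi|\mathbf v|^2}\mathrm{d}\mathbf v=1$ and $\mathcal S(h_0)<\infty$, and let $h_k$ be as in the context. Then for every $k\ge0$, $$\mathcal S(h_k)\le\left[\frac{M}{N+M}+\frac{N}{N+M}\Big(1-\mu_\rho\frac{N+M}{N\Lambda}\Big)^k\right]\mathcal S(h_0),\qquad\mu_\rho=\mu\int_{-\pi}^\pi\rho(\theta)\sin^2\theta\,\mathrm{d}\theta.$$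
   Context: For a pair $\alpha=(i,j)$, $1\le i<j\le M+N$, $r_\alpha(\theta)$ is the rotation of $\mathbb{R}^{M+N}$ in the $(i,j)$ coordinate plane such that $r_\alpha(\theta)^{-1}\mathbf z$ has $i$-th coordinate $z_i\cos\theta-z_j\sin\theta$, $j$-th coordinate $z_i\sin\theta+z_j\cos\theta$, other coordinates unchanged. $\Lambda=\lambda_SM/2+\lambda_RN/2+\mu M$; $\lambda_{(i,j)}=\lambda_S/(\Lambda(M-1))$ if $j\le M$, $=\lambda_R/(\Lambda(N-1))$ if $i\ge M+1$, $=\mu/(\Lambda N)$ if $i\le M<j$. With $P(\mathbf v,\mathbf w)=\mathbf v$, $$h_k(\mathbf v)=\sum_{\alpha_1,\dots,\alpha_k}\lambda_{\alpha_1}\cdots\lambda_{\alpha_k}\int_{[-\pi,\pi]^k}\prod_{l=1}^k\rho(\theta_l)\,\mathrm{d}\underline\theta\int_{\mathbb{R}^N}(h_0\circ P)\Big(\big[\textstyle\prod_{l=1}^kr_{\alpha_l}(\theta_l)\big]^{-1}(\mathbf v,\mathbf w)\Big)e^{-\pi|\mathbf w|^2}\,\mathrm{d}\mathbf w.$$ $\mathcal S(h)=\int_{\mathbb{R}^M}h\log h\,e^{-\pi|\mathbf v|^2}\mathrm{d}\mathbf v$. *)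

theory Defs
  imports "HOL-Analysis.Analysis"
begin

text \<open>Coordinates of R^(M+N) are indexed 0-based by {0..<M+N}; v = first M coordinates,
  w = coordinates M..M+N-1. Vectors are functions nat => real, measured by products of lborel.\<close>

definition gauss_w :: "nat set \<Rightarrow> (nat \<Rightarrow> real) \<Rightarrow> real" where
  "gauss_w I x = exp (- pi * (\<Sum>i\<in>I. (x i)\<^sup>2))"

text \<open>rot i j th z = r_(i,j)(th)^(-1) z\<close>
definition rot :: "nat \<Rightarrow> nat \<Rightarrow> real \<Rightarrow> (nat \<Rightarrow> real) \<Rightarrow> (nat \<Rightarrow> real)" where
  "rot i j th z = z(i := z i * cos th - z j * sin th, j := z i * sin th + z j * cos th)"

fun rot_prod_inv :: "nat \<Rightarrow> (nat \<Rightarrow> nat \<times> nat) \<Rightarrow> (nat \<Rightarrow> real) \<Rightarrow> (nat \<Rightarrow> real) \<Rightarrow> (nat \<Rightarrow> real)" where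
  "rot_prod_inv 0 a th z = z"
| "rot_prod_inv (Suc k) a th z = rot_prod_inv k a th (rot (fst (a k)) (snd (a k)) (th k) z)"

definition pairs :: "nat \<Rightarrow> (nat \<times> nat) set" where
  "pairs D = {(i, j). i < j \<and> j < D}"

definition Lam :: "nat \<Rightarrow> nat \<Rightarrow> real \<Rightarrow> real \<Rightarrow> real \<Rightarrow> real" where
  "Lam M N lS lR mu = lS * real M / 2 + lR * real N / 2 + mu * real M"

definition lam :: "nat \<Rightarrow> nat \<Rightarrow> real \<Rightarrow> real \<Rightarrow> real \<Rightarrow> nat \<times> nat \<Rightarrow> real" where
  "lam M N lS lR mu a =
     (if snd a < M then lS / (Lam M N lS lR mu * (real M - 1))
      else if M \<le> fst a then lR / (Lam M N lS lR mu * (real N - 1))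
      else mu / (Lam M N lS lR mu * real N))"

definition hk :: "nat \<Rightarrow> nat \<Rightarrow> real \<Rightarrow> real \<Rightarrow> real \<Rightarrow> (real \<Rightarrow> real)
    \<Rightarrow> ((nat \<Rightarrow> real) \<Rightarrow> real) \<Rightarrow> nat \<Rightarrow> (nat \<Rightarrow> real) \<Rightarrow> real" where
  "hk M N lS lR mu \<rho> h0 k v =
     (\<Sum>a\<in>PiE {..<k} (\<lambda>_. pairs (M + N)).
        (\<Prod>l<k. lam M N lS lR mu (a l)) *
        (\<integral>th. (\<Prod>l<k. indicator {-pi..pi} (th l) * \<rho> (th l)) *
            (\<integral>w. h0 (restrict (rot_prod_inv k a th (\<lambda>i. if i < M then v i else w i)) {..<M})
                   * gauss_w {M..<M+N} w
               \<partial>(PiM {M..<M+N} (\<lambda>_. lborel)))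
          \<partial>(PiM {..<k} (\<lambda>_. lborel))))"

definition entropy :: "nat \<Rightarrow> ((nat \<Rightarrow> real) \<Rightarrow> real) \<Rightarrow> real" where
  "entropy M h = (\<integral>v. h v * ln (h v) * gauss_w {..<M} v \<partial>(PiM {..<M} (\<lambda>_. lborel)))"

definition fourier_coeff :: "(real \<Rightarrow> real) \<Rightarrow> int \<Rightarrow> complex" where
  "fourier_coeff \<rho> n = (1 / (2 * pi)) *
     (LINT th:{-pi..pi}|lborel. complex_of_real (\<rho> th) * exp (- (\<i> * complex_of_real (real_of_int n * th))))"

end

theory Submission
  imports Defs "HOL-Probability.Probability" "HOL-Real_Asymp.Real_Asymp"
begin

text \<open>
  Instead of a Brascamp--Lieb inequality we compare entropy production along the
  Ornstein--Uhlenbeck semigroup. On \<open>R^(M+N)\<close> with its Gaussian measure, \<open>h_k\<close> is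
  \<open>\<Pi> Q\<^sup>k (h\<^sub>0 \<circ> P)\<close>, where \<open>Q\<close> averages over one rotation and \<open>\<Pi>\<close> integrates out the reservoir;
  both commute with the Mehler operators. The rotations act linearly on gradients, and
  \<open>x\<^sup>2 / y\<close> is jointly convex, so the Fisher information of \<open>h_k\<close> is at most a constant times that of
  \<open>h\<^sub>0\<close>. The constant is obtained by iterating the average of the rotations on the quadratic forms
  \<open>a |v|\<^sup>2 + b |w|\<^sup>2\<close>; here \<open>\<integral> \<rho> sin cos = 0\<close> removes the cross terms.

  The passage from Fisher information to entropy avoids differentiation in time. One Mehler step of
  size \<open>s\<close> lowers the entropy by the averaged entropy of the function on a Gaussian ball of radius
  \<open>s\<close>, which is \<open>\<pi> |E f(c z + s y) y|\<^sup>2 / E f(c z + s y)\<close> up to \<open>O(s\<^sup>3)\<close>. Summing over \<open>n\<close> steps with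
  \<open>n s\<^sup>3 \<longlonglongrightarrow> 0\<close> and \<open>n s\<^sup>2 \<longlonglongrightarrow> \<infinity>\<close> transfers the inequality to bounded data, and truncation
  together with Fatou's lemma to all data.
\<close>

section \<open>The Gaussian measure and its invariances\<close>

text \<open>Working with finite Mehler steps turns the Fisher comparison into algebra and convexity,
  and moves the difficulty into uniform error terms. A third-order expansion of x ln x costs 1/e^2,
  so the data are kept above a positive e. The error of one step is O(s^3) with constants depending
  on Lipschitz and second-order bounds; both functions are therefore smoothed once at the start,
  after which these bounds do not grow. The entropy left after n steps decays like (1 - s^2)^n,
  because each step contracts the Lipschitz constant by c = sqrt (1 - s^2). The initial smoothing is
  removed by L1 continuity on one side and monotonicity of entropy on the other. The contraction
  constant is a single coefficient: the reservoir average sees only the gradient in v, so the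
  quadratic form starts as |v|^2, and h_0 composed with P has a gradient only in v, so only the
  final coefficient of |v|^2 counts. The rates may sum to less than 1, and then Q loses mass. Hence
  entropy is always measured relative to \<open>phi\<close> of the mean, and the loss is absorbed at
  the end by x ln x <= 0 on [0,1].\<close>

definition gauss1 :: "real measure" where
  "gauss1 = density lborel (\<lambda>x. ennreal (exp (- pi * x\<^sup>2)))"

definition gauss :: "nat set \<Rightarrow> (nat \<Rightarrow> real) measure" where
  "gauss I = PiM I (\<lambda>_. gauss1)"

text \<open>The weight is already normalised and has variance 1/(2 pi). This variance is the origin
  of all later factors 2 pi and 1/(2 pi).\<close>

lemma exp_eq_normal_density: "exp (- pi * x\<^sup>2) = normal_density 0 (1 / sqrt (2 * pi)) x"
  by (simp add: normal_density_def power_divide field_simps)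

lemma sets_gauss1 [simp, measurable_cong]: "sets gauss1 = sets borel"
  and space_gauss1 [simp]: "space gauss1 = UNIV"
  by (simp_all add: gauss1_def)

lemma prob_space_gauss1: "prob_space gauss1"
  unfolding gauss1_def exp_eq_normal_density by (rule prob_space_normal_density) simp

interpretation gauss1: prob_space gauss1 by (rule prob_space_gauss1)

lemma emeasure_gauss1_UNIV [simp]: "emeasure gauss1 UNIV = 1"
  using gauss1.emeasure_space_1 by simp

interpretation g1p: product_sigma_finite "\<lambda>_::nat. gauss1" ..

lemma prob_space_gauss: "prob_space (gauss I)"
  unfolding gauss_def by (rule prob_space_PiM) (rule prob_space_gauss1)

interpretation gauss: prob_space "gauss I" for I by (rule prob_space_gauss)

lemma space_gauss: "space (gauss I) = extensional I"
  by (simp add: gauss_def space_PiM PiE_def)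

lemma sets_gauss [measurable_cong]: "sets (gauss I) = sets (PiM I (\<lambda>_. borel))"
  unfolding gauss_def by (rule sets_PiM_cong) auto

text \<open>On a box both the density and the indicator factor over the coordinates, and boxes
  determine a product measure. The lemma serves the Gaussian and also the joint law of the k
  angles.\<close>

lemma PiM_density:
  assumes I: "finite I" and M: "product_sigma_finite M"
    and N: "product_sigma_finite (\<lambda>i. density (M i) (f i))"
    and f [measurable]: "\<And>i. i \<in> I \<Longrightarrow> f i \<in> borel_measurable (M i)"
  shows "density (PiM I M) (\<lambda>x. \<Prod>i\<in>I. f i (x i)) = PiM I (\<lambda>i. density (M i) (f i))"
proof -
  interpret M: product_sigma_finite M by fact
  interpret N: product_sigma_finite "\<lambda>i. density (M i) (f i)" by fact
  show ?thesis
  proof (rule N.PiM_eqI[OF I])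
    show "sets (density (PiM I M) (\<lambda>x. \<Prod>i\<in>I. f i (x i))) = sets (PiM I (\<lambda>i. density (M i) (f i)))"
      by (simp, rule sets_PiM_cong) auto
  next
    fix A assume "\<And>i. i \<in> I \<Longrightarrow> A i \<in> sets (density (M i) (f i))"
    then have A [measurable]: "\<And>i. i \<in> I \<Longrightarrow> A i \<in> sets (M i)" by simp
    have "emeasure (density (PiM I M) (\<lambda>x. \<Prod>i\<in>I. f i (x i))) (Pi\<^sub>E I A)
        = (\<integral>\<^sup>+x. (\<Prod>i\<in>I. f i (x i)) * indicator (Pi\<^sub>E I A) x \<partial>PiM I M)"
      by (rule emeasure_density) (use I in measurable)
    also have "\<dots> = (\<integral>\<^sup>+x. (\<Prod>i\<in>I. f i (x i) * indicator (A i) (x i)) \<partial>PiM I M)"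
    proof (rule nn_integral_cong)
      fix x assume x: "x \<in> space (PiM I M)"
      have "(\<Prod>i\<in>I. indicator (A i) (x i)) = (indicator (Pi\<^sub>E I A) x :: ennreal)"
      proof (cases "x \<in> Pi\<^sub>E I A")
        case True then show ?thesis by (auto simp: PiE_def Pi_def intro!: prod.neutral)
      next
        case False
        then obtain i where "i \<in> I" "x i \<notin> A i" using x by (auto simp: space_PiM PiE_def)
        with I have "(\<Prod>i\<in>I. indicator (A i) (x i)) = (0::ennreal)"
          by (auto intro!: prod_zero bexI[of _ i])
        with False show ?thesis by simp
      qed
      then show "(\<Prod>i\<in>I. f i (x i)) * indicator (Pi\<^sub>E I A) x = (\<Prod>i\<in>I. f i (x i) * indicator (A i) (x i))"
        by (simp add: prod.distrib)
    qed
    also have "\<dots> = (\<Prod>i\<in>I. \<integral>\<^sup>+x. f i x * indicator (A i) x \<partial>M i)"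
      by (rule M.product_nn_integral_prod[OF I, of "\<lambda>i y. f i y * indicator (A i) y"]) measurable
    also have "\<dots> = (\<Prod>i\<in>I. emeasure (density (M i) (f i)) (A i))"
      by (intro prod.cong refl) (simp add: emeasure_density)
    finally show "emeasure (density (PiM I M) (\<lambda>x. \<Prod>i\<in>I. f i (x i))) (Pi\<^sub>E I A)
        = (\<Prod>i\<in>I. emeasure (density (M i) (f i)) (A i))" .
  qed
qed

lemma product_sigma_finite_lborel: "product_sigma_finite (\<lambda>_::nat. lborel :: real measure)"
  by standard

lemma gauss_density:
  assumes I: "finite I"
  shows "gauss I = density (PiM I (\<lambda>_. lborel)) (\<lambda>x. ennreal (gauss_w I x))"
proof -
  have "gauss I = density (PiM I (\<lambda>_. lborel)) (\<lambda>x. \<Prod>i\<in>I. ennreal (exp (- pi * (x i)\<^sup>2)))"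
    unfolding gauss_def gauss1_def
  proof (rule PiM_density[symmetric, OF I product_sigma_finite_lborel])
    show "product_sigma_finite (\<lambda>_::nat. density lborel (\<lambda>x. ennreal (exp (- pi * x\<^sup>2))))"
      unfolding gauss1_def[symmetric] ..
  qed measurable
  also have "(\<lambda>x. \<Prod>i\<in>I. ennreal (exp (- pi * (x i)\<^sup>2))) = (\<lambda>x. ennreal (gauss_w I x))"
    using I by (simp add: gauss_w_def prod_ennreal exp_sum sum_distrib_left)
  finally show ?thesis .
qed

lemma measurable_gauss_w [measurable]:
  "gauss_w I \<in> borel_measurable (PiM I (\<lambda>_. borel))"
  unfolding gauss_w_def by measurable

text \<open>Bridge between the weighted Lebesgue integrals of the final statement and the
  probability measure \<open>gauss\<close>. Integrability is transferred in both directions: it is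
  assumed for the initial datum and asserted for the evolved one.\<close>

lemma integral_gauss:
  assumes I: "finite I" and f: "f \<in> borel_measurable (PiM I (\<lambda>_. borel))"
  shows "(\<integral>x. f x * gauss_w I x \<partial>PiM I (\<lambda>_. lborel)) = (\<integral>x. f x \<partial>gauss I)"
    and "integrable (PiM I (\<lambda>_. lborel)) (\<lambda>x. f x * gauss_w I x) \<longleftrightarrow> integrable (gauss I) (f :: _ \<Rightarrow> real)"
proof -
  have e: "sets (PiM I (\<lambda>_. lborel)) = sets (PiM I (\<lambda>_. borel :: real measure))"
    by (rule sets_PiM_cong) auto
  have [measurable]: "f \<in> borel_measurable (PiM I (\<lambda>_. lborel))"
    using f by (subst measurable_cong_sets[OF e refl])
  have [measurable]: "gauss_w I \<in> borel_measurable (PiM I (\<lambda>_. lborel))"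
    by (subst measurable_cong_sets[OF e refl]) measurable
  have p: "gauss_w I x \<ge> 0" for x by (simp add: gauss_w_def)
  show "(\<integral>x. f x * gauss_w I x \<partial>PiM I (\<lambda>_. lborel)) = (\<integral>x. f x \<partial>gauss I)"
    using p by (simp add: gauss_density[OF I] integral_density mult.commute)
  show "integrable (PiM I (\<lambda>_. lborel)) (\<lambda>x. f x * gauss_w I x) \<longleftrightarrow> integrable (gauss I) f"
    using p by (simp add: gauss_density[OF I] integrable_density mult.commute)
qed

section \<open>Rotation invariance of the plane Lebesgue and Gaussian measures\<close>

lemma nn_integral_shear:
  fixes f :: "real \<Rightarrow> real \<Rightarrow> ennreal"
  assumes [measurable]: "case_prod f \<in> borel_measurable (borel \<Otimes>\<^sub>M borel)"
  shows "(\<integral>\<^sup>+x. \<integral>\<^sup>+y. f x (y + t * x) \<partial>lborel \<partial>lborel) = (\<integral>\<^sup>+x. \<integral>\<^sup>+y. f x y \<partial>lborel \<partial>lborel)"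
    and "(\<integral>\<^sup>+x. \<integral>\<^sup>+y. f (x + t * y) y \<partial>lborel \<partial>lborel) = (\<integral>\<^sup>+x. \<integral>\<^sup>+y. f x y \<partial>lborel \<partial>lborel)"
proof -
  have *: "(\<integral>\<^sup>+y. g (y + a) \<partial>lborel) = (\<integral>\<^sup>+y. g y \<partial>lborel)"
    if [measurable]: "g \<in> borel_measurable borel" for g :: "real \<Rightarrow> ennreal" and a
    using nn_integral_real_affine[of g 1 a] by (simp add: add.commute)
  show "(\<integral>\<^sup>+x. \<integral>\<^sup>+y. f x (y + t * x) \<partial>lborel \<partial>lborel) = (\<integral>\<^sup>+x. \<integral>\<^sup>+y. f x y \<partial>lborel \<partial>lborel)"
    by (intro nn_integral_cong *) measurable
  have "(\<integral>\<^sup>+x. \<integral>\<^sup>+y. f (x + t * y) y \<partial>lborel \<partial>lborel) = (\<integral>\<^sup>+y. \<integral>\<^sup>+x. f (x + t * y) y \<partial>lborel \<partial>lborel)"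
    by (rule lborel_pair.Fubini'[symmetric]) measurable
  also have "\<dots> = (\<integral>\<^sup>+y. \<integral>\<^sup>+x. f x y \<partial>lborel \<partial>lborel)"
    by (intro nn_integral_cong *) measurable
  also have "\<dots> = (\<integral>\<^sup>+x. \<integral>\<^sup>+y. f x y \<partial>lborel \<partial>lborel)"
    by (rule lborel_pair.Fubini') measurable
  finally show "(\<integral>\<^sup>+x. \<integral>\<^sup>+y. f (x + t * y) y \<partial>lborel \<partial>lborel) = (\<integral>\<^sup>+x. \<integral>\<^sup>+y. f x y \<partial>lborel \<partial>lborel)" .
qed

text \<open>A plane rotation is a product of three shears, and a shear is a translation in one
  variable while the other is frozen. If s = 0 the rotation is plus or minus the identity and is
  treated separately.\<close>

lemma nn_integral_rotate_lborel:
  fixes f :: "real \<Rightarrow> real \<Rightarrow> ennreal"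
  assumes m [measurable]: "case_prod f \<in> borel_measurable (borel \<Otimes>\<^sub>M borel)" and cs: "c\<^sup>2 + s\<^sup>2 = 1"
  shows "(\<integral>\<^sup>+x. \<integral>\<^sup>+y. f (c * x - s * y) (s * x + c * y) \<partial>lborel \<partial>lborel)
       = (\<integral>\<^sup>+x. \<integral>\<^sup>+y. f x y \<partial>lborel \<partial>lborel)"
proof (cases "s = 0")
  case True
  then have "c = 1 \<or> c = -1" using cs by (simp add: power2_eq_1_iff)
  have *: "(\<integral>\<^sup>+y. g (- y) \<partial>lborel) = (\<integral>\<^sup>+y. g y \<partial>lborel)"
    if [measurable]: "g \<in> borel_measurable borel" for g :: "real \<Rightarrow> ennreal"
    using nn_integral_real_affine[of g "-1" 0] by simp
  have "(\<integral>\<^sup>+x. \<integral>\<^sup>+y. f (- x) (- y) \<partial>lborel \<partial>lborel) = (\<integral>\<^sup>+x. \<integral>\<^sup>+y. f (- x) y \<partial>lborel \<partial>lborel)"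
    by (intro nn_integral_cong *) measurable
  also have "\<dots> = (\<integral>\<^sup>+x. \<integral>\<^sup>+y. f x y \<partial>lborel \<partial>lborel)"
    by (rule *) measurable
  finally show ?thesis using True \<open>c = 1 \<or> c = -1\<close> by auto
next
  case False
  \<comment> \<open>This is the tangent of half the angle. The shears have parameters -t, s, -t, and
    the two identities that follow are what multiplying them out requires.\<close>
  define t where "t = (1 - c) / s"
  have st: "s * t = 1 - c" using False by (simp add: t_def)
  have tc: "t * (1 + c) = s" using False cs by (simp add: t_def field_simps power2_eq_square)
  have "(\<integral>\<^sup>+x. \<integral>\<^sup>+y. f x y \<partial>lborel \<partial>lborel) = (\<integral>\<^sup>+x. \<integral>\<^sup>+y. f (x + (-t) * y) y \<partial>lborel \<partial>lborel)"
    by (rule nn_integral_shear(2)[symmetric]) measurable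
  also have "\<dots> = (\<integral>\<^sup>+x. \<integral>\<^sup>+y. f (x + (-t) * (y + s * x)) (y + s * x) \<partial>lborel \<partial>lborel)"
    by (rule nn_integral_shear(1)[symmetric, where f="\<lambda>x y. f (x + (-t) * y) y"]) measurable
  also have "\<dots> = (\<integral>\<^sup>+x. \<integral>\<^sup>+y. f ((x + (-t) * y) + (-t) * (y + s * (x + (-t) * y))) (y + s * (x + (-t) * y)) \<partial>lborel \<partial>lborel)"
    by (rule nn_integral_shear(2)[symmetric, where f="\<lambda>x y. f (x + (-t) * (y + s * x)) (y + s * x)"]) measurable
  also have "\<dots> = (\<integral>\<^sup>+x. \<integral>\<^sup>+y. f (c * x - s * y) (s * x + c * y) \<partial>lborel \<partial>lborel)"
  proof (intro nn_integral_cong)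
    fix x y :: real
    have b: "y + s * (x + (-t) * y) = s * x + c * y"
      using arg_cong[OF st, of "\<lambda>u. u * y"] by (simp add: algebra_simps)
    have "(x + (-t) * y) + (-t) * (s * x + c * y) = (1 - s * t) * x - t * (1 + c) * y"
      by (simp add: algebra_simps)
    also have "\<dots> = c * x - s * y" unfolding st tc by simp
    finally show "f ((x + (-t) * y) + (-t) * (y + s * (x + (-t) * y))) (y + s * (x + (-t) * y))
      = f (c * x - s * y) (s * x + c * y)" by (simp only: b)
  qed
  finally show ?thesis by simp
qed

lemma nn_integral_gauss1_pair:
  fixes f :: "real \<Rightarrow> real \<Rightarrow> ennreal"
  assumes [measurable]: "case_prod f \<in> borel_measurable (borel \<Otimes>\<^sub>M borel)"
  shows "(\<integral>\<^sup>+x. \<integral>\<^sup>+y. f x y \<partial>gauss1 \<partial>gauss1)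
    = (\<integral>\<^sup>+x. \<integral>\<^sup>+y. f x y * ennreal (exp (- pi * (x\<^sup>2 + y\<^sup>2))) \<partial>lborel \<partial>lborel)"
  unfolding gauss1_def
  by (subst nn_integral_density, measurable, subst nn_integral_density, measurable)
     (auto simp: nn_integral_cmult[symmetric] algebra_simps exp_add[symmetric] ennreal_mult'[symmetric] mult_exp_exp
       intro!: nn_integral_cong)

text \<open>The Gaussian weight depends on x^2 + y^2 alone, so it is carried along by the rotation
  and invariance is inherited from Lebesgue measure.\<close>

lemma nn_integral_rotate:
  fixes f :: "real \<Rightarrow> real \<Rightarrow> ennreal"
  assumes [measurable]: "case_prod f \<in> borel_measurable (borel \<Otimes>\<^sub>M borel)" and cs: "c\<^sup>2 + s\<^sup>2 = 1"
  shows "(\<integral>\<^sup>+x. \<integral>\<^sup>+y. f (c * x - s * y) (s * x + c * y) \<partial>gauss1 \<partial>gauss1)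
       = (\<integral>\<^sup>+x. \<integral>\<^sup>+y. f x y \<partial>gauss1 \<partial>gauss1)"
proof -
  have *: "(c * x - s * y)\<^sup>2 + (s * x + c * y)\<^sup>2 = x\<^sup>2 + y\<^sup>2" for x y
  proof -
    have "(c * x - s * y)\<^sup>2 + (s * x + c * y)\<^sup>2 = (c\<^sup>2 + s\<^sup>2) * (x\<^sup>2 + y\<^sup>2)"
      by (simp add: power2_eq_square algebra_simps)
    then show ?thesis by (simp add: cs)
  qed
  have "(\<integral>\<^sup>+x. \<integral>\<^sup>+y. f (c * x - s * y) (s * x + c * y) \<partial>gauss1 \<partial>gauss1) =
      (\<integral>\<^sup>+x. \<integral>\<^sup>+y. f (c * x - s * y) (s * x + c * y)
         * ennreal (exp (- pi * ((c * x - s * y)\<^sup>2 + (s * x + c * y)\<^sup>2))) \<partial>lborel \<partial>lborel)"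
    unfolding * by (rule nn_integral_gauss1_pair) measurable
  also have "\<dots> = (\<integral>\<^sup>+x. \<integral>\<^sup>+y. f x y * ennreal (exp (- pi * (x\<^sup>2 + y\<^sup>2))) \<partial>lborel \<partial>lborel)"
    by (rule nn_integral_rotate_lborel[where f="\<lambda>x y. f x y * ennreal (exp (- pi * (x\<^sup>2 + y\<^sup>2)))"])
       (use cs in measurable)
  also have "\<dots> = (\<integral>\<^sup>+x. \<integral>\<^sup>+y. f x y \<partial>gauss1 \<partial>gauss1)"
    by (rule nn_integral_gauss1_pair[symmetric]) measurable
  finally show ?thesis .
qed

text \<open>The coefficients vary with the coordinate so that one operation covers several cases:
  constant c and s give a Mehler step, values 0 and 1 resample a block of coordinates, and c = -1
  with s = 0 reflects one. The result is restricted to I in order to lie in the space of the product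
  measure.\<close>

definition mix :: "nat set \<Rightarrow> (nat \<Rightarrow> real) \<Rightarrow> (nat \<Rightarrow> real) \<Rightarrow> (nat \<Rightarrow> real) \<Rightarrow> (nat \<Rightarrow> real) \<Rightarrow> nat \<Rightarrow> real" where
  "mix I c s z y = (\<lambda>i\<in>I. c i * z i + s i * y i)"

lemma mix_ext [simp]: "mix I c s z y \<in> extensional I"
  by (simp add: mix_def)

lemma mix_apply [simp]: "i \<in> I \<Longrightarrow> mix I c s z y i = c i * z i + s i * y i"
  by (simp add: mix_def)

lemma mix_restrict [simp]: "mix I c s (restrict z I) y = mix I c s z y" "mix I c s z (restrict y I) = mix I c s z y"
  by (auto simp: mix_def)

lemma measurable_mix [measurable]:
  assumes [measurable]: "f \<in> measurable N (PiM I (\<lambda>_. borel))" "g \<in> measurable N (PiM I (\<lambda>_. borel))"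
  shows "(\<lambda>x. mix I c s (f x) (g x)) \<in> measurable N (PiM I (\<lambda>_. borel))"
  unfolding mix_def by measurable

text \<open>The mixture is the first component of a plane rotation with sine -s, and f ignores the
  second component.\<close>

lemma nn_integral_gauss1_mix:
  assumes [measurable]: "f \<in> borel_measurable borel" and cs: "c\<^sup>2 + s\<^sup>2 = 1"
  shows "(\<integral>\<^sup>+x. \<integral>\<^sup>+y. f (c * x + s * y) \<partial>gauss1 \<partial>gauss1) = (\<integral>\<^sup>+x. f x \<partial>gauss1)"
proof -
  have "(\<integral>\<^sup>+x. \<integral>\<^sup>+y. f (c * x + s * y) \<partial>gauss1 \<partial>gauss1) = (\<integral>\<^sup>+x. \<integral>\<^sup>+y. f (c * x - (-s) * y) \<partial>gauss1 \<partial>gauss1)"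
    by simp
  also have "\<dots> = (\<integral>\<^sup>+x. \<integral>\<^sup>+y. f x \<partial>gauss1 \<partial>gauss1)"
    using cs by (intro nn_integral_rotate[where f="\<lambda>x y. f x" and s="-s" and c=c]) simp_all
  finally show ?thesis by simp
qed

text \<open>Invariance of the Gaussian measure, checked on boxes, where it factors over the coordinates.\<close>

lemma distr_mix:
  assumes I: "finite I" and cs: "\<And>i. i \<in> I \<Longrightarrow> (c i)\<^sup>2 + (s i)\<^sup>2 = 1"
  shows "distr (gauss I \<Otimes>\<^sub>M gauss I) (gauss I) (\<lambda>(x, y). mix I c s x y) = gauss I"
  (is "?L = _")
proof -
  have "?L = PiM I (\<lambda>_. gauss1)"
  proof (rule g1p.PiM_eqI[OF I])
    show "sets ?L = sets (PiM I (\<lambda>_. gauss1))" by (simp add: gauss_def)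
  next
    fix A :: "nat \<Rightarrow> real set" assume "\<And>i. i \<in> I \<Longrightarrow> A i \<in> sets gauss1"
    then have A [measurable]: "\<And>i. i \<in> I \<Longrightarrow> A i \<in> sets borel" by simp
    have box [measurable]: "Pi\<^sub>E I A \<in> sets (gauss I)" unfolding gauss_def using I by measurable
    have ind: "indicator (Pi\<^sub>E I A) (mix I c s x y) = (\<Prod>i\<in>I. indicator (A i) (c i * x i + s i * y i) :: ennreal)" for x y
    proof (cases "mix I c s x y \<in> Pi\<^sub>E I A")
      case True then show ?thesis by (auto simp: PiE_def Pi_def intro!: prod.neutral[symmetric])
    next
      case False
      then obtain i where i: "i \<in> I" "mix I c s x y i \<notin> A i" unfolding PiE_def using mix_ext by blast
      then have "indicator (A i) (c i * x i + s i * y i) = (0::ennreal)" by simp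
      with i I have "(\<Prod>i\<in>I. indicator (A i) (c i * x i + s i * y i)) = (0::ennreal)"
        by (meson prod_zero)
      with False show ?thesis by simp
    qed
    have "emeasure ?L (Pi\<^sub>E I A) = (\<integral>\<^sup>+z. indicator (Pi\<^sub>E I A) z \<partial>?L)"
      by simp
    also have "\<dots> = (\<integral>\<^sup>+p. indicator (Pi\<^sub>E I A) (mix I c s (fst p) (snd p)) \<partial>(gauss I \<Otimes>\<^sub>M gauss I))"
      by (subst nn_integral_distr) (auto simp: case_prod_beta)
    also have "\<dots> = (\<integral>\<^sup>+x. \<integral>\<^sup>+y. indicator (Pi\<^sub>E I A) (mix I c s x y) \<partial>gauss I \<partial>gauss I)"
      by (subst gauss.nn_integral_fst[symmetric]) auto
    also have "\<dots> = (\<integral>\<^sup>+x. (\<Prod>i\<in>I. \<integral>\<^sup>+y. indicator (A i) (c i * x i + s i * y) \<partial>gauss1) \<partial>gauss I)"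
      unfolding ind gauss_def
      by (intro nn_integral_cong g1p.product_nn_integral_prod[OF I, where f="\<lambda>i y. indicator (A i) (c i * _ i + s i * y)"]) measurable
    also have "\<dots> = (\<Prod>i\<in>I. \<integral>\<^sup>+x. \<integral>\<^sup>+y. indicator (A i) (c i * x + s i * y) \<partial>gauss1 \<partial>gauss1)"
      unfolding gauss_def
      by (rule g1p.product_nn_integral_prod[OF I, where f="\<lambda>i x. \<integral>\<^sup>+y. indicator (A i) (c i * x + s i * y) \<partial>gauss1"]) measurable
    also have "\<dots> = (\<Prod>i\<in>I. emeasure gauss1 (A i))"
    proof (rule prod.cong[OF refl])
      fix i assume i: "i \<in> I"
      then have [measurable]: "A i \<in> sets borel" by simp
      have "(\<integral>\<^sup>+x. \<integral>\<^sup>+y. indicator (A i) (c i * x + s i * y) \<partial>gauss1 \<partial>gauss1) = (\<integral>\<^sup>+x. indicator (A i) x \<partial>gauss1)"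
        by (rule nn_integral_gauss1_mix) (use cs i in auto)
      then show "(\<integral>\<^sup>+x. \<integral>\<^sup>+y. indicator (A i) (c i * x + s i * y) \<partial>gauss1 \<partial>gauss1) = emeasure gauss1 (A i)"
        by simp
    qed
    finally show "emeasure ?L (Pi\<^sub>E I A) = (\<Prod>i\<in>I. emeasure gauss1 (A i))" .
  qed
  then show ?thesis by (simp add: gauss_def)
qed


lemma integral_mix:
  fixes F :: "(nat \<Rightarrow> real) \<Rightarrow> real"
  assumes I: "finite I" and cs: "\<And>i. i \<in> I \<Longrightarrow> (c i)\<^sup>2 + (s i)\<^sup>2 = 1"
    and F: "integrable (gauss I) F"
  shows "(\<integral>x. \<integral>y. F (mix I c s x y) \<partial>gauss I \<partial>gauss I) = (\<integral>x. F x \<partial>gauss I)"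
    and "integrable (gauss I \<Otimes>\<^sub>M gauss I) (\<lambda>p. F (mix I c s (fst p) (snd p)))"
    and "integrable (gauss I) (\<lambda>x. \<integral>y. F (mix I c s x y) \<partial>gauss I)"
proof -
  interpret pair_sigma_finite "gauss I" "gauss I" ..
  have [measurable]: "F \<in> borel_measurable (gauss I)" using F by simp
  have m: "(\<lambda>p. mix I c s (fst p) (snd p)) \<in> measurable (gauss I \<Otimes>\<^sub>M gauss I) (gauss I)"
    by measurable
  have d: "distr (gauss I \<Otimes>\<^sub>M gauss I) (gauss I) (\<lambda>p. mix I c s (fst p) (snd p)) = gauss I"
    using distr_mix[OF I, of c s] cs by (simp add: case_prod_beta')
  show i: "integrable (gauss I \<Otimes>\<^sub>M gauss I) (\<lambda>p. F (mix I c s (fst p) (snd p)))"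
    by (rule integrable_distr[OF m]) (simp add: d F)
  have "(\<integral>x. F x \<partial>gauss I) = (\<integral>p. F (mix I c s (fst p) (snd p)) \<partial>(gauss I \<Otimes>\<^sub>M gauss I))"
    by (subst d[symmetric], rule integral_distr[OF m]) measurable
  also have "\<dots> = (\<integral>x. \<integral>y. F (mix I c s x y) \<partial>gauss I \<partial>gauss I)"
    using integral_fst'[OF i] by simp
  finally show "(\<integral>x. \<integral>y. F (mix I c s x y) \<partial>gauss I \<partial>gauss I) = (\<integral>x. F x \<partial>gauss I)" ..
  show "integrable (gauss I) (\<lambda>x. \<integral>y. F (mix I c s x y) \<partial>gauss I)"
    using integrable_fst'[OF i] by simp
qed

text \<open>A reflection is the degenerate mixture with s = 0 and c = -1 in one coordinate, so
  invariance comes from \<open>integral_mix\<close>.\<close>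

lemma integral_flip:
  fixes F :: "(nat \<Rightarrow> real) \<Rightarrow> real"
  assumes I: "finite I" and F: "integrable (gauss I) F"
  shows "(\<integral>x. F (\<lambda>k\<in>I. if k = i then - x k else x k) \<partial>gauss I) = (\<integral>x. F x \<partial>gauss I)"
proof -
  have "mix I (\<lambda>k. if k = i then -1 else 1) (\<lambda>_. 0) x y = (\<lambda>k\<in>I. if k = i then - x k else x k)" for x y
    by (auto simp: mix_def)
  with integral_mix(1)[OF I _ F, of "\<lambda>k. if k = i then -1 else 1" "\<lambda>_. 0"]
  show ?thesis by (simp add: gauss.prob_space)
qed

text \<open>Isolating the coordinates i and j by Fubini leaves a plane rotation for each value of
  the others. Nonnegative integrals are used so that Fubini applies to any measurable f.\<close>

lemma nn_integral_gauss_rot: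
  assumes I: "finite I" and ij: "i \<in> I" "j \<in> I" "i \<noteq> j"
    and f: "f \<in> borel_measurable (gauss I)"
  shows "(\<integral>\<^sup>+z. f (rot i j th z) \<partial>gauss I) = (\<integral>\<^sup>+z. f z \<partial>gauss I)"
proof -
  define J where "J = I - {i, j}"
  have J: "finite J" "j \<notin> J" "i \<notin> insert j J" and eq: "I = insert i (insert j J)"
    using I ij by (auto simp: J_def)
  have fJ: "finite (insert j J)" using J by simp
  have f' [measurable]: "f \<in> borel_measurable (PiM (insert i (insert j J)) (\<lambda>_. gauss1))"
    using f unfolding gauss_def eq by simp
  have rm [measurable]: "rot i j th \<in> measurable (PiM (insert i (insert j J)) (\<lambda>_. gauss1)) (PiM (insert i (insert j J)) (\<lambda>_. gauss1))"
    unfolding rot_def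
    by (intro measurable_fun_upd[where J="insert i (insert j J)"]) (auto simp: insert_absorb)
  have split: "(\<integral>\<^sup>+z. h z \<partial>PiM (insert i (insert j J)) (\<lambda>_. gauss1)) =
     (\<integral>\<^sup>+x. \<integral>\<^sup>+b. \<integral>\<^sup>+a. h (x(j := b, i := a)) \<partial>gauss1 \<partial>gauss1 \<partial>PiM J (\<lambda>_. gauss1))"
    if [measurable]: "h \<in> borel_measurable (PiM (insert i (insert j J)) (\<lambda>_. gauss1))" for h
  proof -
    have [measurable]: "(\<lambda>p. (fst p)(i := snd p)) \<in> measurable (PiM (insert j J) (\<lambda>_. gauss1) \<Otimes>\<^sub>M gauss1) (PiM (insert i (insert j J)) (\<lambda>_. gauss1))"
      by (intro measurable_fun_upd[where J="insert j J"]) auto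
    show ?thesis
      by (subst g1p.product_nn_integral_insert[OF fJ J(3) that],
          subst g1p.product_nn_integral_insert[OF J(1,2)]) (auto intro!: gauss1.borel_measurable_nn_integral simp: case_prod_beta')
  qed
  have "(\<integral>\<^sup>+z. f (rot i j th z) \<partial>PiM (insert i (insert j J)) (\<lambda>_. gauss1)) =
     (\<integral>\<^sup>+x. \<integral>\<^sup>+b. \<integral>\<^sup>+a. f (rot i j th (x(j := b, i := a))) \<partial>gauss1 \<partial>gauss1 \<partial>PiM J (\<lambda>_. gauss1))"
    by (rule split) measurable
  also have "\<dots> = (\<integral>\<^sup>+x. \<integral>\<^sup>+b. \<integral>\<^sup>+a. f (x(j := b, i := a)) \<partial>gauss1 \<partial>gauss1 \<partial>PiM J (\<lambda>_. gauss1))"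
  proof (rule nn_integral_cong)
    fix x assume x: "x \<in> space (PiM J (\<lambda>_. gauss1))"
    \<comment> \<open>The outer variable b sits at j and the inner variable a at i. In the order (b,
      a) the plane rotation has the opposite angle, hence the sine -sin th.\<close>
    have r: "rot i j th (x(j := b, i := a)) = x(j := cos th * b - (- sin th) * a, i := - sin th * b + cos th * a)" for a b
      using ij by (auto simp: rot_def fun_eq_iff mult.commute)
    have [measurable]: "(\<lambda>p. x(j := fst p, i := snd p)) \<in> measurable (borel \<Otimes>\<^sub>M borel) (PiM (insert i (insert j J)) (\<lambda>_. gauss1))"
    proof (rule measurable_fun_upd[where J="insert j J"])
      show "(\<lambda>p. x(j := fst p)) \<in> measurable (borel \<Otimes>\<^sub>M borel) (PiM (insert j J) (\<lambda>_. gauss1))"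
        by (rule measurable_fun_upd[where J=J]) (use x in \<open>auto intro: measurable_const\<close>)
    qed auto
    show "(\<integral>\<^sup>+b. \<integral>\<^sup>+a. f (rot i j th (x(j := b, i := a))) \<partial>gauss1 \<partial>gauss1) = (\<integral>\<^sup>+b. \<integral>\<^sup>+a. f (x(j := b, i := a)) \<partial>gauss1 \<partial>gauss1)"
      unfolding r by (rule nn_integral_rotate[where f="\<lambda>b a. f (x(j := b, i := a))"]) (auto simp: case_prod_beta')
  qed
  also have "\<dots> = (\<integral>\<^sup>+z. f z \<partial>PiM (insert i (insert j J)) (\<lambda>_. gauss1))"
    by (rule split[symmetric]) measurable
  finally show ?thesis unfolding gauss_def eq .
qed

lemma measurable_rot [measurable]:
  assumes ij: "i \<in> I" "j \<in> I"
    and [measurable]: "th \<in> borel_measurable N" "f \<in> measurable N (PiM I (\<lambda>_. borel))"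
  shows "(\<lambda>x. rot i j (th x) (f x)) \<in> measurable N (PiM I (\<lambda>_. borel))"
proof -
  have *: "insert i I = I" "insert j I = I" using ij by auto
  have [measurable]: "(\<lambda>x. f x i) \<in> borel_measurable N" "(\<lambda>x. f x j) \<in> borel_measurable N"
    using ij by measurable
  show ?thesis
    unfolding rot_def by (intro measurable_fun_upd[where J=I]) (auto simp: *)
qed

lemma distr_rot:
  assumes I: "finite I" and ij: "i \<in> I" "j \<in> I" "i \<noteq> j"
  shows "distr (gauss I) (gauss I) (rot i j th) = gauss I"
proof (rule measure_eqI)
  have m [measurable]: "rot i j th \<in> measurable (gauss I) (gauss I)"
    using measurable_rot[OF ij(1,2), of "\<lambda>_. th" "gauss I" "\<lambda>x. x"] by measurable
  fix A assume "A \<in> sets (distr (gauss I) (gauss I) (rot i j th))"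
  then have A [measurable]: "A \<in> sets (gauss I)" by simp
  have "emeasure (distr (gauss I) (gauss I) (rot i j th)) A = (\<integral>\<^sup>+z. indicator A (rot i j th z) \<partial>gauss I)"
    using nn_integral_distr[OF m, of "indicator A"] by simp
  also have "\<dots> = emeasure (gauss I) A"
    by (subst nn_integral_gauss_rot[OF I ij]) auto
  finally show "emeasure (distr (gauss I) (gauss I) (rot i j th)) A = emeasure (gauss I) A" .
qed simp

section \<open>Moments of the Gaussian\<close>

lemma distr_gauss1_component:
  assumes "i \<in> I"
  shows "distr (gauss I) gauss1 (\<lambda>x. x i) = gauss1"
  unfolding gauss_def by (rule distr_PiM_component[OF prob_space_gauss1 assms])

lemma integral_gauss_component:
  fixes f :: "real \<Rightarrow> real"
  assumes "i \<in> I" and [measurable]: "f \<in> borel_measurable borel"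
  shows "(\<integral>x. f (x i) \<partial>gauss I) = (\<integral>x. f x \<partial>gauss1)" "integrable (gauss I) (\<lambda>x. f (x i)) \<longleftrightarrow> integrable gauss1 f"
proof -
  have m: "(\<lambda>x. x i) \<in> measurable (gauss I) gauss1" using assms(1) unfolding gauss_def by measurable
  show "(\<integral>x. f (x i) \<partial>gauss I) = (\<integral>x. f x \<partial>gauss1)"
    by (subst distr_gauss1_component[OF assms(1), symmetric], rule integral_distr[OF m, symmetric]) measurable
  show "integrable (gauss I) (\<lambda>x. f (x i)) \<longleftrightarrow> integrable gauss1 f"
    using integrable_distr_eq[OF m, of f] by (simp add: distr_gauss1_component[OF assms(1)])
qed

lemma integral_gauss1_sq: "(\<integral>x. x\<^sup>2 \<partial>gauss1) = 1 / (2 * pi)"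
proof -
  have "(\<integral>x. x\<^sup>2 \<partial>gauss1) = (\<integral>x. normal_density 0 (1 / sqrt (2 * pi)) x * x\<^sup>2 \<partial>lborel)"
    unfolding gauss1_def exp_eq_normal_density by (subst integral_density) (auto)
  also have "\<dots> = 1 / (2 * pi)"
    using integral_normal_moment_even[of "1 / sqrt (2 * pi)" 0 1] by (simp add: power_divide)
  finally show ?thesis .
qed

text \<open>Completing the square makes exp (k x) times the weight a multiple of a shifted normal
  density, and exp (k |x|) is at most the sum of the exponentials for k and -k.\<close>

lemma integrable_gauss1_exp: "integrable gauss1 (\<lambda>x. exp (k * \<bar>x\<bar>))"
proof -
  have sq: "k * x - pi * x\<^sup>2 = k\<^sup>2 / (4 * pi) - pi * (x - k / (2 * pi))\<^sup>2" for k x :: real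
    by (simp add: power2_eq_square field_simps)
  have *: "integrable lborel (\<lambda>x. exp (- pi * x\<^sup>2) * exp (k * x))" for k :: real
  proof -
    have "integrable lborel (\<lambda>x. exp (k\<^sup>2 / (4 * pi)) * normal_density (k / (2 * pi)) (1 / sqrt (2 * pi)) x)"
      by simp
    also have "(\<lambda>x. exp (k\<^sup>2 / (4 * pi)) * normal_density (k / (2 * pi)) (1 / sqrt (2 * pi)) x)
       = (\<lambda>x. exp (- pi * x\<^sup>2) * exp (k * x))"
    proof
      fix x :: real
      have "normal_density (k / (2 * pi)) (1 / sqrt (2 * pi)) x = exp (- pi * (x - k / (2 * pi))\<^sup>2)"
        by (simp add: normal_density_def power_divide)
      then show "exp (k\<^sup>2 / (4 * pi)) * normal_density (k / (2 * pi)) (1 / sqrt (2 * pi)) x = exp (- pi * x\<^sup>2) * exp (k * x)"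
        using sq[of k x] by (simp add: mult_exp_exp)
    qed
    finally show ?thesis .
  qed
  have "integrable lborel (\<lambda>x. exp (- pi * x\<^sup>2) * exp (k * x) + exp (- pi * x\<^sup>2) * exp ((-k) * x))"
    by (intro Bochner_Integration.integrable_add *)
  then have "integrable lborel (\<lambda>x. exp (- pi * x\<^sup>2) * exp (k * \<bar>x\<bar>))"
  proof (rule Bochner_Integration.integrable_bound)
    have "exp (- pi * x\<^sup>2) * exp (k * \<bar>x\<bar>) \<le> exp (- pi * x\<^sup>2) * exp (k * x) + exp (- pi * x\<^sup>2) * exp ((-k) * x)" for x
      by (cases "x \<ge> 0") simp_all
    then show "AE x in lborel. norm (exp (- pi * x\<^sup>2) * exp (k * \<bar>x\<bar>))
        \<le> norm (exp (- pi * x\<^sup>2) * exp (k * x) + exp (- pi * x\<^sup>2) * exp ((-k) * x))"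
      by (auto intro: order_trans[OF _ abs_ge_self])
  qed auto
  then show ?thesis
    unfolding gauss1_def by (subst integrable_density) auto
qed

lemma integrable_gauss_exp:
  assumes I: "finite I"
  shows "integrable (gauss I) (\<lambda>y. exp (k * (\<Sum>i\<in>I. \<bar>y i\<bar>)))"
proof -
  have "integrable (gauss I) (\<lambda>y. \<Prod>i\<in>I. exp (k * \<bar>y i\<bar>))"
    unfolding gauss_def by (rule g1p.product_integrable_prod[OF I, where f="\<lambda>_ y. exp (k * \<bar>y\<bar>)"]) (rule integrable_gauss1_exp)
  then show ?thesis using I by (simp add: exp_sum sum_distrib_left)
qed

section \<open>Local entropy\<close>

definition phi :: "real \<Rightarrow> real" where
  "phi x = x * ln x"

text \<open>The l1 norm is preferred to the Euclidean one because its exponential factors over the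
  coordinates, so all moments reduce to dimension one.\<close>

definition l1norm :: "nat set \<Rightarrow> (nat \<Rightarrow> real) \<Rightarrow> real" where
  "l1norm I y = (\<Sum>i\<in>I. \<bar>y i\<bar>)"

text \<open>The bound holds at every point of \<open>extensional I\<close>, not merely almost
  everywhere, since mixing and rotation evaluate F at prescribed points. Values off that set are
  invisible to the product measure.\<close>

definition bmeas :: "nat set \<Rightarrow> ((nat \<Rightarrow> real) \<Rightarrow> real) \<Rightarrow> bool" where
  "bmeas I F \<longleftrightarrow> F \<in> borel_measurable (PiM I (\<lambda>_. borel)) \<and> (\<exists>B. \<forall>z\<in>extensional I. \<bar>F z\<bar> \<le> B)"

lemma measurable_phi [measurable]: "phi \<in> borel_measurable borel"
  unfolding phi_def by measurable

lemma measurable_l1norm [measurable]: "l1norm I \<in> borel_measurable (PiM I (\<lambda>_. borel))"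
  unfolding l1norm_def by measurable

lemma l1norm_nonneg [simp]: "0 \<le> l1norm I y"
  by (simp add: l1norm_def sum_nonneg)

lemma l1norm_diff_le: "l1norm I (\<lambda>i. x i - y i) \<le> l1norm I x + l1norm I y"
  unfolding l1norm_def sum.distrib[symmetric] by (intro sum_mono) simp

lemma l1norm_scale: "l1norm I (\<lambda>i. c * x i) = \<bar>c\<bar> * l1norm I x"
  by (simp add: l1norm_def sum_distrib_left abs_mult)

lemma abs_sum_mult_le_l1norm:
  assumes "\<And>i. i \<in> I \<Longrightarrow> \<bar>x i\<bar> \<le> A"
  shows "\<bar>\<Sum>i\<in>I. x i * y i\<bar> \<le> A * l1norm I y"
proof -
  have "\<bar>\<Sum>i\<in>I. x i * y i\<bar> \<le> (\<Sum>i\<in>I. \<bar>x i\<bar> * \<bar>y i\<bar>)"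
    by (rule order_trans[OF sum_abs]) (simp add: abs_mult)
  also have "\<dots> \<le> (\<Sum>i\<in>I. A * \<bar>y i\<bar>)"
    by (intro sum_mono mult_right_mono assms) auto
  finally show ?thesis by (simp add: l1norm_def sum_distrib_left)
qed

text \<open>The third derivative of x ln x is -1/x^2, at most 1/e^2 in modulus on [e, \<infinity>).
  This is why positive lower bounds are carried through the whole argument.\<close>

lemma phi_taylor:
  assumes e: "0 < e" and x: "e \<le> x" and m: "e \<le> m"
  shows "\<bar>phi x - phi m - (ln m + 1) * (x - m) - (x - m)\<^sup>2 / (2 * m)\<bar> \<le> \<bar>x - m\<bar> ^ 3 / (6 * e\<^sup>2)"
proof (cases "x = m")
  case True then show ?thesis by simp
next
  case False
  \<comment> \<open>The successive derivatives of \<open>phi\<close>; only the orders 0 to 3 are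
    evaluated, so the last branch stands for the third.\<close>
  define d where "d = (\<lambda>n::nat. \<lambda>t::real. if n = 0 then phi t else if n = 1 then ln t + 1 else if n = 2 then 1 / t else - (1 / t\<^sup>2))"
  have "\<exists>t. (if x < m then x < t \<and> t < m else m < t \<and> t < x) \<and>
      phi x = (\<Sum>n<3. (d n m / fact n) * (x - m) ^ n) + (d 3 t / fact 3) * (x - m) ^ 3"
  proof (rule Taylor[where a="min x m" and b="max x m"])
    show "\<forall>n t. n < 3 \<and> min x m \<le> t \<and> t \<le> max x m \<longrightarrow> DERIV (d n) t :> d (Suc n) t"
    proof (intro allI impI)
      fix n :: nat and t assume a: "n < 3 \<and> min x m \<le> t \<and> t \<le> max x m"
      then have t: "t > 0" using e x m by auto
      from a consider "n = 0" | "n = 1" | "n = 2" by linarith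
      then show "DERIV (d n) t :> d (Suc n) t"
      proof cases
        case 1 with t show ?thesis
          by (auto simp: d_def phi_def intro!: derivative_eq_intros)
      next
        case 2 with t show ?thesis
          by (auto simp: d_def intro!: derivative_eq_intros)
      next
        case 3 with t show ?thesis
          by (auto simp: d_def power2_eq_square intro!: derivative_eq_intros)
      qed
    qed
  qed (use False in \<open>auto simp: d_def fun_eq_iff\<close>)
  then obtain t where t: "if x < m then x < t \<and> t < m else m < t \<and> t < x"
    and eq: "phi x = (\<Sum>n<3. (d n m / fact n) * (x - m) ^ n) + (d 3 t / fact 3) * (x - m) ^ 3" by blast
  have te: "e \<le> t" using t x m by (auto split: if_splits)
  have "phi x - phi m - (ln m + 1) * (x - m) - (x - m)\<^sup>2 / (2 * m) = - (1 / (6 * t\<^sup>2)) * (x - m) ^ 3"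
    unfolding eq by (simp add: d_def eval_nat_numeral)
  then have "\<bar>phi x - phi m - (ln m + 1) * (x - m) - (x - m)\<^sup>2 / (2 * m)\<bar> = (1 / (6 * t\<^sup>2)) * \<bar>x - m\<bar> ^ 3"
    by (simp add: abs_mult power_abs)
  also have "\<dots> \<le> (1 / (6 * e\<^sup>2)) * \<bar>x - m\<bar> ^ 3"
    using te e by (intro mult_right_mono divide_left_mono mult_left_mono power_mono) auto
  finally show ?thesis by simp
qed

text \<open>This is x ln (x/m) <= x (x/m - 1) rewritten. The quadratic coefficient is twice that of
  Taylor; in exchange the bound is global.\<close>

lemma phi_upper:
  assumes "0 < x" "0 < m"
  shows "phi x \<le> phi m + (ln m + 1) * (x - m) + (x - m)\<^sup>2 / m"
proof -
  have "ln (x / m) \<le> x / m - 1" using assms by (intro ln_le_minus_one) simp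
  then have "x * ln (x / m) \<le> x * (x / m - 1)" using assms by (intro mult_left_mono) auto
  moreover have "x * ln (x / m) = phi x - x * ln m" using assms by (simp add: phi_def ln_div algebra_simps)
  moreover have "phi m + (ln m + 1) * (x - m) + (x - m)\<^sup>2 / m = x * ln m + x * (x / m - 1)"
    using assms by (simp add: phi_def power2_eq_square field_simps)
  ultimately show ?thesis by linarith
qed

lemma phi_tangent:
  assumes "0 \<le> x" "0 < m"
  shows "phi m + (ln m + 1) * (x - m) \<le> phi x"
proof (cases "x = 0")
  case True then show ?thesis using assms by (simp add: phi_def algebra_simps)
next
  case False
  then have x: "x > 0" using assms by simp
  have "ln (m / x) \<le> m / x - 1" using assms x by (intro ln_le_minus_one) simp
  then have "x * ln (m / x) \<le> x * (m / x - 1)" using x by (intro mult_left_mono) auto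
  then have "x * ln m - x * ln x \<le> m - x" using assms x by (simp add: ln_div algebra_simps)
  then show ?thesis by (simp add: phi_def algebra_simps)
qed

section \<open>Bounded functions and their affine approximation in Gaussian L2\<close>

context
  fixes I :: "nat set" assumes I: "finite I"
begin

lemma bmeas_integrable: "bmeas I F \<Longrightarrow> integrable (gauss I) F"
  unfolding bmeas_def
proof (elim conjE exE)
  fix B assume m: "F \<in> borel_measurable (PiM I (\<lambda>_. borel))" and B: "\<forall>z\<in>extensional I. \<bar>F z\<bar> \<le> B"
  have [measurable]: "F \<in> borel_measurable (gauss I)"
    using m by (subst measurable_cong_sets[OF sets_gauss refl])
  show "integrable (gauss I) F"
    by (rule gauss.integrable_const_bound[of _ B]) (use B in \<open>auto simp: space_gauss intro!: AE_I2\<close>)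
qed

lemma bmeas_mult_integrable:
  assumes F: "bmeas I F" and g: "integrable (gauss I) g"
  shows "integrable (gauss I) (\<lambda>y. F y * g y)"
proof -
  from F obtain B where B: "\<forall>z\<in>extensional I. \<bar>F z\<bar> \<le> B" by (auto simp: bmeas_def)
  have [measurable]: "F \<in> borel_measurable (gauss I)" using bmeas_integrable[OF F] by simp
  have [measurable]: "g \<in> borel_measurable (gauss I)" using g by simp
  show ?thesis
  proof (rule Bochner_Integration.integrable_bound)
    show "integrable (gauss I) (\<lambda>y. B * g y)" using g by simp
    show "AE y in gauss I. norm (F y * g y) \<le> norm (B * g y)"
    proof (rule AE_I2)
      fix y assume "y \<in> space (gauss I)"
      then have "\<bar>F y\<bar> \<le> B" using B by (simp add: space_gauss)
      then have "\<bar>F y\<bar> \<le> \<bar>B\<bar>" by simp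
      then show "norm (F y * g y) \<le> norm (B * g y)"
        by (simp add: abs_mult mult_right_mono)
    qed
  qed simp
qed

lemma bmeas_const [simp]: "bmeas I (\<lambda>_. a)"
  by (auto simp: bmeas_def)

lemma bmeas_add: "bmeas I F \<Longrightarrow> bmeas I G \<Longrightarrow> bmeas I (\<lambda>y. F y + G y)"
proof -
  assume F: "bmeas I F" and G: "bmeas I G"
  from F G obtain A B where "\<forall>z\<in>extensional I. \<bar>F z\<bar> \<le> A" "\<forall>z\<in>extensional I. \<bar>G z\<bar> \<le> B"
    by (auto simp: bmeas_def)
  then have "\<forall>z\<in>extensional I. \<bar>F z + G z\<bar> \<le> A + B"
    by (meson abs_triangle_ineq add_mono order_trans)
  with F G show ?thesis unfolding bmeas_def by (auto intro!: exI[of _ "A + B"])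
qed

lemma bmeas_mult: "bmeas I F \<Longrightarrow> bmeas I G \<Longrightarrow> bmeas I (\<lambda>y. F y * G y)"
proof -
  assume F: "bmeas I F" and G: "bmeas I G"
  from F G obtain A B where "\<forall>z\<in>extensional I. \<bar>F z\<bar> \<le> A" "\<forall>z\<in>extensional I. \<bar>G z\<bar> \<le> B"
    by (auto simp: bmeas_def)
  then have "\<forall>z\<in>extensional I. \<bar>F z * G z\<bar> \<le> A * B"
    by (auto simp: abs_mult intro!: mult_mono intro: order_trans[OF abs_ge_zero])
  with F G show ?thesis unfolding bmeas_def by (auto intro!: exI[of _ "A * B"])
qed

lemma bmeas_diff: "bmeas I F \<Longrightarrow> bmeas I G \<Longrightarrow> bmeas I (\<lambda>y. F y - G y)"
  using bmeas_add[of F "\<lambda>y. (-1) * G y"] bmeas_mult[of "\<lambda>_. -1" G] by simp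

lemma bmeas_range:
  assumes "F \<in> borel_measurable (PiM I (\<lambda>_. borel))" "\<And>z. z \<in> extensional I \<Longrightarrow> e \<le> F z \<and> F z \<le> B"
  shows "bmeas I F"
  unfolding bmeas_def
proof (intro conjI exI ballI)
  fix z :: "nat \<Rightarrow> real" assume "z \<in> extensional I"
  then show "\<bar>F z\<bar> \<le> \<bar>e\<bar> + \<bar>B\<bar>" using assms(2)[of z] by linarith
qed fact

lemma bmeas_mix: "bmeas I F \<Longrightarrow> bmeas I (\<lambda>y. F (mix I c s z y))"
  unfolding bmeas_def
proof (elim conjE exE, intro conjI)
  fix B assume [measurable]: "F \<in> borel_measurable (PiM I (\<lambda>_. borel))" and B: "\<forall>z\<in>extensional I. \<bar>F z\<bar> \<le> B"
  have "(\<lambda>y. mix I c s (restrict z I) y) \<in> measurable (PiM I (\<lambda>_. borel)) (PiM I (\<lambda>_. borel))"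
    by (rule measurable_mix) (auto intro!: measurable_const simp: space_PiM)
  then show "(\<lambda>y. F (mix I c s z y)) \<in> borel_measurable (PiM I (\<lambda>_. borel))" by simp
  show "\<exists>B. \<forall>y\<in>extensional I. \<bar>F (mix I c s z y)\<bar> \<le> B" using B by (intro exI[of _ B]) auto
qed

text \<open>A single term of the exponential series; it reduces every polynomial moment to an
  exponential one.\<close>

lemma power_le_fact_exp: "0 \<le> t \<Longrightarrow> t ^ n \<le> fact n * exp (t::real)"
proof -
  assume t: "0 \<le> t"
  have "(\<Sum>k\<in>{n}. inverse (fact k) *\<^sub>R t ^ k) \<le> (\<Sum>k. inverse (fact k) *\<^sub>R t ^ k)"
    using summable_exp_generic[of t] t by (intro sum_le_suminf) auto
  then have "inverse (fact n) * t ^ n \<le> exp t" by (simp add: exp_def)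
  then show ?thesis by (simp add: field_simps)
qed

lemma integrable_l1norm_exp: "integrable (gauss I) (\<lambda>y. exp (k * l1norm I y))"
  unfolding l1norm_def by (rule integrable_gauss_exp[OF I])

lemma measurable_gauss_l1norm [measurable]: "l1norm I \<in> borel_measurable (gauss I)"
  using measurable_l1norm by (subst measurable_cong_sets[OF sets_gauss refl])

lemma integrable_l1norm_pow: "integrable (gauss I) (\<lambda>y. (l1norm I y + a) ^ n)" if a: "a \<ge> 0"
proof (rule Bochner_Integration.integrable_bound)
  show "integrable (gauss I) (\<lambda>y. fact n * exp a * exp (1 * l1norm I y))"
    by (intro integrable_mult_right integrable_l1norm_exp)
  have "(l1norm I y + a) ^ n \<le> fact n * exp (l1norm I y + a)" for y
    using a by (intro power_le_fact_exp) simp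
  then show "AE y in gauss I. norm ((l1norm I y + a) ^ n) \<le> norm (fact n * exp a * exp (1 * l1norm I y))"
    using a by (auto simp: exp_add mult_ac abs_mult)
qed measurable

lemma integrable_l1norm: "integrable (gauss I) (l1norm I)"
  using integrable_l1norm_pow[of 0 1] by simp

lemma coord_measurable [measurable]: "i \<in> I \<Longrightarrow> (\<lambda>y. y i) \<in> borel_measurable (gauss I)"
  unfolding gauss_def by measurable

lemma abs_coord_le_l1norm: "i \<in> I \<Longrightarrow> \<bar>y i\<bar> \<le> l1norm I y"
  unfolding l1norm_def by (rule member_le_sum[of i I "\<lambda>i. \<bar>y i\<bar>"]) (use I in auto)

lemma integrable_coord: "i \<in> I \<Longrightarrow> integrable (gauss I) (\<lambda>y. y i)"
  by (rule Bochner_Integration.integrable_bound[OF integrable_l1norm]) (auto intro: abs_coord_le_l1norm)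

lemma integrable_coord2: "i \<in> I \<Longrightarrow> j \<in> I \<Longrightarrow> integrable (gauss I) (\<lambda>y. y i * y j)"
proof (rule Bochner_Integration.integrable_bound)
  assume ij: "i \<in> I" "j \<in> I"
  show "integrable (gauss I) (\<lambda>y. (l1norm I y + 0) ^ 2)" by (rule integrable_l1norm_pow) simp
  show "(\<lambda>y. y i * y j) \<in> borel_measurable (gauss I)" using ij by measurable
  show "AE y in gauss I. norm (y i * y j) \<le> norm ((l1norm I y + 0)\<^sup>2)"
    using ij by (auto simp: abs_mult power2_eq_square intro!: mult_mono abs_coord_le_l1norm)
qed

text \<open>The integrand is odd under reflection of the i-th coordinate. This gives the vanishing
  means and covariances, and later the absence of a gradient in coordinates on which a function does
  not depend.\<close>

lemma integral_coord_flip: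
  assumes i: "i \<in> I" and int: "integrable (gauss I) (\<lambda>y. F y * y i)"
    and F: "\<And>y. F (\<lambda>k\<in>I. if k = i then - y k else y k) = F y"
  shows "(\<integral>y. F y * y i \<partial>gauss I) = 0"
  using integral_flip[OF I int, of i] i by (simp add: F)

lemma integral_coord: "i \<in> I \<Longrightarrow> (\<integral>y. y i \<partial>gauss I) = 0"
  using integral_coord_flip[of i "\<lambda>_. 1"] integrable_coord[of i] by simp

lemma integral_coord2:
  assumes ij: "i \<in> I" "j \<in> I"
  shows "(\<integral>y. y i * y j \<partial>gauss I) = (if i = j then 1 / (2 * pi) else 0)"
proof (cases "i = j")
  case True
  then show ?thesis using integral_gauss_component(1)[of i I "\<lambda>x. x\<^sup>2"] ij integral_gauss1_sq
    by (simp add: power2_eq_square)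
next
  case False
  then show ?thesis
    using integral_coord_flip[of j "\<lambda>y. y i"] integrable_coord2[of i j] ij by simp
qed

text \<open>The coordinates are centred, pairwise orthogonal and of square norm 1/(2 pi), so the
  squared distance from G to an affine function splits. The numbers \<open>b i\<close> are the first
  Hermite coefficients of G.\<close>

lemma variance_expand:
  assumes G: "bmeas I G"
  defines "m \<equiv> (\<integral>y. G y \<partial>gauss I)" and "b \<equiv> \<lambda>i. \<integral>y. G y * y i \<partial>gauss I"
  shows "integrable (gauss I) (\<lambda>y. (G y - a - (\<Sum>i\<in>I. l i * y i))\<^sup>2)"
    and "(\<integral>y. (G y - a - (\<Sum>i\<in>I. l i * y i))\<^sup>2 \<partial>gauss I) =
      (\<integral>y. (G y - m)\<^sup>2 \<partial>gauss I) + (m - a)\<^sup>2 - (\<Sum>i\<in>I. 2 * l i * b i) + (\<Sum>i\<in>I. (l i)\<^sup>2 / (2 * pi))"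
proof -
  note [simp] = bmeas_integrable[OF G]
  have Gm: "bmeas I (\<lambda>y. G y - m)" by (rule bmeas_diff[OF G bmeas_const])
  have G2: "integrable (gauss I) (\<lambda>y. (G y - m)\<^sup>2)"
    using bmeas_integrable[OF bmeas_mult[OF Gm Gm]] by (simp add: power2_eq_square)
  have Gy: "integrable (gauss I) (\<lambda>y. G y * y i)" if "i \<in> I" for i
    by (rule bmeas_mult_integrable[OF G integrable_coord[OF that]])
  have eq: "(G y - a - (\<Sum>i\<in>I. l i * y i))\<^sup>2 =
     (((G y - m)\<^sup>2 + 2 * (m - a) * (G y - m) + (m - a)\<^sup>2) - (\<Sum>i\<in>I. 2 * l i * (G y * y i) - 2 * a * l i * y i))
       + (\<Sum>i\<in>I. \<Sum>j\<in>I. l i * l j * (y i * y j))" for y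
  proof -
    have "(\<Sum>i\<in>I. 2 * l i * (G y * y i) - 2 * a * l i * y i) = 2 * (G y - a) * (\<Sum>i\<in>I. l i * y i)"
      unfolding sum_distrib_left by (intro sum.cong) (auto simp: algebra_simps)
    moreover have "(\<Sum>i\<in>I. \<Sum>j\<in>I. l i * l j * (y i * y j)) = (\<Sum>i\<in>I. l i * y i)\<^sup>2"
      unfolding power2_eq_square sum_product by (intro sum.cong) (auto simp: algebra_simps)
    ultimately show ?thesis by (simp add: power2_eq_square algebra_simps)
  qed
  have i1: "integrable (gauss I) (\<lambda>y. (G y - m)\<^sup>2 + 2 * (m - a) * (G y - m) + (m - a)\<^sup>2)"
    using G2 by (intro Bochner_Integration.integrable_add integrable_mult_right) auto
  have i2: "integrable (gauss I) (\<lambda>y. \<Sum>i\<in>I. 2 * l i * (G y * y i) - 2 * a * l i * y i)"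
    by (intro Bochner_Integration.integrable_sum Bochner_Integration.integrable_diff integrable_mult_right Gy integrable_coord)
  have i3: "integrable (gauss I) (\<lambda>y. \<Sum>i\<in>I. \<Sum>j\<in>I. l i * l j * (y i * y j))"
    by (intro Bochner_Integration.integrable_sum integrable_mult_right integrable_coord2)
  show "integrable (gauss I) (\<lambda>y. (G y - a - (\<Sum>i\<in>I. l i * y i))\<^sup>2)"
    unfolding eq by (intro Bochner_Integration.integrable_add Bochner_Integration.integrable_diff i1 i2 i3)
  have "(\<integral>y. (G y - a - (\<Sum>i\<in>I. l i * y i))\<^sup>2 \<partial>gauss I) =
     (\<integral>y. (G y - m)\<^sup>2 + 2 * (m - a) * (G y - m) + (m - a)\<^sup>2 \<partial>gauss I)
      - (\<integral>y. (\<Sum>i\<in>I. 2 * l i * (G y * y i) - 2 * a * l i * y i) \<partial>gauss I)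
      + (\<integral>y. (\<Sum>i\<in>I. \<Sum>j\<in>I. l i * l j * (y i * y j)) \<partial>gauss I)"
    unfolding eq by (simp only: Bochner_Integration.integral_add Bochner_Integration.integral_diff
        Bochner_Integration.integrable_diff i1 i2 i3)
  also have "(\<integral>y. (G y - m)\<^sup>2 + 2 * (m - a) * (G y - m) + (m - a)\<^sup>2 \<partial>gauss I) = (\<integral>y. (G y - m)\<^sup>2 \<partial>gauss I) + (m - a)\<^sup>2"
    using G2 by (simp add: gauss.prob_space m_def[symmetric])
  also have "(\<integral>y. (\<Sum>i\<in>I. 2 * l i * (G y * y i) - 2 * a * l i * y i) \<partial>gauss I) = (\<Sum>i\<in>I. 2 * l i * b i)"
    by (subst Bochner_Integration.integral_sum)
       (auto intro!: sum.cong Bochner_Integration.integrable_diff integrable_mult_right Gy integrable_coord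
             simp: integral_coord b_def Gy integrable_coord)
  also have "(\<integral>y. (\<Sum>i\<in>I. \<Sum>j\<in>I. l i * l j * (y i * y j)) \<partial>gauss I) = (\<Sum>i\<in>I. \<Sum>j\<in>I. l i * l j * (if i = j then 1 / (2 * pi) else 0))"
    by (subst Bochner_Integration.integral_sum)
       (auto intro!: sum.cong Bochner_Integration.integrable_sum integrable_mult_right integrable_coord2
          simp: Bochner_Integration.integral_sum integral_coord2 integrable_coord2)
  also have "\<dots> = (\<Sum>i\<in>I. (l i)\<^sup>2 / (2 * pi))"
    using I by (intro sum.cong) (auto simp: if_distrib[of "\<lambda>x. _ * x"] sum.delta power2_eq_square cong: if_cong)
  finally show "(\<integral>y. (G y - a - (\<Sum>i\<in>I. l i * y i))\<^sup>2 \<partial>gauss I) =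
      (\<integral>y. (G y - m)\<^sup>2 \<partial>gauss I) + (m - a)\<^sup>2 - (\<Sum>i\<in>I. 2 * l i * b i) + (\<Sum>i\<in>I. (l i)\<^sup>2 / (2 * pi))" .
qed

text \<open>The first bound is Bessel's inequality for the linear functions. The second says that
  its defect is at most the squared L2 distance from G to any affine function whatsoever.\<close>

lemma variance_bounds:
  assumes G: "bmeas I G"
  defines "m \<equiv> (\<integral>y. G y \<partial>gauss I)" and "b \<equiv> \<lambda>i. \<integral>y. G y * y i \<partial>gauss I"
  shows "2 * pi * (\<Sum>i\<in>I. (b i)\<^sup>2) \<le> (\<integral>y. (G y - m)\<^sup>2 \<partial>gauss I)"
    and "(\<integral>y. (G y - m)\<^sup>2 \<partial>gauss I) \<le> 2 * pi * (\<Sum>i\<in>I. (b i)\<^sup>2) + (\<integral>y. (G y - a - (\<Sum>i\<in>I. l i * y i))\<^sup>2 \<partial>gauss I)"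
proof -
  \<comment> \<open>The coefficients 2 pi b_i give the orthogonal projection onto affine
    functions.\<close>
  have "0 \<le> (\<integral>y. (G y - m - (\<Sum>i\<in>I. (2 * pi * b i) * y i))\<^sup>2 \<partial>gauss I)" by simp
  also have "\<dots> = (\<integral>y. (G y - m)\<^sup>2 \<partial>gauss I) + (m - m)\<^sup>2 - (\<Sum>i\<in>I. 2 * (2 * pi * b i) * b i) + (\<Sum>i\<in>I. (2 * pi * b i)\<^sup>2 / (2 * pi))"
    unfolding m_def b_def by (rule variance_expand[OF G])
  also have "(\<Sum>i\<in>I. 2 * (2 * pi * b i) * b i) = 4 * pi * (\<Sum>i\<in>I. (b i)\<^sup>2)"
    unfolding sum_distrib_left by (intro sum.cong) (auto simp: power2_eq_square)
  also have "(\<Sum>i\<in>I. (2 * pi * b i)\<^sup>2 / (2 * pi)) = 2 * pi * (\<Sum>i\<in>I. (b i)\<^sup>2)"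
    unfolding sum_distrib_left by (intro sum.cong) (auto simp: power2_eq_square)
  finally show "2 * pi * (\<Sum>i\<in>I. (b i)\<^sup>2) \<le> (\<integral>y. (G y - m)\<^sup>2 \<partial>gauss I)" by simp
  \<comment> \<open>The excess caused by using slopes l instead of the optimal ones is a sum of
    squares.\<close>
  have "0 \<le> (\<Sum>i\<in>I. (l i - 2 * pi * b i)\<^sup>2 / (2 * pi))" by (intro sum_nonneg) simp
  also have "\<dots> = (\<Sum>i\<in>I. (l i)\<^sup>2 / (2 * pi)) - (\<Sum>i\<in>I. 2 * l i * b i) + 2 * pi * (\<Sum>i\<in>I. (b i)\<^sup>2)"
    unfolding sum_distrib_left sum_subtractf[symmetric] sum.distrib[symmetric]
    by (intro sum.cong) (auto simp: power2_eq_square field_simps)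
  finally show "(\<integral>y. (G y - m)\<^sup>2 \<partial>gauss I) \<le> 2 * pi * (\<Sum>i\<in>I. (b i)\<^sup>2) + (\<integral>y. (G y - a - (\<Sum>i\<in>I. l i * y i))\<^sup>2 \<partial>gauss I)"
    using variance_expand(2)[OF G, of a l] zero_le_power2[of "m - a"] unfolding m_def b_def by linarith
qed

text \<open>Below, the tangent at 1 gives phi x >= x - 1 >= -1; above, \<open>phi_upper\<close> at 1
  gives phi x <= x^2 - x.\<close>

lemma bmeas_phi:
  assumes G: "bmeas I G" and nn: "\<And>z. z \<in> extensional I \<Longrightarrow> 0 \<le> G z"
  shows "bmeas I (\<lambda>y. phi (G y))"
proof -
  from G obtain B where B: "\<forall>z\<in>extensional I. \<bar>G z\<bar> \<le> B" and [measurable]: "G \<in> borel_measurable (PiM I (\<lambda>_. borel))"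
    by (auto simp: bmeas_def)
  show ?thesis
  proof (rule bmeas_range)
    fix z :: "nat \<Rightarrow> real" assume z: "z \<in> extensional I"
    with B nn have x: "0 \<le> G z" "G z \<le> B" by force+
    have "-1 \<le> phi (G z)" using phi_tangent[of "G z" 1] x by (simp add: phi_def)
    moreover have "phi (G z) \<le> B\<^sup>2"
    proof (cases "G z = 0")
      case False
      then have "phi (G z) \<le> (G z)\<^sup>2 - G z"
        using phi_upper[of "G z" 1] x by (simp add: phi_def power2_eq_square algebra_simps)
      also have "\<dots> \<le> B\<^sup>2 - 0" using x by (intro diff_mono power_mono)
      finally show ?thesis by simp
    qed (simp add: phi_def)
    ultimately show "-1 \<le> phi (G z) \<and> phi (G z) \<le> B\<^sup>2" by simp
  qed measurable
qed

text \<open>Expand \<open>phi\<close> at the mean m: the linear term integrates to zero and the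
  quadratic term is the variance over 2m. Bessel bounds the variance below by 2 pi |b|^2; for the
  upper bound the distance to an affine function is added. The cruder third estimate comes from
  \<open>phi_upper\<close>, and the fourth is Jensen's inequality.\<close>

lemma local_entropy:
  assumes m [measurable]: "G \<in> borel_measurable (PiM I (\<lambda>_. borel))"
    and e: "0 < e" and R: "\<And>z. z \<in> extensional I \<Longrightarrow> e \<le> G z \<and> G z \<le> B"
  defines "m \<equiv> (\<integral>y. G y \<partial>gauss I)" and "b \<equiv> \<lambda>i. \<integral>y. G y * y i \<partial>gauss I"
  shows "pi * (\<Sum>i\<in>I. (b i)\<^sup>2) / m - (\<integral>y. \<bar>G y - m\<bar> ^ 3 \<partial>gauss I) / (6 * e\<^sup>2) \<le> (\<integral>y. phi (G y) \<partial>gauss I) - phi m"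
    and "(\<integral>y. phi (G y) \<partial>gauss I) - phi m \<le> pi * (\<Sum>i\<in>I. (b i)\<^sup>2) / m + (\<integral>y. \<bar>G y - m\<bar> ^ 3 \<partial>gauss I) / (6 * e\<^sup>2)
           + (\<integral>y. (G y - a - (\<Sum>i\<in>I. l i * y i))\<^sup>2 \<partial>gauss I) / (2 * e)"
    and "(\<integral>y. phi (G y) \<partial>gauss I) - phi m \<le> (\<integral>y. (G y - m)\<^sup>2 \<partial>gauss I) / e"
    and "phi m \<le> (\<integral>y. phi (G y) \<partial>gauss I)"
proof -
  have G: "bmeas I G" by (rule bmeas_range[OF m R])
  have phii [simp]: "integrable (gauss I) (\<lambda>y. phi (G y))"
    by (rule bmeas_integrable[OF bmeas_phi[OF G]]) (use R e in force)
  note [simp] = bmeas_integrable[OF G]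
  have me: "e \<le> m"
  proof -
    have "e = (\<integral>y. e \<partial>gauss I)" by (simp add: gauss.prob_space)
    also have "\<dots> \<le> m" unfolding m_def by (intro integral_mono) (use R in \<open>auto simp: space_gauss\<close>)
    finally show ?thesis .
  qed
  have Gm: "bmeas I (\<lambda>y. G y - m)" by (rule bmeas_diff[OF G bmeas_const])
  have G2: "integrable (gauss I) (\<lambda>y. (G y - m)\<^sup>2)"
    using bmeas_integrable[OF bmeas_mult[OF Gm Gm]] by (simp add: power2_eq_square)
  have "integrable (gauss I) (\<lambda>y. (G y - m) ^ 3)"
    using bmeas_integrable[OF bmeas_mult[OF Gm bmeas_mult[OF Gm Gm]]] by (simp add: power3_eq_cube mult_ac)
  then have G3: "integrable (gauss I) (\<lambda>y. \<bar>G y - m\<bar> ^ 3)"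
    using Bochner_Integration.integrable_abs[of "gauss I" "\<lambda>y. (G y - m) ^ 3"] by (simp add: power_abs)
  let ?V = "\<integral>y. (G y - m)\<^sup>2 \<partial>gauss I" and ?T = "\<integral>y. \<bar>G y - m\<bar> ^ 3 \<partial>gauss I" and ?P = "\<integral>y. phi (G y) \<partial>gauss I"
  have lin: "(\<integral>y. (ln m + 1) * (G y - m) \<partial>gauss I) = 0"
    by (simp add: m_def[symmetric] gauss.prob_space)
  have lini: "integrable (gauss I) (\<lambda>y. (ln m + 1) * (G y - m))" by simp
  have lo: "?V / (2 * m) - ?T / (6 * e\<^sup>2) \<le> ?P - phi m" and up: "?P - phi m \<le> ?V / (2 * m) + ?T / (6 * e\<^sup>2)"
  proof -
    have b: "\<bar>phi (G y) - phi m - (ln m + 1) * (G y - m) - (G y - m)\<^sup>2 / (2 * m)\<bar> \<le> \<bar>G y - m\<bar> ^ 3 / (6 * e\<^sup>2)"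
      if "y \<in> space (gauss I)" for y
      using phi_taylor[OF e _ me, of "G y"] R[of y] that by (simp add: space_gauss)
    have "(\<integral>y. phi m + (ln m + 1) * (G y - m) + (G y - m)\<^sup>2 / (2 * m) - \<bar>G y - m\<bar> ^ 3 / (6 * e\<^sup>2) \<partial>gauss I) \<le> ?P"
    proof (intro integral_mono)
      fix y assume "y \<in> space (gauss I)"
      from b[OF this] show "phi m + (ln m + 1) * (G y - m) + (G y - m)\<^sup>2 / (2 * m) - \<bar>G y - m\<bar> ^ 3 / (6 * e\<^sup>2) \<le> phi (G y)"
        by linarith
    qed (use G2 G3 lini in auto)
    also have "(\<integral>y. phi m + (ln m + 1) * (G y - m) + (G y - m)\<^sup>2 / (2 * m) - \<bar>G y - m\<bar> ^ 3 / (6 * e\<^sup>2) \<partial>gauss I)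
       = phi m + ?V / (2 * m) - ?T / (6 * e\<^sup>2)"
      using G2 G3 lini lin by (simp add: gauss.prob_space del: integral_mult_right_zero)
    finally show "?V / (2 * m) - ?T / (6 * e\<^sup>2) \<le> ?P - phi m" by simp
    have "?P \<le> (\<integral>y. phi m + (ln m + 1) * (G y - m) + (G y - m)\<^sup>2 / (2 * m) + \<bar>G y - m\<bar> ^ 3 / (6 * e\<^sup>2) \<partial>gauss I)"
    proof (intro integral_mono)
      fix y assume "y \<in> space (gauss I)"
      from b[OF this] show "phi (G y) \<le> phi m + (ln m + 1) * (G y - m) + (G y - m)\<^sup>2 / (2 * m) + \<bar>G y - m\<bar> ^ 3 / (6 * e\<^sup>2)"
        by linarith
    qed (use G2 G3 lini in auto)
    also have "(\<integral>y. phi m + (ln m + 1) * (G y - m) + (G y - m)\<^sup>2 / (2 * m) + \<bar>G y - m\<bar> ^ 3 / (6 * e\<^sup>2) \<partial>gauss I)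
       = phi m + ?V / (2 * m) + ?T / (6 * e\<^sup>2)"
      using G2 G3 lini lin by (simp add: gauss.prob_space del: integral_mult_right_zero)
    finally show "?P - phi m \<le> ?V / (2 * m) + ?T / (6 * e\<^sup>2)" by simp
  qed
  have mpos: "m > 0" using me e by simp
  have vb1: "pi * (\<Sum>i\<in>I. (b i)\<^sup>2) / m \<le> ?V / (2 * m)"
  proof -
    have "2 * pi * (\<Sum>i\<in>I. (b i)\<^sup>2) \<le> ?V" unfolding b_def m_def by (rule variance_bounds[OF G])
    then have "2 * pi * (\<Sum>i\<in>I. (b i)\<^sup>2) / (2 * m) \<le> ?V / (2 * m)" using mpos by (intro divide_right_mono) auto
    then show ?thesis by simp
  qed
  with lo show "pi * (\<Sum>i\<in>I. (b i)\<^sup>2) / m - ?T / (6 * e\<^sup>2) \<le> ?P - phi m" by linarith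
  let ?R = "\<integral>y. (G y - a - (\<Sum>i\<in>I. l i * y i))\<^sup>2 \<partial>gauss I"
  have "?V \<le> 2 * pi * (\<Sum>i\<in>I. (b i)\<^sup>2) + ?R" unfolding b_def m_def by (rule variance_bounds[OF G])
  then have "?V / (2 * m) \<le> (2 * pi * (\<Sum>i\<in>I. (b i)\<^sup>2) + ?R) / (2 * m)" using mpos by (intro divide_right_mono) auto
  also have "\<dots> = pi * (\<Sum>i\<in>I. (b i)\<^sup>2) / m + ?R / (2 * m)" by (simp add: add_divide_distrib)
  also have "?R / (2 * m) \<le> ?R / (2 * e)"
    using me e mpos by (intro divide_left_mono) (auto)
  finally show "?P - phi m \<le> pi * (\<Sum>i\<in>I. (b i)\<^sup>2) / m + ?T / (6 * e\<^sup>2) + ?R / (2 * e)"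
    using up by linarith
  have "?P \<le> (\<integral>y. phi m + (ln m + 1) * (G y - m) + (G y - m)\<^sup>2 / m \<partial>gauss I)"
  proof (intro integral_mono)
    fix y assume "y \<in> space (gauss I)"
    then show "phi (G y) \<le> phi m + (ln m + 1) * (G y - m) + (G y - m)\<^sup>2 / m"
      using R[of y] e mpos by (intro phi_upper) (auto simp: space_gauss)
  qed (use G2 lini in auto)
  also have "\<dots> = phi m + ?V / m"
    using G2 lini lin by (simp add: gauss.prob_space del: integral_mult_right_zero)
  also have "?V / m \<le> ?V / e" using me e mpos by (intro divide_left_mono) auto
  finally show "?P - phi m \<le> ?V / e" by simp
  have "phi m = (\<integral>y. phi m + (ln m + 1) * (G y - m) \<partial>gauss I)"
    using lini lin by (simp add: gauss.prob_space del: integral_mult_right_zero)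
  also have "\<dots> \<le> ?P"
  proof (intro integral_mono)
    fix y assume "y \<in> space (gauss I)"
    then show "phi m + (ln m + 1) * (G y - m) \<le> phi (G y)"
      using R[of y] e mpos by (intro phi_tangent) (auto simp: space_gauss)
  qed (use lini in auto)
  finally show "phi m \<le> ?P" .
qed

end

declare coord_measurable [measurable del]

section \<open>The Mehler operator\<close>

text \<open>For constant c and s with c^2 + s^2 = 1 this is the Ornstein-Uhlenbeck operator at the
  time t with exp (-t) = c. The normalisation is imposed where invariance of the measure is
  used.\<close>

definition mehler :: "nat set \<Rightarrow> (nat \<Rightarrow> real) \<Rightarrow> (nat \<Rightarrow> real) \<Rightarrow> ((nat \<Rightarrow> real) \<Rightarrow> real) \<Rightarrow> (nat \<Rightarrow> real) \<Rightarrow> real" where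
  "mehler I c s F z = (\<integral>y. F (mix I c s z y) \<partial>gauss I)"

text \<open>By Gaussian integration by parts, a multiple of the \<open>i\<close>-th partial derivative of \<open>mehler I c s F\<close>;
  no differentiability of \<open>F\<close> is needed.\<close>

definition hermite :: "nat set \<Rightarrow> (nat \<Rightarrow> real) \<Rightarrow> (nat \<Rightarrow> real) \<Rightarrow> nat \<Rightarrow> ((nat \<Rightarrow> real) \<Rightarrow> real) \<Rightarrow> (nat \<Rightarrow> real) \<Rightarrow> real" where
  "hermite I c s i F z = (\<integral>y. F (mix I c s z y) * y i \<partial>gauss I)"

text \<open>For constant nonzero c and s and w = 1 this is (s / (2 pi c))^2 times the Fisher
  information of the smoothed function. The prefactor is the same for a function and its image under
  collisions, so it cancels in comparisons. The weights w record a diagonal quadratic form in the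
  gradient.\<close>

definition fisher :: "nat set \<Rightarrow> (nat \<Rightarrow> real) \<Rightarrow> (nat \<Rightarrow> real) \<Rightarrow> (nat \<Rightarrow> real) \<Rightarrow> ((nat \<Rightarrow> real) \<Rightarrow> real) \<Rightarrow> real" where
  "fisher I c s w F = (\<integral>z. (\<Sum>i\<in>I. w i * (hermite I c s i F z)\<^sup>2) / mehler I c s F z \<partial>gauss I)"

definition ent :: "nat set \<Rightarrow> ((nat \<Rightarrow> real) \<Rightarrow> real) \<Rightarrow> real" where
  "ent I F = (\<integral>z. phi (F z) \<partial>gauss I)"

definition between :: "nat set \<Rightarrow> real \<Rightarrow> real \<Rightarrow> ((nat \<Rightarrow> real) \<Rightarrow> real) \<Rightarrow> bool" where
  "between I e B F \<longleftrightarrow> F \<in> borel_measurable (PiM I (\<lambda>_. borel)) \<and> (\<forall>z\<in>extensional I. e \<le> F z \<and> F z \<le> B)"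

definition lipschitz_l1 :: "nat set \<Rightarrow> real \<Rightarrow> ((nat \<Rightarrow> real) \<Rightarrow> real) \<Rightarrow> bool" where
  "lipschitz_l1 I L F \<longleftrightarrow> (\<forall>x\<in>extensional I. \<forall>y\<in>extensional I. \<bar>F y - F x\<bar> \<le> L * l1norm I (\<lambda>i. y i - x i))"

text \<open>A candidate gradient with quadratic remainder. It is required bounded and measurable so
  that it can itself be averaged by \<open>mehler\<close>.\<close>

definition taylor_l1 :: "nat set \<Rightarrow> real \<Rightarrow> ((nat \<Rightarrow> real) \<Rightarrow> real) \<Rightarrow> bool" where
  "taylor_l1 I H F \<longleftrightarrow> (\<exists>D. (\<forall>i\<in>I. bmeas I (D i)) \<and> (\<forall>x\<in>extensional I. \<forall>y\<in>extensional I.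
     \<bar>F y - F x - (\<Sum>i\<in>I. D i x * (y i - x i))\<bar> \<le> H * (l1norm I (\<lambda>i. y i - x i))\<^sup>2))"

lemma space_PiM_borel [simp]: "space (PiM I (\<lambda>_. borel :: real measure)) = extensional I"
  by (simp add: space_PiM PiE_def)

lemma measurable_PiM_gauss:
  "f \<in> borel_measurable (PiM I (\<lambda>_. borel)) \<longleftrightarrow> f \<in> borel_measurable (gauss I)"
  by (simp add: measurable_cong_sets[OF sets_gauss refl])

lemma measurable_integral_mix:
  fixes F :: "(nat \<Rightarrow> real) \<Rightarrow> real"
  assumes [measurable]: "F \<in> borel_measurable (PiM I (\<lambda>_. borel))" "f \<in> borel_measurable (gauss I)"
  shows "(\<lambda>z. \<integral>y. F (mix I c s z y) * f y \<partial>gauss I) \<in> borel_measurable (PiM I (\<lambda>_. borel :: real measure))"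
proof -
  have m: "(\<lambda>p. snd p) \<in> measurable (PiM I (\<lambda>_. borel) \<Otimes>\<^sub>M gauss I) (PiM I (\<lambda>_. borel :: real measure))"
    using measurable_snd by (simp cong: measurable_cong_sets add: sets_gauss)
  have [measurable]: "(\<lambda>p. mix I c s (fst p) (snd p)) \<in> measurable (PiM I (\<lambda>_. borel) \<Otimes>\<^sub>M gauss I) (PiM I (\<lambda>_. borel))"
    by (rule measurable_mix[OF measurable_fst m])
  show ?thesis
    by (rule gauss.borel_measurable_lebesgue_integral) (simp add: case_prod_beta')
qed

lemma measurable_mehler [measurable]:
  assumes [measurable]: "F \<in> borel_measurable (PiM I (\<lambda>_. borel))"
  shows "mehler I c s F \<in> borel_measurable (PiM I (\<lambda>_. borel))"
  unfolding mehler_def[abs_def] using measurable_integral_mix[of F I "\<lambda>_. 1" c s] by simp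

lemma between_measurable: "between I e B F \<Longrightarrow> F \<in> borel_measurable (PiM I (\<lambda>_. borel))"
  and between_range: "between I e B F \<Longrightarrow> z \<in> extensional I \<Longrightarrow> e \<le> F z \<and> F z \<le> B"
  by (auto simp: between_def)

context
  fixes I :: "nat set" assumes I: "finite I"
begin

lemma between_bmeas: "between I e B F \<Longrightarrow> bmeas I F"
  unfolding between_def by (rule bmeas_range[OF I]) auto

lemma measurable_hermite [measurable]:
  assumes [measurable]: "F \<in> borel_measurable (PiM I (\<lambda>_. borel))" and "i \<in> I"
  shows "hermite I c s i F \<in> borel_measurable (PiM I (\<lambda>_. borel))"
  unfolding hermite_def[abs_def] by (rule measurable_integral_mix[OF assms(1) coord_measurable[OF I assms(2)]])

lemma mehler_mono_const:
  assumes F: "between I e B F"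
  shows "e \<le> mehler I c s F z \<and> mehler I c s F z \<le> B"
proof -
  note [simp] = bmeas_integrable[OF I bmeas_mix[OF I between_bmeas[OF F], of c s z]]
  have "(\<integral>y. e \<partial>gauss I) \<le> mehler I c s F z" "mehler I c s F z \<le> (\<integral>y. B \<partial>gauss I)"
    unfolding mehler_def by (intro integral_mono; use between_range[OF F] in simp)+
  then show ?thesis by (simp add: gauss.prob_space)
qed

lemma between_mehler: "between I e B F \<Longrightarrow> between I e B (mehler I c s F)"
  unfolding between_def using mehler_mono_const[of e B F c s] by (auto simp: between_def)

lemma bmeas_mehler:
  assumes F: "bmeas I F" shows "bmeas I (mehler I c s F)"
proof -
  from F obtain B where B: "\<forall>z\<in>extensional I. \<bar>F z\<bar> \<le> B" and m: "F \<in> borel_measurable (PiM I (\<lambda>_. borel))"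
    by (auto simp: bmeas_def)
  then have "between I (-B) B F" by (auto simp: between_def abs_le_iff)
  from between_bmeas[OF between_mehler[OF this]] show ?thesis .
qed

lemma bmeas_hermite:
  assumes F: "bmeas I F" and i: "i \<in> I" shows "bmeas I (hermite I c s i F)"
proof -
  from F obtain B where B: "\<forall>z\<in>extensional I. \<bar>F z\<bar> \<le> B" and m: "F \<in> borel_measurable (PiM I (\<lambda>_. borel))"
    by (auto simp: bmeas_def)
  have "\<bar>hermite I c s i F z\<bar> \<le> \<bar>B\<bar> * (\<integral>y. l1norm I y \<partial>gauss I)" for z
  proof -
    note int = bmeas_mult_integrable[OF I bmeas_mix[OF I F, of c s z] integrable_coord[OF I i]]
    have "\<bar>hermite I c s i F z\<bar> \<le> (\<integral>y. \<bar>F (mix I c s z y) * y i\<bar> \<partial>gauss I)"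
      unfolding hermite_def by (rule integral_abs_bound)
    also have "\<dots> \<le> (\<integral>y. \<bar>B\<bar> * l1norm I y \<partial>gauss I)"
    proof (intro integral_mono)
      fix y
      have "\<bar>F (mix I c s z y)\<bar> \<le> \<bar>B\<bar>" using B[rule_format, of "mix I c s z y"] by simp
      then show "\<bar>F (mix I c s z y) * y i\<bar> \<le> \<bar>B\<bar> * l1norm I y"
        unfolding abs_mult by (intro mult_mono abs_coord_le_l1norm[OF I i]) auto
    qed (use int integrable_l1norm[OF I] in auto)
    finally show ?thesis by simp
  qed
  with measurable_hermite[OF m i] show ?thesis unfolding bmeas_def by blast
qed

lemma integral_mehler:
  assumes cs: "\<And>i. i \<in> I \<Longrightarrow> (c i)\<^sup>2 + (s i)\<^sup>2 = 1" and F: "bmeas I F"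
  shows "(\<integral>z. mehler I c s F z \<partial>gauss I) = (\<integral>z. F z \<partial>gauss I)"
  unfolding mehler_def by (rule integral_mix(1)[OF I cs bmeas_integrable[OF I F]])

lemma l1norm_mix_diff: "l1norm I (\<lambda>i. mix I (\<lambda>_. c) (\<lambda>_. s) z y i - mix I (\<lambda>_. c) (\<lambda>_. s) z' y' i)
   \<le> \<bar>c\<bar> * l1norm I (\<lambda>i. z i - z' i) + \<bar>s\<bar> * l1norm I (\<lambda>i. y i - y' i)"
  unfolding l1norm_def sum_distrib_left sum.distrib[symmetric]
proof (rule sum_mono)
  fix i assume "i \<in> I"
  then have "mix I (\<lambda>_. c) (\<lambda>_. s) z y i - mix I (\<lambda>_. c) (\<lambda>_. s) z' y' i = c * (z i - z' i) + s * (y i - y' i)"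
    by (simp add: algebra_simps)
  then show "\<bar>mix I (\<lambda>_. c) (\<lambda>_. s) z y i - mix I (\<lambda>_. c) (\<lambda>_. s) z' y' i\<bar> \<le> \<bar>c\<bar> * \<bar>z i - z' i\<bar> + \<bar>s\<bar> * \<bar>y i - y' i\<bar>"
    by (metis abs_mult abs_triangle_ineq)
qed

text \<open>The shift by \<open>mom1\<close> in the second and third moments arises because
  deviations are measured from the Gaussian mean of F; the fourth moment is for the remainder at a
  fixed centre and is unshifted.\<close>

definition mom1 :: real where "mom1 = (\<integral>y. l1norm I y \<partial>gauss I)"
definition mom3 :: real where "mom3 = (\<integral>y. (l1norm I y + mom1) ^ 3 \<partial>gauss I)"
definition mom4 :: real where "mom4 = (\<integral>y. (l1norm I y) ^ 4 \<partial>gauss I)"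
definition mom2 :: real where "mom2 = (\<integral>y. (l1norm I y + mom1) ^ 2 \<partial>gauss I)"

lemma mom1_nonneg: "0 \<le> mom1" unfolding mom1_def by simp

text \<open>The Mehler value is an average over a second noise y', and two mixtures with the same z
  differ by s (y - y').\<close>

lemma lip_osc:
  assumes F: "bmeas I F" and L: "lipschitz_l1 I L F" "0 \<le> L" and z: "z \<in> extensional I" and s: "0 \<le> s" and y: "y \<in> extensional I"
  shows "\<bar>F (mix I (\<lambda>_. c) (\<lambda>_. s) z y) - mehler I (\<lambda>_. c) (\<lambda>_. s) F z\<bar> \<le> L * s * (l1norm I y + mom1)"
proof -
  let ?m = "mix I (\<lambda>_. c) (\<lambda>_. s) z"
  note int = bmeas_integrable[OF I bmeas_mix[OF I F, of "\<lambda>_. c" "\<lambda>_. s" z]]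
  have "F (?m y) - mehler I (\<lambda>_. c) (\<lambda>_. s) F z = (\<integral>y'. F (?m y) - F (?m y') \<partial>gauss I)"
    using int by (simp add: mehler_def gauss.prob_space)
  also have "\<bar>\<dots>\<bar> \<le> (\<integral>y'. \<bar>F (?m y) - F (?m y')\<bar> \<partial>gauss I)"
    by (rule integral_abs_bound)
  also have "\<dots> \<le> (\<integral>y'. L * s * (l1norm I y + l1norm I y') \<partial>gauss I)"
  proof (intro integral_mono)
    fix y' assume "y' \<in> space (gauss I)"
    have "\<bar>F (?m y) - F (?m y')\<bar> \<le> L * l1norm I (\<lambda>i. ?m y i - ?m y' i)"
      using L(1) by (simp add: lipschitz_l1_def)
    also have "\<dots> \<le> L * (s * l1norm I (\<lambda>i. y i - y' i))"
      using l1norm_mix_diff[of c s z y z y'] s L(2) by (intro mult_left_mono) (auto simp: l1norm_def)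
    also have "\<dots> \<le> L * (s * (l1norm I y + l1norm I y'))"
      using s L(2) l1norm_diff_le by (intro mult_left_mono) auto
    finally show "\<bar>F (?m y) - F (?m y')\<bar> \<le> L * s * (l1norm I y + l1norm I y')" by (simp add: mult.assoc)
  qed (use int integrable_l1norm[OF I] in auto)
  also have "\<dots> = L * s * (l1norm I y + mom1)"
    using integrable_l1norm[OF I] by (simp add: gauss.prob_space mom1_def)
  finally show ?thesis .
qed

lemma fisher_integrable:
  assumes F: "between I e B F" and e: "0 < e"
  shows "bmeas I (\<lambda>z. (\<Sum>i\<in>I. w i * (hermite I c s i F z)\<^sup>2) / mehler I c s F z)"
proof -
  have "bmeas I (\<lambda>z. inverse (mehler I c s F z))"
  proof (rule bmeas_range)
    fix z :: "nat \<Rightarrow> real" assume "z \<in> extensional I"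
    show "0 \<le> inverse (mehler I c s F z) \<and> inverse (mehler I c s F z) \<le> inverse e"
      using mehler_mono_const[OF F, of c s z] e by (auto intro!: le_imp_inverse_le)
  qed (use between_measurable[OF F] I in measurable)
  moreover have "bmeas I (\<lambda>z. \<Sum>i\<in>J. w i * (hermite I c s i F z)\<^sup>2)" if "J \<subseteq> I" for J
    using finite_subset[OF that I] that
  proof (induction J rule: finite_induct)
    case (insert i J)
    then have "bmeas I (hermite I c s i F)" by (intro bmeas_hermite between_bmeas[OF F]) auto
    then have "bmeas I (\<lambda>z. w i * (hermite I c s i F z)\<^sup>2)"
      unfolding power2_eq_square by (intro bmeas_mult bmeas_const I)
    with insert show ?case by (simp add: bmeas_add[OF I])
  qed (simp add: I)
  ultimately show ?thesis
    unfolding divide_inverse by (intro bmeas_mult[OF I]) auto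
qed

text \<open>By invariance, \<open>phi \<circ> F\<close> has the same integral as its own Mehler
  average. The entropy drop is thus the mean over z of the local Jensen gap, which
  \<open>local_entropy\<close> estimates.\<close>

lemma ent_mehler_diff:
  assumes cs: "c\<^sup>2 + s\<^sup>2 = 1" and F: "between I e B F" and e: "0 < e"
  shows "ent I F - ent I (mehler I (\<lambda>_. c) (\<lambda>_. s) F)
      = (\<integral>z. (\<integral>y. phi (F (mix I (\<lambda>_. c) (\<lambda>_. s) z y)) \<partial>gauss I) - phi (mehler I (\<lambda>_. c) (\<lambda>_. s) F z) \<partial>gauss I)"
    and "integrable (gauss I) (\<lambda>z. (\<integral>y. phi (F (mix I (\<lambda>_. c) (\<lambda>_. s) z y)) \<partial>gauss I) - phi (mehler I (\<lambda>_. c) (\<lambda>_. s) F z))"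
proof -
  have p: "bmeas I (\<lambda>z. phi (F z))"
    by (rule bmeas_phi[OF I between_bmeas[OF F]]) (use between_range[OF F] e in force)
  have q: "bmeas I (\<lambda>z. phi (mehler I (\<lambda>_. c) (\<lambda>_. s) F z))"
  proof (rule bmeas_phi[OF I bmeas_mehler[OF between_bmeas[OF F]]])
    fix z show "0 \<le> mehler I (\<lambda>_. c) (\<lambda>_. s) F z"
      using mehler_mono_const[OF F, of "\<lambda>_. c" "\<lambda>_. s" z] e by linarith
  qed
  have cs': "(c)\<^sup>2 + (s)\<^sup>2 = 1" if "i \<in> I" for i using cs .
  note i1 = integral_mix[OF I cs' bmeas_integrable[OF I p]]
  show "integrable (gauss I) (\<lambda>z. (\<integral>y. phi (F (mix I (\<lambda>_. c) (\<lambda>_. s) z y)) \<partial>gauss I) - phi (mehler I (\<lambda>_. c) (\<lambda>_. s) F z))"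
    using i1(3) bmeas_integrable[OF I q] by auto
  show "ent I F - ent I (mehler I (\<lambda>_. c) (\<lambda>_. s) F)
      = (\<integral>z. (\<integral>y. phi (F (mix I (\<lambda>_. c) (\<lambda>_. s) z y)) \<partial>gauss I) - phi (mehler I (\<lambda>_. c) (\<lambda>_. s) F z) \<partial>gauss I)"
    unfolding ent_def
    using i1(3) bmeas_integrable[OF I q] i1(1)
    by (subst Bochner_Integration.integral_diff) simp_all
qed

lemma lip_cube_bound:
  assumes F: "bmeas I F" and L: "lipschitz_l1 I L F" "0 \<le> L" and z: "z \<in> extensional I" and s: "0 \<le> s"
  shows "(\<integral>y. \<bar>F (mix I (\<lambda>_. c) (\<lambda>_. s) z y) - mehler I (\<lambda>_. c) (\<lambda>_. s) F z\<bar> ^ 3 \<partial>gauss I) \<le> L ^ 3 * s ^ 3 * mom3"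
    and "(\<integral>y. (F (mix I (\<lambda>_. c) (\<lambda>_. s) z y) - mehler I (\<lambda>_. c) (\<lambda>_. s) F z)\<^sup>2 \<partial>gauss I) \<le> L\<^sup>2 * s\<^sup>2 * mom2"
proof -
  let ?d = "\<lambda>y. F (mix I (\<lambda>_. c) (\<lambda>_. s) z y) - mehler I (\<lambda>_. c) (\<lambda>_. s) F z"
  have d: "bmeas I ?d" by (rule bmeas_diff[OF I bmeas_mix[OF I F] bmeas_const[OF I]])
  have le: "\<bar>?d y\<bar> \<le> L * s * (l1norm I y + mom1)" if "y \<in> space (gauss I)" for y
    using lip_osc[OF F L z s, of y c] that by (simp add: space_gauss)
  have i: "integrable (gauss I) (\<lambda>y. L ^ n * s ^ n * (l1norm I y + mom1) ^ n)" for n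
    by (intro integrable_mult_right integrable_l1norm_pow[OF I] mom1_nonneg)
  have le_n: "\<bar>?d y\<bar> ^ n \<le> L ^ n * s ^ n * (l1norm I y + mom1) ^ n" if "y \<in> space (gauss I)" for y n
    using power_mono[OF le[OF that] abs_ge_zero, of n] by (simp add: power_mult_distrib)
  have "integrable (gauss I) (\<lambda>y. \<bar>?d y ^ 3\<bar>)"
    using bmeas_integrable[OF I bmeas_mult[OF I d bmeas_mult[OF I d d]]]
    by (intro Bochner_Integration.integrable_abs) (simp add: power3_eq_cube mult_ac)
  then have "(\<integral>y. \<bar>?d y\<bar> ^ 3 \<partial>gauss I) \<le> (\<integral>y. L ^ 3 * s ^ 3 * (l1norm I y + mom1) ^ 3 \<partial>gauss I)"
    using le_n[of _ 3] i[of 3] by (intro integral_mono) (auto simp: power_abs)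
  then show "(\<integral>y. \<bar>?d y\<bar> ^ 3 \<partial>gauss I) \<le> L ^ 3 * s ^ 3 * mom3" by (simp add: mom3_def)
  have "integrable (gauss I) (\<lambda>y. (?d y)\<^sup>2)"
    using bmeas_integrable[OF I bmeas_mult[OF I d d]] by (simp add: power2_eq_square)
  then have "(\<integral>y. (?d y)\<^sup>2 \<partial>gauss I) \<le> (\<integral>y. L ^ 2 * s ^ 2 * (l1norm I y + mom1) ^ 2 \<partial>gauss I)"
    using le_n[of _ 2] i[of 2] by (intro integral_mono) auto
  then show "(\<integral>y. (?d y)\<^sup>2 \<partial>gauss I) \<le> L\<^sup>2 * s\<^sup>2 * mom2" by (simp add: mom2_def)
qed

text \<open>Bessel's inequality inside the local estimate suffices here, and the only error is cubic
  in s. This side is applied to the initial datum, whose entropy drop must dominate its Fisher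
  information.\<close>

lemma step_lower:
  assumes cs: "c\<^sup>2 + s\<^sup>2 = 1" and s: "0 \<le> s" and F: "between I e B F" and e: "0 < e" and L: "lipschitz_l1 I L F" "0 \<le> L"
  shows "pi * fisher I (\<lambda>_. c) (\<lambda>_. s) (\<lambda>_. 1) F - L ^ 3 * s ^ 3 * mom3 / (6 * e\<^sup>2)
    \<le> ent I F - ent I (mehler I (\<lambda>_. c) (\<lambda>_. s) F)"
proof -
  let ?c = "\<lambda>_::nat. c" and ?s = "\<lambda>_::nat. s"
  define f where "f = (\<lambda>z. (\<Sum>i\<in>I. 1 * (hermite I ?c ?s i F z)\<^sup>2) / mehler I ?c ?s F z)"
  have fi: "integrable (gauss I) f" unfolding f_def by (rule bmeas_integrable[OF I fisher_integrable[OF F e]])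
  have "pi * fisher I ?c ?s (\<lambda>_. 1) F - L ^ 3 * s ^ 3 * mom3 / (6 * e\<^sup>2)
     = (\<integral>z. pi * f z - L ^ 3 * s ^ 3 * mom3 / (6 * e\<^sup>2) \<partial>gauss I)"
    unfolding fisher_def f_def[symmetric] using fi by (simp add: gauss.prob_space)
  also have "\<dots> \<le> (\<integral>z. (\<integral>y. phi (F (mix I ?c ?s z y)) \<partial>gauss I) - phi (mehler I ?c ?s F z) \<partial>gauss I)"
  proof (rule integral_mono)
    fix z assume "z \<in> space (gauss I)"
    then have z: "z \<in> extensional I" by (simp add: space_gauss)
    have m: "(\<lambda>y. F (mix I ?c ?s z y)) \<in> borel_measurable (PiM I (\<lambda>_. borel))"
      using bmeas_mix[OF I between_bmeas[OF F]] by (simp add: bmeas_def)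
    have "pi * (\<Sum>i\<in>I. (hermite I ?c ?s i F z)\<^sup>2) / mehler I ?c ?s F z
       - (\<integral>y. \<bar>F (mix I ?c ?s z y) - mehler I ?c ?s F z\<bar> ^ 3 \<partial>gauss I) / (6 * e\<^sup>2)
       \<le> (\<integral>y. phi (F (mix I ?c ?s z y)) \<partial>gauss I) - phi (mehler I ?c ?s F z)"
      unfolding mehler_def hermite_def by (rule local_entropy(1)[OF I m e, of B]) (use between_range[OF F] in auto)
    moreover have "(\<integral>y. \<bar>F (mix I ?c ?s z y) - mehler I ?c ?s F z\<bar> ^ 3 \<partial>gauss I) / (6 * e\<^sup>2) \<le> L ^ 3 * s ^ 3 * mom3 / (6 * e\<^sup>2)"
      by (intro divide_right_mono lip_cube_bound[OF between_bmeas[OF F] L z s]) simp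
    ultimately show "pi * f z - L ^ 3 * s ^ 3 * mom3 / (6 * e\<^sup>2) \<le> (\<integral>y. phi (F (mix I ?c ?s z y)) \<partial>gauss I) - phi (mehler I ?c ?s F z)"
      by (simp add: f_def)
  qed (use fi ent_mehler_diff(2)[OF cs F e] in auto)
  also have "\<dots> = ent I F - ent I (mehler I ?c ?s F)"
    by (rule ent_mehler_diff(1)[OF cs F e, symmetric])
  finally show ?thesis .
qed

text \<open>The reverse bound needs F to be nearly affine on the ball of radius s. The quadratic
  remainder enters squared, which gives the order s^4. This side is applied to the evolved
  function.\<close>

lemma step_upper:
  assumes cs: "c\<^sup>2 + s\<^sup>2 = 1" and s: "0 \<le> s" and F: "between I e B F" and e: "0 < e" and L: "lipschitz_l1 I L F" "0 \<le> L"
    and H: "taylor_l1 I H F" "0 \<le> H"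
  shows "ent I F - ent I (mehler I (\<lambda>_. c) (\<lambda>_. s) F) \<le> pi * fisher I (\<lambda>_. c) (\<lambda>_. s) (\<lambda>_. 1) F
     + L ^ 3 * s ^ 3 * mom3 / (6 * e\<^sup>2) + H\<^sup>2 * s ^ 4 * mom4 / (2 * e)"
proof -
  let ?c = "\<lambda>_::nat. c" and ?s = "\<lambda>_::nat. s"
  define f where "f = (\<lambda>z. (\<Sum>i\<in>I. 1 * (hermite I ?c ?s i F z)\<^sup>2) / mehler I ?c ?s F z)"
  let ?E = "L ^ 3 * s ^ 3 * mom3 / (6 * e\<^sup>2) + H\<^sup>2 * s ^ 4 * mom4 / (2 * e)"
  from H(1) obtain D where D: "\<And>x y. x \<in> extensional I \<Longrightarrow> y \<in> extensional I \<Longrightarrow>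
     \<bar>F y - F x - (\<Sum>i\<in>I. D i x * (y i - x i))\<bar> \<le> H * (l1norm I (\<lambda>i. y i - x i))\<^sup>2" by (auto simp: taylor_l1_def)
  have fi: "integrable (gauss I) f" unfolding f_def by (rule bmeas_integrable[OF I fisher_integrable[OF F e]])
  have "ent I F - ent I (mehler I ?c ?s F) = (\<integral>z. (\<integral>y. phi (F (mix I ?c ?s z y)) \<partial>gauss I) - phi (mehler I ?c ?s F z) \<partial>gauss I)"
    by (rule ent_mehler_diff(1)[OF cs F e])
  also have "\<dots> \<le> (\<integral>z. pi * f z + ?E \<partial>gauss I)"
  proof (rule integral_mono)
    fix z assume "z \<in> space (gauss I)"
    then have z: "z \<in> extensional I" by (simp add: space_gauss)
    \<comment> \<open>The centre of the Gaussian ball: the mixture is x + s y, so the affine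
      approximant has slopes s D_i(x).\<close>
    define x where "x = (\<lambda>i\<in>I. c * z i)"
    have xe: "x \<in> extensional I" by (simp add: x_def)
    let ?G = "\<lambda>y. F (mix I ?c ?s z y)"
    have Gb: "bmeas I ?G" by (rule bmeas_mix[OF I between_bmeas[OF F]])
    then have m: "?G \<in> borel_measurable (PiM I (\<lambda>_. borel))" by (simp add: bmeas_def)
    let ?r = "\<lambda>y. ?G y - F x - (\<Sum>i\<in>I. (s * D i x) * y i)"
    have r: "\<bar>?r y\<bar> \<le> H * s\<^sup>2 * (l1norm I y)\<^sup>2" for y
    proof -
      have "\<bar>F (mix I ?c ?s z y) - F x - (\<Sum>i\<in>I. D i x * (mix I ?c ?s z y i - x i))\<bar>
          \<le> H * (l1norm I (\<lambda>i. mix I ?c ?s z y i - x i))\<^sup>2"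
        by (rule D[OF xe]) simp
      moreover have "(\<Sum>i\<in>I. D i x * (mix I ?c ?s z y i - x i)) = (\<Sum>i\<in>I. (s * D i x) * y i)"
        by (intro sum.cong) (auto simp: x_def)
      moreover have "l1norm I (\<lambda>i. mix I ?c ?s z y i - x i) = s * l1norm I y"
        unfolding l1norm_def sum_distrib_left by (intro sum.cong) (auto simp: x_def abs_mult s)
      ultimately show ?thesis by (simp add: power_mult_distrib mult_ac)
    qed
    have "(\<integral>y. (?r y)\<^sup>2 \<partial>gauss I) \<le> (\<integral>y. H\<^sup>2 * s ^ 4 * (l1norm I y + 0) ^ 4 \<partial>gauss I)"
    proof (rule integral_mono)
      show "integrable (gauss I) (\<lambda>y. (?r y)\<^sup>2)" by (rule variance_expand(1)[OF I Gb])
      show "integrable (gauss I) (\<lambda>y. H\<^sup>2 * s ^ 4 * (l1norm I y + 0) ^ 4)"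
        by (intro integrable_mult_right integrable_l1norm_pow[OF I]) simp
      fix y
      have "(?r y)\<^sup>2 = \<bar>?r y\<bar>\<^sup>2" by simp
      also have "\<dots> \<le> (H * s\<^sup>2 * (l1norm I y)\<^sup>2)\<^sup>2" by (intro power_mono r) simp
      also have "\<dots> = H\<^sup>2 * s ^ 4 * (l1norm I y + 0) ^ 4" by (simp add: power_mult_distrib power_mult[symmetric])
      finally show "(?r y)\<^sup>2 \<le> H\<^sup>2 * s ^ 4 * (l1norm I y + 0) ^ 4" .
    qed
    then have R: "(\<integral>y. (?r y)\<^sup>2 \<partial>gauss I) / (2 * e) \<le> H\<^sup>2 * s ^ 4 * mom4 / (2 * e)"
      using e by (intro divide_right_mono) (auto simp: mom4_def)
    have "(\<integral>y. phi (?G y) \<partial>gauss I) - phi (mehler I ?c ?s F z) \<le> pi * (\<Sum>i\<in>I. (hermite I ?c ?s i F z)\<^sup>2) / mehler I ?c ?s F z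
       + (\<integral>y. \<bar>?G y - mehler I ?c ?s F z\<bar> ^ 3 \<partial>gauss I) / (6 * e\<^sup>2) + (\<integral>y. (?r y)\<^sup>2 \<partial>gauss I) / (2 * e)"
      unfolding mehler_def hermite_def by (rule local_entropy(2)[OF I m e, of B]) (use between_range[OF F] in auto)
    moreover have "(\<integral>y. \<bar>?G y - mehler I ?c ?s F z\<bar> ^ 3 \<partial>gauss I) / (6 * e\<^sup>2) \<le> L ^ 3 * s ^ 3 * mom3 / (6 * e\<^sup>2)"
      by (intro divide_right_mono lip_cube_bound[OF between_bmeas[OF F] L z s]) simp
    ultimately show "(\<integral>y. phi (F (mix I ?c ?s z y)) \<partial>gauss I) - phi (mehler I ?c ?s F z) \<le> pi * f z + ?E"
      using R by (simp add: f_def)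
  qed (use fi ent_mehler_diff(2)[OF cs F e] in auto)
  also have "\<dots> = pi * fisher I ?c ?s (\<lambda>_. 1) F + ?E"
    unfolding fisher_def f_def[symmetric] using fi by (simp add: gauss.prob_space)
  finally show ?thesis by simp
qed

lemma ent_mehler_le:
  assumes cs: "c\<^sup>2 + s\<^sup>2 = 1" and F: "between I e B F" and e: "0 < e"
  shows "ent I (mehler I (\<lambda>_. c) (\<lambda>_. s) F) \<le> ent I F"
proof -
  have "0 \<le> (\<integral>z. (\<integral>y. phi (F (mix I (\<lambda>_. c) (\<lambda>_. s) z y)) \<partial>gauss I) - phi (mehler I (\<lambda>_. c) (\<lambda>_. s) F z) \<partial>gauss I)"
  proof (rule integral_nonneg_AE, rule AE_I2)
    fix z
    have m: "(\<lambda>y. F (mix I (\<lambda>_. c) (\<lambda>_. s) z y)) \<in> borel_measurable (PiM I (\<lambda>_. borel))"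
      using bmeas_mix[OF I between_bmeas[OF F]] by (simp add: bmeas_def)
    show "0 \<le> (\<integral>y. phi (F (mix I (\<lambda>_. c) (\<lambda>_. s) z y)) \<partial>gauss I) - phi (mehler I (\<lambda>_. c) (\<lambda>_. s) F z)"
      unfolding mehler_def using local_entropy(4)[OF I m e, of B] between_range[OF F] by auto
  qed
  then show ?thesis using ent_mehler_diff(1)[OF cs F e] by simp
qed

lemma ent_lower:
  assumes F: "between I e B F" and e: "0 < e"
  shows "phi (\<integral>z. F z \<partial>gauss I) \<le> ent I F"
  unfolding ent_def by (rule local_entropy(4)[OF I between_measurable[OF F] e between_range[OF F]])

text \<open>A Poincare-type bound with a crude constant. It is used at the end of the iteration,
  when the Lipschitz constant has become small.\<close>

lemma ent_upper_lip:
  assumes F: "between I e B F" and e: "0 < e" and L: "lipschitz_l1 I L F" "0 \<le> L"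
  shows "ent I F \<le> phi (\<integral>z. F z \<partial>gauss I) + L\<^sup>2 * mom2 / e"
proof -
  \<comment> \<open>With c = 0 and s = 1 the base point is multiplied by zero and the Mehler value
    is the full mean, so any extensional base point turns the local square estimate into a variance
    estimate.\<close>
  let ?u = "\<lambda>_::nat. undefined :: real"
  have u: "?u \<in> extensional I" by (auto simp: extensional_def)
  have m: "mix I (\<lambda>_. 0) (\<lambda>_. 1) ?u y = y" if "y \<in> extensional I" for y
    using that by (auto simp: mix_def extensional_def)
  have eq: "(\<integral>y. f (mix I (\<lambda>_. 0) (\<lambda>_. 1) ?u y) \<partial>gauss I) = (\<integral>y. f y \<partial>gauss I)" for f :: "_ \<Rightarrow> real"
    by (intro Bochner_Integration.integral_cong) (auto simp: space_gauss m)
  have a: "mehler I (\<lambda>_. 0) (\<lambda>_. 1) F ?u = (\<integral>z. F z \<partial>gauss I)"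
    unfolding mehler_def by (rule eq)
  have "(\<integral>y. (F y - (\<integral>z. F z \<partial>gauss I))\<^sup>2 \<partial>gauss I) \<le> L\<^sup>2 * 1\<^sup>2 * mom2"
    using lip_cube_bound(2)[OF between_bmeas[OF F] L u, of 1 0] unfolding a
    using eq[of "\<lambda>y. (F y - (\<integral>z. F z \<partial>gauss I))\<^sup>2"] by simp
  then have "(\<integral>y. (F y - (\<integral>z. F z \<partial>gauss I))\<^sup>2 \<partial>gauss I) / e \<le> L\<^sup>2 * mom2 / e"
    using e by (intro divide_right_mono) auto
  moreover have "ent I F - phi (\<integral>z. F z \<partial>gauss I) \<le> (\<integral>y. (F y - (\<integral>z. F z \<partial>gauss I))\<^sup>2 \<partial>gauss I) / e"
    unfolding ent_def by (rule local_entropy(3)[OF I between_measurable[OF F] e between_range[OF F]])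
  ultimately show ?thesis by linarith
qed

text \<open>The gain of a factor c, as in the gradient commutation of the semigroup, is what makes
  the residual entropy decay geometrically.\<close>

lemma lipschitz_l1_mehler:
  assumes F: "bmeas I F" and L: "lipschitz_l1 I L F" and c: "0 \<le> c" and L0: "0 \<le> L"
  shows "lipschitz_l1 I (c * L) (mehler I (\<lambda>_. c) (\<lambda>_. s) F)"
  unfolding lipschitz_l1_def
proof (intro ballI)
  fix x y :: "nat \<Rightarrow> real" assume x: "x \<in> extensional I" and y: "y \<in> extensional I"
  let ?m = "mix I (\<lambda>_. c) (\<lambda>_. s)"
  note int = bmeas_integrable[OF I bmeas_mix[OF I F, of "\<lambda>_. c" "\<lambda>_. s"]]
  have "mehler I (\<lambda>_. c) (\<lambda>_. s) F y - mehler I (\<lambda>_. c) (\<lambda>_. s) F x = (\<integral>t. F (?m y t) - F (?m x t) \<partial>gauss I)"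
    using int by (simp add: mehler_def)
  also have "\<bar>\<dots>\<bar> \<le> (\<integral>t. \<bar>F (?m y t) - F (?m x t)\<bar> \<partial>gauss I)" by (rule integral_abs_bound)
  also have "\<dots> \<le> (\<integral>t. c * L * l1norm I (\<lambda>i. y i - x i) \<partial>gauss I)"
  proof (rule integral_mono)
    fix t
    have "\<bar>F (?m y t) - F (?m x t)\<bar> \<le> L * l1norm I (\<lambda>i. ?m y t i - ?m x t i)"
      using L by (simp add: lipschitz_l1_def)
    also have "\<dots> \<le> L * (c * l1norm I (\<lambda>i. y i - x i))"
      using l1norm_mix_diff[of c s y t x t] c L0 by (intro mult_left_mono) (auto simp: l1norm_def)
    finally show "\<bar>F (?m y t) - F (?m x t)\<bar> \<le> c * L * l1norm I (\<lambda>i. y i - x i)" by (simp add: mult_ac)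
  qed (use int in auto)
  finally show "\<bar>mehler I (\<lambda>_. c) (\<lambda>_. s) F y - mehler I (\<lambda>_. c) (\<lambda>_. s) F x\<bar> \<le> c * L * l1norm I (\<lambda>i. y i - x i)"
    by (simp add: gauss.prob_space)
qed

text \<open>Displacements of z are shrunk by c <= 1 inside F, so the same H remains valid after any
  number of steps.\<close>

lemma taylor_l1_mehler:
  assumes F: "bmeas I F" and H: "taylor_l1 I H F" "0 \<le> H" and c: "0 \<le> c" "c \<le> 1"
  shows "taylor_l1 I H (mehler I (\<lambda>_. c) (\<lambda>_. s) F)"
proof -
  let ?m = "mix I (\<lambda>_. c) (\<lambda>_. s)" and ?A = "mehler I (\<lambda>_. c) (\<lambda>_. s)"
  from H(1) obtain D where Db: "\<And>i. i \<in> I \<Longrightarrow> bmeas I (D i)" and D: "\<And>x y. x \<in> extensional I \<Longrightarrow> y \<in> extensional I \<Longrightarrow>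
     \<bar>F y - F x - (\<Sum>i\<in>I. D i x * (y i - x i))\<bar> \<le> H * (l1norm I (\<lambda>i. y i - x i))\<^sup>2" by (auto simp: taylor_l1_def)
  note int = bmeas_integrable[OF I bmeas_mix[OF I F, of "\<lambda>_. c" "\<lambda>_. s"]]
  have intD: "integrable (gauss I) (\<lambda>t. D i (?m x t))" if "i \<in> I" for i x
    by (rule bmeas_integrable[OF I bmeas_mix[OF I Db[OF that]]])
  show ?thesis unfolding taylor_l1_def
  \<comment> \<open>The chain rule under the integral dictates this candidate gradient.\<close>
  proof (intro exI[of _ "\<lambda>i x. c * ?A (D i) x"] conjI ballI)
    fix i assume "i \<in> I" then show "bmeas I (\<lambda>x. c * ?A (D i) x)"
      by (intro bmeas_mult[OF I] bmeas_const[OF I] bmeas_mehler Db)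
  next
    fix x y :: "nat \<Rightarrow> real" assume x: "x \<in> extensional I" and y: "y \<in> extensional I"
    have si: "integrable (gauss I) (\<lambda>t. \<Sum>i\<in>I. D i (?m x t) * (c * (y i - x i)))"
      by (intro Bochner_Integration.integrable_sum integrable_mult_left intD)
    have "(\<integral>t. (\<Sum>i\<in>I. D i (?m x t) * (c * (y i - x i))) \<partial>gauss I) = (\<Sum>i\<in>I. c * ?A (D i) x * (y i - x i))"
      by (subst Bochner_Integration.integral_sum) (auto simp: intD mehler_def intro!: sum.cong)
    then have "\<bar>?A F y - ?A F x - (\<Sum>i\<in>I. c * ?A (D i) x * (y i - x i))\<bar>
       = \<bar>(\<integral>t. F (?m y t) - F (?m x t) - (\<Sum>i\<in>I. D i (?m x t) * (c * (y i - x i))) \<partial>gauss I)\<bar>"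
      using int si by (simp add: mehler_def)
    also have "\<dots> \<le> (\<integral>t. \<bar>F (?m y t) - F (?m x t) - (\<Sum>i\<in>I. D i (?m x t) * (c * (y i - x i)))\<bar> \<partial>gauss I)"
      by (rule integral_abs_bound)
    also have "\<dots> \<le> (\<integral>t. H * (l1norm I (\<lambda>i. y i - x i))\<^sup>2 \<partial>gauss I)"
    proof (rule integral_mono)
      fix t
      have e: "(\<Sum>i\<in>I. D i (?m x t) * (?m y t i - ?m x t i)) = (\<Sum>i\<in>I. D i (?m x t) * (c * (y i - x i)))"
        by (intro sum.cong) (auto simp: algebra_simps)
      have "\<bar>F (?m y t) - F (?m x t) - (\<Sum>i\<in>I. D i (?m x t) * (c * (y i - x i)))\<bar> \<le> H * (l1norm I (\<lambda>i. ?m y t i - ?m x t i))\<^sup>2"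
        using D[of "?m x t" "?m y t"] unfolding e by simp
      also have "H * (l1norm I (\<lambda>i. ?m y t i - ?m x t i))\<^sup>2 \<le> H * (l1norm I (\<lambda>i. y i - x i))\<^sup>2"
      proof (intro mult_left_mono power_mono H)
        have "l1norm I (\<lambda>i. ?m y t i - ?m x t i) \<le> c * l1norm I (\<lambda>i. y i - x i)"
          using l1norm_mix_diff[of c s y t x t] c by (simp add: l1norm_def)
        also have "\<dots> \<le> l1norm I (\<lambda>i. y i - x i)" using c by (intro mult_left_le_one_le) auto
        finally show "l1norm I (\<lambda>i. ?m y t i - ?m x t i) \<le> l1norm I (\<lambda>i. y i - x i)" .
      qed simp
      finally show "\<bar>F (?m y t) - F (?m x t) - (\<Sum>i\<in>I. D i (?m x t) * (c * (y i - x i)))\<bar> \<le> H * (l1norm I (\<lambda>i. y i - x i))\<^sup>2" .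
    qed (use int si in auto)
    finally show "\<bar>?A F y - ?A F x - (\<Sum>i\<in>I. c * ?A (D i) x * (y i - x i))\<bar> \<le> H * (l1norm I (\<lambda>i. y i - x i))\<^sup>2"
      by (simp add: gauss.prob_space)
  qed
qed

end

section \<open>Smoothing\<close>

text \<open>On boxes this is translation invariance of Lebesgue measure in each coordinate.\<close>

lemma distr_PiM_lborel_shift:
  assumes I: "finite I"
  shows "distr (PiM I (\<lambda>_::nat. lborel)) (PiM I (\<lambda>_. lborel)) (\<lambda>x. \<lambda>i\<in>I. x i + a i) = PiM I (\<lambda>_. lborel :: real measure)"
proof -
  interpret L: product_sigma_finite "\<lambda>_::nat. lborel :: real measure" by standard
  have m [measurable]: "(\<lambda>x. \<lambda>i\<in>I. x i + a i) \<in> measurable (PiM I (\<lambda>_. lborel)) (PiM I (\<lambda>_. lborel :: real measure))"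
    by measurable
  show ?thesis
  proof (rule L.PiM_eqI[OF I])
    fix A :: "nat \<Rightarrow> real set" assume A: "\<And>i. i \<in> I \<Longrightarrow> A i \<in> sets lborel"
    have A' [measurable]: "\<And>i. i \<in> I \<Longrightarrow> (\<lambda>x. x + a i) -` A i \<in> sets borel"
    proof -
      fix i assume "i \<in> I"
      have "(\<lambda>x. x + a i) \<in> borel_measurable borel" by simp
      from measurable_sets[OF this, of "A i"] A[OF \<open>i \<in> I\<close>] show "(\<lambda>x. x + a i) -` A i \<in> sets borel" by simp
    qed
    have "(\<lambda>x. \<lambda>i\<in>I. x i + a i) -` Pi\<^sub>E I A \<inter> space (PiM I (\<lambda>_. lborel)) = Pi\<^sub>E I (\<lambda>i. (\<lambda>x. x + a i) -` A i)"
      by (auto simp: space_PiM PiE_def Pi_def)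
    moreover have "Pi\<^sub>E I A \<in> sets (PiM I (\<lambda>_. lborel))" using A I by (intro sets_PiM_I_finite) auto
    ultimately have "emeasure (distr (PiM I (\<lambda>_. lborel)) (PiM I (\<lambda>_. lborel)) (\<lambda>x. \<lambda>i\<in>I. x i + a i)) (Pi\<^sub>E I A)
       = emeasure (PiM I (\<lambda>_. lborel)) (Pi\<^sub>E I (\<lambda>i. (\<lambda>x. x + a i) -` A i))"
      by (simp add: emeasure_distr[OF m])
    also have "\<dots> = (\<Prod>i\<in>I. emeasure lborel ((\<lambda>x. x + a i) -` A i))"
      using A' by (intro L.emeasure_PiM I) simp
    also have "\<dots> = (\<Prod>i\<in>I. emeasure lborel (A i))"
    proof (rule prod.cong[OF refl])
      fix i assume "i \<in> I"
      have "emeasure lborel (A i) = emeasure (distr lborel borel (\<lambda>x. a i + x)) (A i)"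
        by (simp add: lborel_distr_plus)
      also have "\<dots> = emeasure lborel ((\<lambda>x. x + a i) -` A i)"
      proof -
        have "(\<lambda>x. a i + x) = (\<lambda>x. x + a i)" by (simp add: fun_eq_iff)
        then show ?thesis using A[OF \<open>i \<in> I\<close>] by (subst emeasure_distr) auto
      qed
      finally show "emeasure lborel ((\<lambda>x. x + a i) -` A i) = emeasure lborel (A i)" ..
    qed
    finally show "emeasure (distr (PiM I (\<lambda>_. lborel)) (PiM I (\<lambda>_. lborel)) (\<lambda>x. \<lambda>i\<in>I. x i + a i)) (Pi\<^sub>E I A)
       = (\<Prod>i\<in>I. emeasure lborel (A i))" .
  qed simp
qed

text \<open>The Cameron-Martin formula for the weight exp (-pi |y|^2): the exponential is the ratio
  of the translated weight to the original one.\<close>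

lemma integral_gauss_shift:
  assumes I: "finite I" and f [measurable]: "f \<in> borel_measurable (PiM I (\<lambda>_. borel))"
  shows "(\<integral>y. f (\<lambda>i\<in>I. y i + a i) \<partial>gauss I)
    = (\<integral>y. f y * exp (2 * pi * (\<Sum>i\<in>I. a i * y i) - pi * (\<Sum>i\<in>I. (a i)\<^sup>2)) \<partial>gauss I)"
    (is "?l = ?r")
proof -
  let ?L = "PiM I (\<lambda>_. lborel :: real measure)"
  let ?sh = "\<lambda>x. \<lambda>i\<in>I. x i + a i"
  have e: "sets ?L = sets (PiM I (\<lambda>_. borel :: real measure))"
    by (rule sets_PiM_cong) auto
  have m [measurable]: "?sh \<in> measurable ?L ?L" by measurable
  have fL [measurable]: "f \<in> borel_measurable ?L" using f by (subst measurable_cong_sets[OF e refl])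
  have gL [measurable]: "gauss_w I \<in> borel_measurable ?L" by (subst measurable_cong_sets[OF e refl]) measurable
  have dm: "(\<lambda>y. gauss_w I (\<lambda>i. y i - a i)) \<in> borel_measurable ?L"
    unfolding gauss_w_def by measurable
  have em: "(\<lambda>y. exp (2 * pi * (\<Sum>i\<in>I. a i * y i) - pi * (\<Sum>i\<in>I. (a i)\<^sup>2))) \<in> borel_measurable (PiM I (\<lambda>_. borel :: real measure))"
    by measurable
  have sm: "?sh \<in> measurable (PiM I (\<lambda>_. borel)) (PiM I (\<lambda>_. borel :: real measure))" by measurable
  have "?l = (\<integral>y. f (?sh y) * gauss_w I y \<partial>?L)"
    by (rule integral_gauss(1)[symmetric, OF I]) (use sm in measurable)
  also have "\<dots> = (\<integral>y. f (?sh y) * gauss_w I (\<lambda>i. ?sh y i - a i) \<partial>?L)"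
    by (intro Bochner_Integration.integral_cong refl) (auto simp: gauss_w_def)
  also have "\<dots> = (\<integral>y. f y * gauss_w I (\<lambda>i. y i - a i) \<partial>distr ?L ?L ?sh)"
    by (rule integral_distr[OF m, symmetric]) (use dm in measurable)
  also have "\<dots> = (\<integral>y. f y * gauss_w I (\<lambda>i. y i - a i) \<partial>?L)"
    by (simp only: distr_PiM_lborel_shift[OF I])
  also have "\<dots> = (\<integral>y. (f y * exp (2 * pi * (\<Sum>i\<in>I. a i * y i) - pi * (\<Sum>i\<in>I. (a i)\<^sup>2))) * gauss_w I y \<partial>?L)"
  proof (rule Bochner_Integration.integral_cong[OF refl])
    fix y
    have "(\<Sum>i\<in>I. (y i - a i)\<^sup>2) = (\<Sum>i\<in>I. (y i)\<^sup>2) - 2 * (\<Sum>i\<in>I. a i * y i) + (\<Sum>i\<in>I. (a i)\<^sup>2)"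
      unfolding sum_distrib_left sum_subtractf[symmetric] sum.distrib[symmetric]
      by (intro sum.cong) (auto simp: power2_eq_square algebra_simps)
    from arg_cong[OF this, of "\<lambda>u. - pi * u"]
    have "gauss_w I (\<lambda>i. y i - a i) = exp (2 * pi * (\<Sum>i\<in>I. a i * y i) - pi * (\<Sum>i\<in>I. (a i)\<^sup>2)) * gauss_w I y"
      by (simp add: gauss_w_def mult_exp_exp algebra_simps)
    then show "f y * gauss_w I (\<lambda>i. y i - a i) = (f y * exp (2 * pi * (\<Sum>i\<in>I. a i * y i) - pi * (\<Sum>i\<in>I. (a i)\<^sup>2))) * gauss_w I y"
      by simp
  qed
  also have "\<dots> = ?r"
    by (rule integral_gauss(1)[OF I]) (use em in measurable)
  finally show ?thesis .
qed

lemma abs_exp_minus_1_minus_le: "\<bar>exp x - 1 - x\<bar> \<le> x\<^sup>2 * exp \<bar>x\<bar>" for x :: real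
proof -
  have "\<exists>t. \<bar>t\<bar> \<le> \<bar>x\<bar> \<and> exp x = (\<Sum>m<2. x ^ m / fact m) + (exp t / fact 2) * x ^ 2"
    by (rule Maclaurin_exp_le)
  then obtain t where t: "\<bar>t\<bar> \<le> \<bar>x\<bar>" "exp x = (\<Sum>m<2. x ^ m / fact m) + (exp t / fact 2) * x ^ 2" by blast
  then have eq: "exp x - 1 - x = exp t / 2 * x\<^sup>2" by (simp add: eval_nat_numeral)
  have "exp t \<le> exp \<bar>x\<bar>" using t(1) by simp
  then have "exp t / 2 \<le> exp \<bar>x\<bar>" using exp_gt_zero[of t] by linarith
  then have "exp t / 2 * x\<^sup>2 \<le> exp \<bar>x\<bar> * x\<^sup>2" by (intro mult_right_mono) auto
  then show ?thesis unfolding eq by (simp add: mult.commute)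
qed

context
  fixes I :: "nat set" assumes I: "finite I"
begin

lemma sum_square_le_l1norm: "(\<Sum>i\<in>I. (a i)\<^sup>2) \<le> (l1norm I a)\<^sup>2"
proof -
  have "(\<Sum>i\<in>I. (a i)\<^sup>2) \<le> (\<Sum>i\<in>I. l1norm I a * \<bar>a i\<bar>)"
  proof (rule sum_mono)
    fix i assume "i \<in> I"
    then have "\<bar>a i\<bar> * \<bar>a i\<bar> \<le> l1norm I a * \<bar>a i\<bar>" by (intro mult_right_mono abs_coord_le_l1norm[OF I]) auto
    then show "(a i)\<^sup>2 \<le> l1norm I a * \<bar>a i\<bar>" by (simp add: power2_eq_square)
  qed
  also have "\<dots> = (l1norm I a)\<^sup>2" by (simp add: l1norm_def sum_distrib_left power2_eq_square)
  finally show ?thesis .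
qed

text \<open>For |a| <= 1 in l1 norm the exponent is at most |a| T with T = 2 pi |y| + pi, so its
  quadratic remainder is |a|^2 times a function of y that the Gaussian integrates.\<close>

lemma exp_tilt_bound:
  assumes A: "l1norm I a \<le> 1"
  shows "\<bar>exp (2 * pi * (\<Sum>i\<in>I. a i * y i) - pi * (\<Sum>i\<in>I. (a i)\<^sup>2)) - 1 - 2 * pi * (\<Sum>i\<in>I. a i * y i)\<bar>
    \<le> (l1norm I a)\<^sup>2 * (2 * exp (2 * pi) * exp (4 * pi * l1norm I y) + pi)"
proof -
  define A where "A = l1norm I a"
  define u where "u = (\<Sum>i\<in>I. a i * y i)"
  define v where "v = (\<Sum>i\<in>I. (a i)\<^sup>2)"
  define q where "q = 2 * pi * u - pi * v"
  define T where "T = 2 * pi * l1norm I y + pi"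
  have A0: "0 \<le> A" "A \<le> 1" using A by (auto simp: A_def)
  have T0: "0 \<le> T" by (simp add: T_def)
  have u: "\<bar>u\<bar> \<le> A * l1norm I y"
    unfolding u_def A_def by (rule abs_sum_mult_le_l1norm) (rule abs_coord_le_l1norm[OF I])
  have v: "0 \<le> v" "v \<le> A\<^sup>2" unfolding v_def A_def by (auto intro: sum_nonneg sum_square_le_l1norm)
  have A2: "A\<^sup>2 \<le> A" using A0 by (simp add: power2_eq_square mult_left_le_one_le)
  have "\<bar>q\<bar> \<le> 2 * pi * \<bar>u\<bar> + pi * v"
    unfolding q_def using abs_triangle_ineq4[of "2 * pi * u" "pi * v"] v(1) by (simp add: abs_mult)
  also have "\<dots> \<le> 2 * pi * (A * l1norm I y) + pi * A"
    using u v A2 by (intro add_mono mult_left_mono) auto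
  finally have q: "\<bar>q\<bar> \<le> A * T" by (simp add: T_def algebra_simps)
  have qT: "\<bar>q\<bar> \<le> T" using q mult_left_le_one_le[OF T0 A0(1) A0(2)] by linarith
  have "\<bar>exp q - 1 - q\<bar> \<le> q\<^sup>2 * exp \<bar>q\<bar>" by (rule abs_exp_minus_1_minus_le)
  also have "\<dots> \<le> (A * T)\<^sup>2 * exp T"
  proof (rule mult_mono)
    have "\<bar>q\<bar>\<^sup>2 \<le> (A * T)\<^sup>2" using q by (intro power_mono) auto
    then show "q\<^sup>2 \<le> (A * T)\<^sup>2" by simp
  qed (use qT in auto)
  also have "\<dots> \<le> A\<^sup>2 * (2 * exp (2 * pi) * exp (4 * pi * l1norm I y))"
  proof -
    \<comment> \<open>The polynomial factor is absorbed into a second exponential; exp (2 T) is exp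
      (2 pi) exp (4 pi |y|), the source of the constants in the bound.\<close>
    have "T\<^sup>2 \<le> fact 2 * exp T" by (rule power_le_fact_exp[OF I T0])
    then have "T\<^sup>2 * exp T \<le> (2 * exp T) * exp T" by (intro mult_right_mono) auto
    also have "\<dots> = 2 * exp (2 * pi) * exp (4 * pi * l1norm I y)"
      by (simp add: T_def mult_exp_exp algebra_simps)
    finally show ?thesis by (simp add: power_mult_distrib mult_left_mono mult.assoc)
  qed
  finally have "\<bar>exp q - 1 - q\<bar> \<le> A\<^sup>2 * (2 * exp (2 * pi) * exp (4 * pi * l1norm I y))" .
  moreover have "pi * v \<le> pi * A\<^sup>2" using v by (intro mult_left_mono) auto
  moreover have "\<bar>exp q - 1 - 2 * pi * u\<bar> \<le> \<bar>exp q - 1 - q\<bar> + pi * v"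
  proof -
    have "0 \<le> pi * v" using v(1) by simp
    then show ?thesis unfolding q_def by linarith
  qed
  ultimately have "\<bar>exp q - 1 - 2 * pi * u\<bar> \<le> A\<^sup>2 * (2 * exp (2 * pi) * exp (4 * pi * l1norm I y)) + pi * A\<^sup>2" by linarith
  then show ?thesis by (simp add: q_def u_def v_def A_def algebra_simps)
qed

lemma integrable_tilt: "integrable (gauss I) (\<lambda>y. exp (2 * pi * (\<Sum>i\<in>I. a i * y i) - r))"
proof (rule Bochner_Integration.integrable_bound)
  show "integrable (gauss I) (\<lambda>y. exp (- r) * exp (2 * pi * l1norm I a * l1norm I y))"
    by (intro integrable_mult_right integrable_l1norm_exp[OF I])
  show "(\<lambda>y. exp (2 * pi * (\<Sum>i\<in>I. a i * y i) - r)) \<in> borel_measurable (gauss I)"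
    using coord_measurable[OF I] by measurable
  have "(\<Sum>i\<in>I. a i * y i) \<le> l1norm I a * l1norm I y" for y
    using abs_sum_mult_le_l1norm[where I=I and x=a and y=y, OF abs_coord_le_l1norm[OF I]] by (simp add: abs_le_iff)
  then have "2 * pi * (\<Sum>i\<in>I. a i * y i) \<le> 2 * pi * (l1norm I a * l1norm I y)" for y
    by (intro mult_left_mono) auto
  then show "AE y in gauss I. norm (exp (2 * pi * (\<Sum>i\<in>I. a i * y i) - r)) \<le> norm (exp (- r) * exp (2 * pi * l1norm I a * l1norm I y))"
    by (auto simp: mult_exp_exp mult.assoc)
qed

text \<open>Shifting the argument of \<open>mehler\<close> tilts the Gaussian density; expanding the tilt to second
  order gives the gradient and the Taylor remainder.\<close>

lemma mehler_smooth:
  assumes F: "bmeas I F" and s: "0 < s" and c: "0 \<le> c"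
  shows "\<exists>L H. 0 \<le> L \<and> 0 \<le> H \<and> lipschitz_l1 I L (mehler I (\<lambda>_. c) (\<lambda>_. s) F) \<and> taylor_l1 I H (mehler I (\<lambda>_. c) (\<lambda>_. s) F)"
proof -
  let ?m = "mix I (\<lambda>_. c) (\<lambda>_. s)" and ?A = "mehler I (\<lambda>_. c) (\<lambda>_. s) F"
  from F obtain B0 where B0: "\<forall>z\<in>extensional I. \<bar>F z\<bar> \<le> B0" and Fm: "F \<in> borel_measurable (PiM I (\<lambda>_. borel))"
    by (auto simp: bmeas_def)
  define B where "B = \<bar>B0\<bar>"
  have B: "\<bar>F z\<bar> \<le> B" if "z \<in> extensional I" for z
    using B0 that unfolding B_def by (meson abs_ge_self order_trans)
  have Bp: "0 \<le> B" by (simp add: B_def)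
  \<comment> \<open>Moving the argument by y - x has the same effect on the mixture as moving the
    Gaussian variable by k (y - x).\<close>
  define k where "k = c / s"
  have k: "0 \<le> k" using c s by (simp add: k_def)
  have sk: "s * k = c" using s by (simp add: k_def)
  define M1 where "M1 = (\<integral>y. l1norm I y \<partial>gauss I)"
  have M1: "0 \<le> M1" by (simp add: M1_def)
  define X where "X = (\<integral>y. 2 * exp (2 * pi) * exp (4 * pi * l1norm I y) + pi \<partial>gauss I)"
  have Xi: "integrable (gauss I) (\<lambda>y. 2 * exp (2 * pi) * exp (4 * pi * l1norm I y) + pi)"
    by (intro Bochner_Integration.integrable_add integrable_mult_right integrable_l1norm_exp[OF I]) simp
  have X: "0 \<le> X" unfolding X_def by (intro integral_nonneg_AE AE_I2) simp
  \<comment> \<open>The term B X serves shifts of norm at most 1, through the tilt estimate. The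
    other two serve larger shifts, where the trivial bound on values and gradient suffices because 1
    and |a| are at most |a|^2.\<close>
  define K where "K = B * X + 2 * B + 2 * pi * B * M1"
  have K: "0 \<le> K" using Bp X M1 by (simp add: K_def)
  note int = bmeas_integrable[OF I bmeas_mix[OF I F, of "\<lambda>_. c" "\<lambda>_. s"]]
  have intm: "integrable (gauss I) (\<lambda>y. F (?m x y) * g y)" if "integrable (gauss I) g" for g x
    by (rule bmeas_mult_integrable[OF I bmeas_mix[OF I F] that])
  have avgB: "\<bar>?A x\<bar> \<le> B" for x
  proof -
    have "\<bar>?A x\<bar> \<le> (\<integral>y. \<bar>F (?m x y)\<bar> \<partial>gauss I)" unfolding mehler_def by (rule integral_abs_bound)
    also have "\<dots> \<le> (\<integral>y. B \<partial>gauss I)" using int B by (intro integral_mono) auto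
    finally show ?thesis by (simp add: gauss.prob_space)
  qed
  \<comment> \<open>The gradient by Gaussian integration by parts: the i-th partial derivative is 2
    pi c / s times the Hermite coefficient.\<close>
  define D where "D = (\<lambda>i x. (2 * pi * k) * hermite I (\<lambda>_. c) (\<lambda>_. s) i F x)"
  have key: "\<bar>?A y - ?A x - (\<Sum>i\<in>I. D i x * (y i - x i))\<bar> \<le> K * k\<^sup>2 * (l1norm I (\<lambda>i. y i - x i))\<^sup>2 \<and>
     \<bar>?A y - ?A x\<bar> \<le> (K + 2 * pi * B * M1) * k * l1norm I (\<lambda>i. y i - x i)" for x y
  proof -
    define a where "a = (\<lambda>i. k * (y i - x i))"
    have na: "l1norm I a = k * l1norm I (\<lambda>i. y i - x i)" unfolding a_def using k by (simp add: l1norm_scale)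
    let ?S = "\<lambda>t. \<Sum>i\<in>I. a i * t i"
    let ?e = "\<lambda>t. exp (2 * pi * ?S t - pi * (\<Sum>i\<in>I. (a i)\<^sup>2))"
    have Si: "integrable (gauss I) ?S"
      by (intro Bochner_Integration.integrable_sum integrable_mult_right integrable_coord[OF I])
    have D_eq: "(\<Sum>i\<in>I. D i x * (y i - x i)) = (\<integral>t. F (?m x t) * (2 * pi * ?S t) \<partial>gauss I)"
    proof -
      have "(\<integral>t. F (?m x t) * (2 * pi * ?S t) \<partial>gauss I) = (\<integral>t. (\<Sum>i\<in>I. 2 * pi * a i * (F (?m x t) * t i)) \<partial>gauss I)"
        by (intro Bochner_Integration.integral_cong refl) (simp add: sum_distrib_left mult_ac)
      also have "\<dots> = (\<Sum>i\<in>I. 2 * pi * a i * hermite I (\<lambda>_. c) (\<lambda>_. s) i F x)"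
        by (subst Bochner_Integration.integral_sum) (auto simp: hermite_def intm integrable_coord[OF I])
      also have "\<dots> = (\<Sum>i\<in>I. D i x * (y i - x i))"
        by (intro sum.cong) (auto simp: D_def a_def)
      finally show ?thesis ..
    qed
    have D_le: "\<bar>\<Sum>i\<in>I. D i x * (y i - x i)\<bar> \<le> 2 * pi * B * M1 * l1norm I a"
    proof -
      have "\<bar>\<Sum>i\<in>I. D i x * (y i - x i)\<bar> \<le> (\<integral>t. \<bar>F (?m x t) * (2 * pi * ?S t)\<bar> \<partial>gauss I)"
        unfolding D_eq by (rule integral_abs_bound)
      also have "\<dots> \<le> (\<integral>t. 2 * pi * B * l1norm I a * l1norm I t \<partial>gauss I)"
      proof (rule integral_mono)
        fix t
        have "\<bar>F (?m x t) * (2 * pi * ?S t)\<bar> \<le> B * (2 * pi * (l1norm I a * l1norm I t))"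
          unfolding abs_mult using abs_sum_mult_le_l1norm[where I=I and x=a and y=t, OF abs_coord_le_l1norm[OF I]] B[of "?m x t"]
          by (intro mult_mono) auto
        then show "\<bar>F (?m x t) * (2 * pi * ?S t)\<bar> \<le> 2 * pi * B * l1norm I a * l1norm I t" by (simp add: mult_ac)
      qed (use intm[of "\<lambda>t. 2 * pi * ?S t"] Si integrable_l1norm[OF I] in auto)
      finally show ?thesis by (simp add: M1_def mult_ac)
    qed
    have "?A y = (\<integral>t. F (?m x (\<lambda>i\<in>I. t i + a i)) \<partial>gauss I)"
    proof -
      have "?m y t = ?m x (\<lambda>i\<in>I. t i + a i)" for t
        using sk by (auto simp: mix_def fun_eq_iff a_def algebra_simps)
      then show ?thesis by (simp add: mehler_def)
    qed
    also have "\<dots> = (\<integral>t. F (?m x t) * ?e t \<partial>gauss I)"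
      by (rule integral_gauss_shift[OF I]) (use bmeas_mix[OF I F] in \<open>simp add: bmeas_def\<close>)
    finally have Ay: "?A y = (\<integral>t. F (?m x t) * ?e t \<partial>gauss I)" .
    let ?R = "?A y - ?A x - (\<Sum>i\<in>I. D i x * (y i - x i))"
    have R1: "\<bar>?R\<bar> \<le> B * X * (l1norm I a)\<^sup>2" if "l1norm I a \<le> 1"
    proof -
      have "\<bar>?R\<bar> = \<bar>\<integral>t. F (?m x t) * (?e t - 1 - 2 * pi * ?S t) \<partial>gauss I\<bar>"
        unfolding Ay D_eq unfolding mehler_def using int intm[OF integrable_tilt] intm[of "\<lambda>t. 2 * pi * ?S t"] Si
        by (simp add: right_diff_distrib del: mult_cancel_left)
      also have "\<dots> \<le> (\<integral>t. \<bar>F (?m x t) * (?e t - 1 - 2 * pi * ?S t)\<bar> \<partial>gauss I)" by (rule integral_abs_bound)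
      also have "\<dots> \<le> (\<integral>t. B * ((l1norm I a)\<^sup>2 * (2 * exp (2 * pi) * exp (4 * pi * l1norm I t) + pi)) \<partial>gauss I)"
      proof (rule integral_mono)
        have "integrable (gauss I) (\<lambda>t. ?e t - 1 - 2 * pi * ?S t)"
          using Si integrable_tilt by (intro Bochner_Integration.integrable_diff) auto
        from intm[OF this] show "integrable (gauss I) (\<lambda>t. \<bar>F (?m x t) * (?e t - 1 - 2 * pi * ?S t)\<bar>)" by simp
        fix t show "\<bar>F (?m x t) * (?e t - 1 - 2 * pi * ?S t)\<bar> \<le> B * ((l1norm I a)\<^sup>2 * (2 * exp (2 * pi) * exp (4 * pi * l1norm I t) + pi))"
          unfolding abs_mult using B[of "?m x t"] exp_tilt_bound[OF that, of t] Bp by (intro mult_mono) auto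
      qed (use Xi in auto)
      also have "\<dots> = B * ((l1norm I a)\<^sup>2 * X)" unfolding X_def by (simp only: integral_mult_right_zero)
      also have "\<dots> = B * X * (l1norm I a)\<^sup>2" by simp
      finally show ?thesis .
    qed
    have R2: "\<bar>?R\<bar> \<le> 2 * B + 2 * pi * B * M1 * l1norm I a" using avgB[of x] avgB[of y] D_le by linarith
    have na0: "0 \<le> l1norm I a" by simp
    have R: "\<bar>?R\<bar> \<le> K * (l1norm I a)\<^sup>2"
    proof (cases "l1norm I a \<le> 1")
      case True
      from R1[OF True] have "\<bar>?R\<bar> \<le> B * X * (l1norm I a)\<^sup>2" .
      also have "\<dots> \<le> K * (l1norm I a)\<^sup>2" using Bp M1 by (intro mult_right_mono) (auto simp: K_def)
      finally show ?thesis .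
    next
      case False
      then have g: "1 \<le> l1norm I a" by simp
      then have g2: "l1norm I a \<le> (l1norm I a)\<^sup>2" by (simp add: power2_eq_square)
      have "2 * B * 1 \<le> 2 * B * (l1norm I a)\<^sup>2" using g g2 Bp by (intro mult_left_mono) auto
      moreover have "2 * pi * B * M1 * l1norm I a \<le> 2 * pi * B * M1 * (l1norm I a)\<^sup>2" using g2 Bp M1 by (intro mult_left_mono) auto
      moreover have "0 \<le> B * X * (l1norm I a)\<^sup>2" using Bp X by simp
      ultimately show ?thesis using R2 by (simp add: K_def algebra_simps)
    qed
    have Lp: "\<bar>?A y - ?A x\<bar> \<le> (K + 2 * pi * B * M1) * l1norm I a"
    proof (cases "l1norm I a \<le> 1")
      case True
      then have "(l1norm I a)\<^sup>2 \<le> l1norm I a" using na0 by (simp add: power2_eq_square mult_left_le_one_le)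
      then have "K * (l1norm I a)\<^sup>2 \<le> K * l1norm I a" using K by (intro mult_left_mono)
      then show ?thesis using R D_le by (simp add: distrib_right)
    next
      case False
      have "2 * B * 1 \<le> (K + 2 * pi * B * M1) * l1norm I a"
        using False Bp X M1 by (intro mult_mono) (auto simp: K_def)
      then show ?thesis using avgB[of x] avgB[of y] by linarith
    qed
    show ?thesis using R Lp unfolding na by (simp add: power_mult_distrib mult_ac)
  qed
  show ?thesis
  proof (intro exI conjI)
    show "0 \<le> (K + 2 * pi * B * M1) * k" "0 \<le> K * k\<^sup>2" using K k Bp M1 by auto
    show "lipschitz_l1 I ((K + 2 * pi * B * M1) * k) ?A" using key by (auto simp: lipschitz_l1_def)
    show "taylor_l1 I (K * k\<^sup>2) ?A" unfolding taylor_l1_def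
    proof (intro exI[of _ D] conjI ballI)
      fix i assume "i \<in> I" then show "bmeas I (D i)"
        unfolding D_def by (intro bmeas_mult[OF I] bmeas_const[OF I] bmeas_hermite[OF I F])
    qed (use key in auto)
  qed
qed

end

section \<open>Strong continuity of the Mehler operator\<close>

lemma abs_indicator_Un_diff:
  "\<bar>indicator (A \<union> B) x - indicator (A \<union> B) y\<bar>
    \<le> \<bar>indicator A x - indicator A y\<bar> + \<bar>indicator B x - indicator B y :: real\<bar>"
  by (cases "x \<in> A"; cases "x \<in> B"; cases "y \<in> A"; cases "y \<in> B") simp_all

context
  fixes I :: "nat set" assumes I: "finite I"
begin

text \<open>The displacement is measured on the product space, before the noise is averaged out, so
  that it dominates the L1 distance between F and its Mehler average.\<close>

definition osc :: "real \<Rightarrow> ((nat \<Rightarrow> real) \<Rightarrow> real) \<Rightarrow> real" where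
  "osc s F = (\<integral>p. \<bar>F (mix I (\<lambda>_. sqrt (1 - s\<^sup>2)) (\<lambda>_. s) (fst p) (snd p)) - F (fst p)\<bar> \<partial>(gauss I \<Otimes>\<^sub>M gauss I))"

text \<open>The mixture and the first projection both have law \<open>gauss I\<close>, so composing
  F with either preserves its L1 norm.\<close>

lemma osc_integrable:
  fixes F :: "(nat \<Rightarrow> real) \<Rightarrow> real"
  assumes s: "0 \<le> s" "s \<le> 1" and F: "integrable (gauss I) F"
  shows "integrable (gauss I \<Otimes>\<^sub>M gauss I) (\<lambda>p. F (mix I (\<lambda>_. sqrt (1 - s\<^sup>2)) (\<lambda>_. s) (fst p) (snd p)))"
    and "integrable (gauss I \<Otimes>\<^sub>M gauss I) (\<lambda>p. F (fst p))"
    and "(\<integral>p. \<bar>F (mix I (\<lambda>_. sqrt (1 - s\<^sup>2)) (\<lambda>_. s) (fst p) (snd p))\<bar> \<partial>(gauss I \<Otimes>\<^sub>M gauss I)) = (\<integral>x. \<bar>F x\<bar> \<partial>gauss I)"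
    and "(\<integral>p. \<bar>F (fst p)\<bar> \<partial>(gauss I \<Otimes>\<^sub>M gauss I)) = (\<integral>x. \<bar>F x\<bar> \<partial>gauss I)"
proof -
  interpret P: pair_sigma_finite "gauss I" "gauss I" ..
  have s1: "s\<^sup>2 \<le> 1" using s by (simp add: power_le_one)
  have cs: "(sqrt (1 - s\<^sup>2))\<^sup>2 + s\<^sup>2 = 1" using s1 by simp
  have Fa: "integrable (gauss I) (\<lambda>x. \<bar>F x\<bar>)" using F by simp
  have [measurable]: "F \<in> borel_measurable (gauss I)" using F by simp
  note m = integral_mix[OF I cs]
  show "integrable (gauss I \<Otimes>\<^sub>M gauss I) (\<lambda>p. F (mix I (\<lambda>_. sqrt (1 - s\<^sup>2)) (\<lambda>_. s) (fst p) (snd p)))"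
    by (rule m(2)[OF F])
  have d: "distr (gauss I \<Otimes>\<^sub>M gauss I) (gauss I) fst = gauss I"
    by (simp add: gauss.distr_pair_fst)
  show "integrable (gauss I \<Otimes>\<^sub>M gauss I) (\<lambda>p. F (fst p))"
    by (rule integrable_distr[where M'="gauss I" and T=fst]) (auto simp: d F)
  show "(\<integral>p. \<bar>F (mix I (\<lambda>_. sqrt (1 - s\<^sup>2)) (\<lambda>_. s) (fst p) (snd p))\<bar> \<partial>(gauss I \<Otimes>\<^sub>M gauss I)) = (\<integral>x. \<bar>F x\<bar> \<partial>gauss I)"
    using P.integral_fst'[OF m(2)[OF Fa]] m(1)[OF Fa] by simp
  show "(\<integral>p. \<bar>F (fst p)\<bar> \<partial>(gauss I \<Otimes>\<^sub>M gauss I)) = (\<integral>x. \<bar>F x\<bar> \<partial>gauss I)"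
    using integral_distr[of fst "gauss I \<Otimes>\<^sub>M gauss I" "gauss I" "\<lambda>x. \<bar>F x\<bar>"] by (simp add: d)
qed

lemma osc_nonneg: "0 \<le> osc s F"
  unfolding osc_def by simp

lemma osc_add:
  assumes s: "0 \<le> s" "s \<le> 1" and F: "integrable (gauss I) F" and G: "integrable (gauss I) G"
  shows "osc s (\<lambda>x. F x + G x) \<le> osc s F + osc s G"
proof -
  note f = osc_integrable[OF s F] and g = osc_integrable[OF s G]
  let ?m = "\<lambda>p. mix I (\<lambda>_. sqrt (1 - s\<^sup>2)) (\<lambda>_. s) (fst p) (snd p)"
  have "osc s (\<lambda>x. F x + G x) \<le> (\<integral>p. \<bar>F (?m p) - F (fst p)\<bar> + \<bar>G (?m p) - G (fst p)\<bar> \<partial>(gauss I \<Otimes>\<^sub>M gauss I))"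
    unfolding osc_def using f(1,2) g(1,2) by (intro integral_mono) auto
  also have "\<dots> = osc s F + osc s G"
    unfolding osc_def using f(1,2) g(1,2) by (intro Bochner_Integration.integral_add) auto
  finally show ?thesis .
qed

text \<open>The constant 2 is independent of s; this uniformity lets strong continuity pass to L1
  limits.\<close>

lemma osc_le:
  assumes s: "0 \<le> s" "s \<le> 1" and F: "integrable (gauss I) F"
  shows "osc s F \<le> 2 * (\<integral>x. \<bar>F x\<bar> \<partial>gauss I)"
proof -
  note f = osc_integrable[OF s F]
  let ?m = "\<lambda>p. mix I (\<lambda>_. sqrt (1 - s\<^sup>2)) (\<lambda>_. s) (fst p) (snd p)"
  have "osc s F \<le> (\<integral>p. \<bar>F (?m p)\<bar> + \<bar>F (fst p)\<bar> \<partial>(gauss I \<Otimes>\<^sub>M gauss I))"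
    unfolding osc_def using f(1,2) by (intro integral_mono) auto
  also have "\<dots> = 2 * (\<integral>x. \<bar>F x\<bar> \<partial>gauss I)"
    using f by (subst Bochner_Integration.integral_add) auto
  finally show ?thesis .
qed

text \<open>The class on which strong continuity holds. It is shown to be closed under sums, scalars
  and L1 limits and to contain indicators of half-spaces, and the measurable structure then yields
  all of L1.\<close>

definition good :: "((nat \<Rightarrow> real) \<Rightarrow> real) \<Rightarrow> bool" where
  "good F \<longleftrightarrow> integrable (gauss I) F \<and> (\<lambda>n. osc (1 / real (Suc n)) F) \<longlonglongrightarrow> 0"

lemma good_lim:
  assumes F: "integrable (gauss I) F" and ap: "\<And>e. 0 < e \<Longrightarrow> \<exists>G. good G \<and> (\<integral>x. \<bar>F x - G x\<bar> \<partial>gauss I) < e"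
  shows "good F"
  unfolding good_def
proof (intro conjI F)
  show "(\<lambda>n. osc (1 / real (Suc n)) F) \<longlonglongrightarrow> 0"
  proof (rule LIMSEQ_I)
    fix r :: real assume "0 < r"
    then obtain G where G: "good G" "(\<integral>x. \<bar>F x - G x\<bar> \<partial>gauss I) < r / 4" using ap[of "r / 4"] by auto
    from G(1) have Gi: "integrable (gauss I) G" and "(\<lambda>n. osc (1 / real (Suc n)) G) \<longlonglongrightarrow> 0" by (auto simp: good_def)
    from LIMSEQ_D[OF this(2), of "r / 2"] \<open>0 < r\<close> obtain N where N: "\<And>n. n \<ge> N \<Longrightarrow> osc (1 / real (Suc n)) G < r / 2"
      using osc_nonneg by auto
    show "\<exists>no. \<forall>n\<ge>no. norm (osc (1 / real (Suc n)) F - 0) < r"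
    proof (intro exI[of _ N] allI impI)
      fix n assume n: "N \<le> n"
      let ?s = "1 / real (Suc n)"
      have s: "0 \<le> ?s" "?s \<le> 1" by auto
      have D: "integrable (gauss I) (\<lambda>x. F x - G x)" using F Gi by simp
      have "osc ?s F = osc ?s (\<lambda>x. (F x - G x) + G x)" by simp
      also have "\<dots> \<le> osc ?s (\<lambda>x. F x - G x) + osc ?s G" by (rule osc_add[OF s D Gi])
      also have "\<dots> < r" using osc_le[OF s D] G(2) N[OF n] by simp
      finally show "norm (osc ?s F - 0) < r" using osc_nonneg by simp
    qed
  qed
qed

lemma good_add:
  assumes "good F" "good G" shows "good (\<lambda>x. F x + G x)"
proof -
  from assms have F: "integrable (gauss I) F" and G: "integrable (gauss I) G"
    and l: "(\<lambda>n. osc (1 / real (Suc n)) F) \<longlonglongrightarrow> 0" "(\<lambda>n. osc (1 / real (Suc n)) G) \<longlonglongrightarrow> 0" by (auto simp: good_def)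
  have "(\<lambda>n. osc (1 / real (Suc n)) F + osc (1 / real (Suc n)) G) \<longlonglongrightarrow> 0" using tendsto_add[OF l] by simp
  then have "(\<lambda>n. osc (1 / real (Suc n)) (\<lambda>x. F x + G x)) \<longlonglongrightarrow> 0"
    by (rule Lim_null_comparison[rotated]) (use osc_add[OF _ _ F G] osc_nonneg in auto)
  with F G show ?thesis by (simp add: good_def)
qed

lemma good_cmult:
  assumes "good F" shows "good (\<lambda>x. F x * a)"
proof -
  have "osc s (\<lambda>x. F x * a) = osc s F * \<bar>a\<bar>" for s
    unfolding osc_def left_diff_distrib[symmetric] abs_mult by simp
  then show ?thesis using assms tendsto_mult_right[of "\<lambda>n. osc (1 / real (Suc n)) F" 0 sequentially "\<bar>a\<bar>"]
    by (auto simp: good_def)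
qed

lemma good_const: "good (\<lambda>_. a)"
  by (simp add: good_def osc_def)

text \<open>The indicator is continuous off the hyperplane x_i = q, which is Gaussian-null, and the
  mixture tends to its first argument as s tends to 0. Dominated convergence does the rest.\<close>

lemma good_halfspace:
  assumes i: "i \<in> I"
  shows "good (indicator {x \<in> extensional I. x i \<le> q})"
proof -
  let ?A = "{x \<in> extensional I. x i \<le> q}"
  let ?s = "\<lambda>n. 1 / real (Suc n)" and ?c = "\<lambda>n. sqrt (1 - (1 / real (Suc n))\<^sup>2)"
  let ?m = "\<lambda>n p. mix I (\<lambda>_. ?c n) (\<lambda>_. ?s n) (fst p) (snd p)"
  note [measurable] = coord_measurable[OF I i]
  have "{x \<in> space (gauss I). x i \<le> q} \<in> sets (gauss I)" by measurable
  then have A [measurable]: "?A \<in> sets (gauss I)" by (simp add: space_gauss)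
  have c1: "?c \<longlonglongrightarrow> 1" and s0: "?s \<longlonglongrightarrow> 0" by real_asymp+
  have int: "integrable (gauss I) (indicator ?A :: _ \<Rightarrow> real)" by (rule gauss.integrable_const_bound[of _ 1]) auto
  \<comment> \<open>The null set is pulled back from the line, first to the i-th coordinate and then
    to the first factor of the product space.\<close>
  have ne: "AE p in gauss I \<Otimes>\<^sub>M gauss I. fst p i \<noteq> q"
  proof -
    have "AE x in lborel. x \<noteq> q" by (rule AE_lborel_singleton)
    then have "AE x in gauss1. x \<noteq> q" unfolding gauss1_def by (subst AE_density) auto
    then have "AE x in distr (gauss I) gauss1 (\<lambda>x. x i). x \<noteq> q" by (subst distr_gauss1_component[OF i])
    then have "AE x in gauss I. x i \<noteq> q"
      by (subst (asm) AE_distr_iff) (use i in \<open>auto simp: gauss_def\<close>)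
    then have "AE x in distr (gauss I \<Otimes>\<^sub>M gauss I) (gauss I) fst. x i \<noteq> q" by (subst gauss.distr_pair_fst)
    then show ?thesis by (rule AE_distrD[OF measurable_fst])
  qed
  have m: "?m n \<in> measurable (gauss I \<Otimes>\<^sub>M gauss I) (gauss I)" for n by measurable
  have "(\<lambda>n. \<integral>p. \<bar>indicator ?A (?m n p) - indicator ?A (fst p)\<bar> \<partial>(gauss I \<Otimes>\<^sub>M gauss I)) \<longlonglongrightarrow> (\<integral>p. 0 \<partial>(gauss I \<Otimes>\<^sub>M gauss I) :: real)"
  proof (rule integral_dominated_convergence[where w="\<lambda>_. 1"])
    show "(\<lambda>p. \<bar>indicator ?A (?m n p) - indicator ?A (fst p)\<bar> :: real) \<in> borel_measurable (gauss I \<Otimes>\<^sub>M gauss I)" for n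
      using m[of n] by measurable
    interpret P: prob_space "gauss I \<Otimes>\<^sub>M gauss I" by (rule prob_space_pair) (rule prob_space_gauss)+
    show "integrable (gauss I \<Otimes>\<^sub>M gauss I) (\<lambda>_. 1 :: real)" by simp
    show "AE p in gauss I \<Otimes>\<^sub>M gauss I. (\<lambda>n. \<bar>indicator ?A (?m n p) - indicator ?A (fst p)\<bar>) \<longlonglongrightarrow> (0 :: real)"
      using ne AE_space
    proof eventually_elim
      case (elim p)
      have e: "fst p \<in> extensional I" using elim(2) by (auto simp: space_pair_measure space_gauss)
      have "(\<lambda>n. ?c n * fst p i + ?s n * snd p i) \<longlonglongrightarrow> 1 * fst p i + 0 * snd p i"
        by (intro tendsto_intros c1 s0)
      then have l: "(\<lambda>n. ?m n p i) \<longlonglongrightarrow> fst p i" using i by simp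
      have "eventually (\<lambda>n. indicator ?A (?m n p) = (indicator ?A (fst p) :: real)) sequentially"
      proof (cases "fst p i < q")
        case True
        from order_tendstoD(2)[OF l this] show ?thesis
          by eventually_elim (use True e in \<open>auto simp: indicator_def\<close>)
      next
        case False
        then have "q < fst p i" using elim by simp
        from order_tendstoD(1)[OF l this] show ?thesis
          by eventually_elim (use False e \<open>q < fst p i\<close> in \<open>auto simp: indicator_def\<close>)
      qed
      then have "eventually (\<lambda>n. \<bar>indicator ?A (?m n p) - indicator ?A (fst p)\<bar> = (0::real)) sequentially"
        by eventually_elim simp
      then show ?case by (rule tendsto_eventually)
    qed
    show "AE p in gauss I \<Otimes>\<^sub>M gauss I. norm \<bar>indicator ?A (?m n p) - indicator ?A (fst p) :: real\<bar> \<le> 1" for n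
      by (auto simp: indicator_def)
  qed (rule borel_measurable_const)
  then show ?thesis using int by (simp add: good_def osc_def)
qed

text \<open>The sets with good indicator form a sigma-algebra containing all half-spaces, hence
  contain every set of the product sigma-algebra.\<close>

lemma good_indicator:
  assumes A: "A \<in> sets (gauss I)"
  shows "good (indicator A)"
proof -
  define G where "G = {A \<in> sets (gauss I). good (indicator A)}"
  have sa: "sigma_algebra (extensional I) G"
    unfolding sigma_algebra_iff2
  proof (intro conjI ballI allI impI)
    show "G \<subseteq> Pow (extensional I)" using sets.sets_into_space[of _ "gauss I"] by (auto simp: G_def space_gauss)
    show "{} \<in> G" using good_const[of 0] by (simp add: G_def indicator_def[abs_def])
  next
    fix B assume B: "B \<in> G"
    have "good (\<lambda>x. 1 + indicator B x * (-1))"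
      using B by (intro good_add good_const good_cmult) (auto simp: G_def)
    moreover have "osc s (\<lambda>x. 1 + indicator B x * (-1)) = osc s (indicator (extensional I - B))" for s
      unfolding osc_def
      by (intro Bochner_Integration.integral_cong refl)
         (auto simp: indicator_def space_pair_measure space_gauss)
    moreover have "extensional I - B \<in> sets (gauss I)"
      using B sets.compl_sets[of B "gauss I"] by (auto simp: G_def space_gauss)
    moreover from this have "integrable (gauss I) (indicator (extensional I - B) :: _ \<Rightarrow> real)"
      by (intro gauss.integrable_const_bound[of _ 1]) auto
    ultimately show "extensional I - B \<in> G" by (simp add: G_def good_def)
  next
    fix A :: "nat \<Rightarrow> (nat \<Rightarrow> real) set" assume r: "range A \<subseteq> G"
    have As: "A k \<in> sets (gauss I)" and Ag: "good (indicator (A k))" for k using r by (auto simp: G_def)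
    \<comment> \<open>Unions need not be disjoint; oscillations of indicators are subadditive
      pointwise, which handles finite unions. Countable unions are then L1 limits.\<close>
    have fin: "good (indicator (\<Union>k<n. A k)) \<and> (\<Union>k<n. A k) \<in> sets (gauss I)" for n
    proof (induction n)
      case 0 then show ?case using good_const[of 0] by (simp add: indicator_def[abs_def])
    next
      case (Suc n)
      define U where "U = (\<Union>k<n. A k)"
      have U: "(\<Union>k<Suc n. A k) = U \<union> A n" by (auto simp: U_def less_Suc_eq)
      have SU: "good (indicator U)" "U \<in> sets (gauss I)" using Suc by (auto simp: U_def)
      have s: "U \<union> A n \<in> sets (gauss I)" using SU As by auto
      have int: "integrable (gauss I) (indicator (U \<union> A n) :: _ \<Rightarrow> real)"
        using s by (intro gauss.integrable_const_bound[of _ 1]) auto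
      have iU: "integrable (gauss I) (indicator U :: _ \<Rightarrow> real)" and iA: "integrable (gauss I) (indicator (A n) :: _ \<Rightarrow> real)"
        using SU Ag by (auto simp: good_def)
      have le: "osc s (indicator (U \<union> A n)) \<le> osc s (indicator U) + osc s (indicator (A n))" if "0 \<le> s" "s \<le> 1" for s
      proof -
        note f = osc_integrable[OF that iU] and g = osc_integrable[OF that iA] and h = osc_integrable[OF that int]
        have "osc s (indicator (U \<union> A n)) \<le> (\<integral>p. \<bar>indicator U (mix I (\<lambda>_. sqrt (1 - s\<^sup>2)) (\<lambda>_. s) (fst p) (snd p)) - indicator U (fst p)\<bar>
           + \<bar>indicator (A n) (mix I (\<lambda>_. sqrt (1 - s\<^sup>2)) (\<lambda>_. s) (fst p) (snd p)) - indicator (A n) (fst p)\<bar> \<partial>(gauss I \<Otimes>\<^sub>M gauss I))"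
          unfolding osc_def
        proof (intro integral_mono)
          fix p
          show "\<bar>indicator (U \<union> A n) (mix I (\<lambda>_. sqrt (1 - s\<^sup>2)) (\<lambda>_. s) (fst p) (snd p)) - indicator (U \<union> A n) (fst p)\<bar>
            \<le> \<bar>indicator U (mix I (\<lambda>_. sqrt (1 - s\<^sup>2)) (\<lambda>_. s) (fst p) (snd p)) - indicator U (fst p)\<bar>
           + \<bar>indicator (A n) (mix I (\<lambda>_. sqrt (1 - s\<^sup>2)) (\<lambda>_. s) (fst p) (snd p)) - indicator (A n) (fst p) :: real\<bar>"
            by (rule abs_indicator_Un_diff)
        qed (intro Bochner_Integration.integrable_add Bochner_Integration.integrable_abs Bochner_Integration.integrable_diff f(1,2) g(1,2) h(1,2))+
        also have "\<dots> = osc s (indicator U) + osc s (indicator (A n))"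
          unfolding osc_def
          by (rule Bochner_Integration.integral_add)
             (intro Bochner_Integration.integrable_abs Bochner_Integration.integrable_diff f(1,2) g(1,2))+
        finally show ?thesis .
      qed
      have "(\<lambda>j. osc (1 / real (Suc j)) (indicator U) + osc (1 / real (Suc j)) (indicator (A n))) \<longlonglongrightarrow> 0"
        using SU Ag by (intro tendsto_add_zero) (auto simp: good_def)
      then have "(\<lambda>j. osc (1 / real (Suc j)) (indicator (U \<union> A n))) \<longlonglongrightarrow> 0"
      proof (rule Lim_null_comparison[rotated, where g="\<lambda>j. osc (1 / real (Suc j)) (indicator U) + osc (1 / real (Suc j)) (indicator (A n))"])
        show "\<forall>\<^sub>F j in sequentially. norm (osc (1 / real (Suc j)) (indicator (U \<union> A n)))
          \<le> osc (1 / real (Suc j)) (indicator U) + osc (1 / real (Suc j)) (indicator (A n))"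
        proof (intro always_eventually allI)
          fix j
          have "osc (1 / real (Suc j)) (indicator (U \<union> A n)) \<le> osc (1 / real (Suc j)) (indicator U) + osc (1 / real (Suc j)) (indicator (A n))"
            by (rule le) auto
          then show "norm (osc (1 / real (Suc j)) (indicator (U \<union> A n))) \<le> osc (1 / real (Suc j)) (indicator U) + osc (1 / real (Suc j)) (indicator (A n))"
            using osc_nonneg[of "1 / real (Suc j)" "indicator (U \<union> A n)"] by (simp only: real_norm_def abs_of_nonneg)
        qed
      qed
      then show ?case unfolding U using s int by (simp add: good_def)
    qed
    let ?V = "\<Union>k. A k"
    have V: "?V \<in> sets (gauss I)" using As by auto
    have "good (indicator ?V)"
    proof (rule good_lim)
      show "integrable (gauss I) (indicator ?V :: _ \<Rightarrow> real)" using V by (intro gauss.integrable_const_bound[of _ 1]) auto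
      fix e :: real assume e: "0 < e"
      have "(\<lambda>n. measure (gauss I) (\<Union>k<n. A k)) \<longlonglongrightarrow> measure (gauss I) (\<Union>n. \<Union>k<n. A k)"
        using fin by (intro gauss.finite_Lim_measure_incseq incseq_SucI UN_mono) auto
      moreover have "(\<Union>n. \<Union>k<n. A k) = ?V" by auto
      ultimately have "(\<lambda>n. measure (gauss I) (\<Union>k<n. A k)) \<longlonglongrightarrow> measure (gauss I) ?V" by simp
      from LIMSEQ_D[OF this e] obtain n where n: "\<bar>measure (gauss I) (\<Union>k<n. A k) - measure (gauss I) ?V\<bar> < e" by auto
      have sub: "(\<Union>k<n. A k) \<subseteq> ?V" by auto
      have "(\<integral>x. \<bar>indicator ?V x - indicator (\<Union>k<n. A k) x :: real\<bar> \<partial>gauss I) = (\<integral>x. indicator (?V - (\<Union>k<n. A k)) x \<partial>gauss I :: real)"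
        by (intro Bochner_Integration.integral_cong refl) (use sub in \<open>auto simp: indicator_def\<close>)
      also have "\<dots> = measure (gauss I) (?V - (\<Union>k<n. A k))"
        using V fin[of n] sets.sets_into_space[of _ "gauss I"] by (simp add: Int_absorb2 sets.Diff)
      also have "\<dots> = measure (gauss I) ?V - measure (gauss I) (\<Union>k<n. A k)"
        using V fin[of n] sub by (intro gauss.finite_measure_Diff) auto
      also have "\<dots> < e" using n by linarith
      finally show "\<exists>G. good G \<and> (\<integral>x. \<bar>indicator ?V x - G x\<bar> \<partial>gauss I) < e"
        using fin[of n] by blast
    qed
    with V show "?V \<in> G" by (simp add: G_def)
  qed
  then interpret S: sigma_algebra "extensional I" G .
  define N where "N = sigma (extensional I) G"
  have Ns [simp]: "sets N = G" "space N = extensional I"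
    using S.sets_measure_of_eq S.space_measure_of_eq by (simp_all add: N_def)
  have co: "(\<lambda>x. x i) \<in> borel_measurable N" if "i \<in> I" for i
  proof (subst borel_measurable_iff_le, intro allI)
    fix q
    have "{w \<in> space (gauss I). w i \<le> q} \<in> sets (gauss I)" using coord_measurable[OF I that] by measurable
    then show "{w \<in> space N. w i \<le> q} \<in> sets N" using good_halfspace[OF that, of q] by (simp add: G_def space_gauss)
  qed
  \<comment> \<open>Since all coordinates are measurable for N, so is the identity into the product
    space; preimages under it are the sets themselves, which gives the inclusion of
    sigma-algebras.\<close>
  have "(\<lambda>x. x) \<in> measurable N (PiM I (\<lambda>_. borel :: real measure))"
  proof -
    have "(\<lambda>x. \<lambda>i\<in>I. x i) \<in> measurable N (PiM I (\<lambda>_. borel :: real measure))"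
      using co by (rule measurable_restrict)
    then show ?thesis
      by (subst measurable_cong[where g="\<lambda>x. \<lambda>i\<in>I. x i"]) (auto simp: extensional_restrict)
  qed
  moreover have "A \<in> sets (PiM I (\<lambda>_. borel))" using A by (simp add: sets_gauss)
  ultimately have "(\<lambda>x. x) -` A \<inter> space N \<in> sets N" by (rule measurable_sets)
  moreover have "(\<lambda>x. x) -` A \<inter> space N = A" using sets.sets_into_space[OF A] by (auto simp: space_gauss)
  ultimately show ?thesis by (simp add: G_def)
qed

lemma good_integrable:
  assumes F: "integrable (gauss I) F"
  shows "good F"
  using F
proof (induct rule: integrable_induct)
  case (base A c)
  then show ?case using good_cmult[OF good_indicator, of A c] by simp
next
  case (add f g) then show ?case by (intro good_add)
next
  case (lim f s)
  show ?case
  proof (rule good_lim[OF lim(5)])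
    fix e :: real assume e: "0 < e"
    have "(\<lambda>k. \<integral>x. \<bar>f x - s k x\<bar> \<partial>gauss I) \<longlonglongrightarrow> (\<integral>x. 0 \<partial>gauss I)"
    proof (rule integral_dominated_convergence[where w="\<lambda>x. 3 * \<bar>f x\<bar>"])
      have [measurable]: "f \<in> borel_measurable (gauss I)" "s k \<in> borel_measurable (gauss I)" for k using lim by auto
      show "(\<lambda>x. \<bar>f x - s k x\<bar>) \<in> borel_measurable (gauss I)" for k by measurable
      show "integrable (gauss I) (\<lambda>x. 3 * \<bar>f x\<bar>)" using lim(5) by simp
      show "AE x in gauss I. (\<lambda>k. \<bar>f x - s k x\<bar>) \<longlonglongrightarrow> 0"
      proof (rule AE_I2)
        fix x assume "x \<in> space (gauss I)"
        then have "(\<lambda>k. \<bar>f x - s k x\<bar>) \<longlonglongrightarrow> \<bar>f x - f x\<bar>" by (intro tendsto_intros lim(3))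
        then show "(\<lambda>k. \<bar>f x - s k x\<bar>) \<longlonglongrightarrow> 0" by simp
      qed
      show "AE x in gauss I. norm \<bar>f x - s k x\<bar> \<le> 3 * \<bar>f x\<bar>" for k
      proof (rule AE_I2)
        fix x assume "x \<in> space (gauss I)"
        then have "\<bar>s k x\<bar> \<le> 2 * \<bar>f x\<bar>" using lim(4) by simp
        then show "norm \<bar>f x - s k x\<bar> \<le> 3 * \<bar>f x\<bar>" by simp
      qed
    qed (rule borel_measurable_const)
    then have "(\<lambda>k. \<integral>x. \<bar>f x - s k x\<bar> \<partial>gauss I) \<longlonglongrightarrow> 0" by simp
    from LIMSEQ_D[OF this e] obtain k where "\<bar>\<integral>x. \<bar>f x - s k x\<bar> \<partial>gauss I\<bar> < e" by auto
    then show "\<exists>G. good G \<and> (\<integral>x. \<bar>f x - G x\<bar> \<partial>gauss I) < e"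
      using lim(2)[of k] by (intro exI[of _ "s k"]) auto
  qed
qed

text \<open>Averaging over the noise before taking absolute values can only decrease, so the
  distance is at most \<open>osc\<close>.\<close>

lemma mehler_tendsto_L1:
  assumes F: "bmeas I F"
  shows "(\<lambda>n. \<integral>z. \<bar>mehler I (\<lambda>_. sqrt (1 - (1 / real (Suc n))\<^sup>2)) (\<lambda>_. 1 / real (Suc n)) F z - F z\<bar> \<partial>gauss I) \<longlonglongrightarrow> 0"
proof -
  interpret P: pair_sigma_finite "gauss I" "gauss I" ..
  have Fi: "integrable (gauss I) F" by (rule bmeas_integrable[OF I F])
  have "(\<lambda>n. osc (1 / real (Suc n)) F) \<longlonglongrightarrow> 0" using good_integrable[OF Fi] by (simp add: good_def)
  then show ?thesis
  proof (rule Lim_null_comparison[rotated], intro always_eventually allI)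
    fix n
    let ?s = "1 / real (Suc n)"
    let ?c = "sqrt (1 - ?s\<^sup>2)"
    have s: "0 \<le> ?s" "?s \<le> 1" by auto
    have i: "integrable (gauss I \<Otimes>\<^sub>M gauss I) (\<lambda>p. \<bar>F (mix I (\<lambda>_. ?c) (\<lambda>_. ?s) (fst p) (snd p)) - F (fst p)\<bar>)"
      using osc_integrable(1,2)[OF s Fi] by auto
    have "(\<integral>z. \<bar>mehler I (\<lambda>_. ?c) (\<lambda>_. ?s) F z - F z\<bar> \<partial>gauss I)
      \<le> (\<integral>z. (\<integral>y. \<bar>F (mix I (\<lambda>_. ?c) (\<lambda>_. ?s) z y) - F z\<bar> \<partial>gauss I) \<partial>gauss I)"
    proof (rule integral_mono)
      show "integrable (gauss I) (\<lambda>z. \<bar>mehler I (\<lambda>_. ?c) (\<lambda>_. ?s) F z - F z\<bar>)"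
        using bmeas_integrable[OF I bmeas_diff[OF I bmeas_mehler[OF I F] F]] by simp
      show "integrable (gauss I) (\<lambda>z. \<integral>y. \<bar>F (mix I (\<lambda>_. ?c) (\<lambda>_. ?s) z y) - F z\<bar> \<partial>gauss I)"
        using P.integrable_fst'[OF i] by simp
      fix z
      have "mehler I (\<lambda>_. ?c) (\<lambda>_. ?s) F z - F z = (\<integral>y. F (mix I (\<lambda>_. ?c) (\<lambda>_. ?s) z y) - F z \<partial>gauss I)"
        unfolding mehler_def using bmeas_integrable[OF I bmeas_mix[OF I F]] by (simp add: gauss.prob_space)
      then show "\<bar>mehler I (\<lambda>_. ?c) (\<lambda>_. ?s) F z - F z\<bar> \<le> (\<integral>y. \<bar>F (mix I (\<lambda>_. ?c) (\<lambda>_. ?s) z y) - F z\<bar> \<partial>gauss I)"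
        by (simp only: integral_abs_bound)
    qed
    also have "\<dots> = osc ?s F" unfolding osc_def using P.integral_fst'[OF i] by simp
    finally show "norm (\<integral>z. \<bar>mehler I (\<lambda>_. ?c) (\<lambda>_. ?s) F z - F z\<bar> \<partial>gauss I) \<le> osc ?s F" by simp
  qed
qed

end

section \<open>From Fisher information to entropy\<close>

context
  fixes I :: "nat set" assumes I: "finite I"
begin

lemma ent_tendsto:
  assumes F: "between I e B F" and e: "0 < e"
  shows "(\<lambda>n. ent I (mehler I (\<lambda>_. sqrt (1 - (1 / real (Suc n))\<^sup>2)) (\<lambda>_. 1 / real (Suc n)) F)) \<longlonglongrightarrow> ent I F"
proof -
  let ?A = "\<lambda>n. mehler I (\<lambda>_. sqrt (1 - (1 / real (Suc n))\<^sup>2)) (\<lambda>_. 1 / real (Suc n)) F"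
  \<comment> \<open>A bound for the derivative ln + 1 of \<open>phi\<close> on [e, B]; tangent
    inequalities at both end points turn it into a Lipschitz constant.\<close>
  define L where "L = \<bar>ln e\<bar> + \<bar>ln B\<bar> + 1"
  have lip: "\<bar>phi x - phi y\<bar> \<le> L * \<bar>x - y\<bar>" if "e \<le> x" "x \<le> B" "e \<le> y" "y \<le> B" for x y
  proof -
    have d: "(ln m + 1) * (y' - m) \<le> phi y' - phi m \<and> \<bar>(ln m + 1) * (y' - m)\<bar> \<le> L * \<bar>y' - m\<bar>" if "e \<le> m" "m \<le> B" "e \<le> y'" for m y'
    proof
      show "(ln m + 1) * (y' - m) \<le> phi y' - phi m" using phi_tangent[of y' m] that e by simp
      have "ln e \<le> ln m" "ln m \<le> ln B" using that e by auto
      then have "\<bar>ln m + 1\<bar> \<le> L" unfolding L_def by linarith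
      then show "\<bar>(ln m + 1) * (y' - m)\<bar> \<le> L * \<bar>y' - m\<bar>" unfolding abs_mult by (intro mult_right_mono) auto
    qed
    from d[of x y] d[of y x] that show ?thesis by (simp add: abs_minus_commute abs_le_iff)
  qed
  have L: "0 \<le> L" by (simp add: L_def)
  have nn: "0 \<le> G z" if "between I e B G" "z \<in> extensional I" for G z using between_range[OF that] e by linarith
  have Ab: "between I e B (?A n)" for n by (rule between_mehler[OF I F])
  have i1: "integrable (gauss I) (\<lambda>z. phi (G z))" if "between I e B G" for G
    by (rule bmeas_integrable[OF I bmeas_phi[OF I between_bmeas[OF I that] nn[OF that]]])
  have "(\<lambda>n. L * (\<integral>z. \<bar>?A n z - F z\<bar> \<partial>gauss I)) \<longlonglongrightarrow> L * 0"
    by (intro tendsto_mult_left mehler_tendsto_L1[OF I between_bmeas[OF I F]])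
  then have lim: "(\<lambda>n. L * (\<integral>z. \<bar>?A n z - F z\<bar> \<partial>gauss I)) \<longlonglongrightarrow> 0" by simp
  have "(\<lambda>n. ent I (?A n) - ent I F) \<longlonglongrightarrow> 0"
  proof (rule Lim_null_comparison[OF _ lim], intro always_eventually allI)
    fix n
    have "ent I (?A n) - ent I F = (\<integral>z. phi (?A n z) - phi (F z) \<partial>gauss I)"
      unfolding ent_def using i1[OF F] i1[OF Ab] by simp
    then have "norm (ent I (?A n) - ent I F) \<le> (\<integral>z. \<bar>phi (?A n z) - phi (F z)\<bar> \<partial>gauss I)"
      using integral_abs_bound by simp
    also have "\<dots> \<le> (\<integral>z. L * \<bar>?A n z - F z\<bar> \<partial>gauss I)"
    proof (rule integral_mono)
      show "integrable (gauss I) (\<lambda>z. \<bar>phi (?A n z) - phi (F z)\<bar>)" using i1[OF F] i1[OF Ab] by simp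
      show "integrable (gauss I) (\<lambda>z. L * \<bar>?A n z - F z\<bar>)"
        using bmeas_integrable[OF I between_bmeas[OF I F]] bmeas_integrable[OF I between_bmeas[OF I Ab]] by simp
      fix z assume "z \<in> space (gauss I)"
      then have z: "z \<in> extensional I" by (simp add: space_gauss)
      show "\<bar>phi (?A n z) - phi (F z)\<bar> \<le> L * \<bar>?A n z - F z\<bar>"
        using between_range[OF F z] between_range[OF Ab z] by (intro lip) auto
    qed
    finally show "norm (ent I (?A n) - ent I F) \<le> L * (\<integral>z. \<bar>?A n z - F z\<bar> \<partial>gauss I)" by simp
  qed
  then show ?thesis by (simp add: LIM_zero_iff)
qed

section \<open>Entropy contraction for operators that commute with the Mehler steps\<close>

context
  fixes K :: "((nat \<Rightarrow> real) \<Rightarrow> real) \<Rightarrow> (nat \<Rightarrow> real) \<Rightarrow> real" and p C :: real and cylindrical :: "((nat \<Rightarrow> real) \<Rightarrow> real) \<Rightarrow> bool"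
  assumes p: "0 < p" and C: "0 \<le> C"
    and bddK: "\<And>F e B. 0 < e \<Longrightarrow> between I e B F \<Longrightarrow> between I (p * e) B (K F)"
    and comm: "\<And>c s F. c\<^sup>2 + s\<^sup>2 = 1 \<Longrightarrow> bmeas I F \<Longrightarrow> K (mehler I (\<lambda>_. c) (\<lambda>_. s) F) = mehler I (\<lambda>_. c) (\<lambda>_. s) (K F)"
    and fish: "\<And>c s F e B. c\<^sup>2 + s\<^sup>2 = 1 \<Longrightarrow> 0 < e \<Longrightarrow> between I e B F \<Longrightarrow> cylindrical F \<Longrightarrow>
        fisher I (\<lambda>_. c) (\<lambda>_. s) (\<lambda>_. 1) (K F) \<le> C * fisher I (\<lambda>_. c) (\<lambda>_. s) (\<lambda>_. 1) F"
    and cylA: "\<And>c s F. cylindrical F \<Longrightarrow> cylindrical (mehler I (\<lambda>_. c) (\<lambda>_. s) F)"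
begin

text \<open>Run the same Mehler steps on F and on K F. Commutation makes the second orbit the image
  of the first, so the Fisher comparison applies at each step and the entropy drops can be summed.
  The preliminary step (c0, s0) supplies bounds for the error terms that stay valid along both
  orbits.\<close>

lemma contraction_smooth:
  assumes F: "0 < e" "between I e B F" "cylindrical F" and cs0: "c0\<^sup>2 + s0\<^sup>2 = 1" "0 \<le> c0" "0 < s0"
  defines "F0 \<equiv> mehler I (\<lambda>_. c0) (\<lambda>_. s0) F"
  defines "U0 \<equiv> mehler I (\<lambda>_. c0) (\<lambda>_. s0) (K F)"
  shows "ent I U0 - phi (\<integral>z. K F z \<partial>gauss I) \<le> C * (ent I F0 - phi (\<integral>z. F z \<partial>gauss I))"
proof -
  define d where "d = p * e"
  have d: "0 < d" using p F by (simp add: d_def)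
  have KF: "between I d B (K F)" unfolding d_def by (rule bddK[OF F(1,2)])
  note Fm = between_bmeas[OF I F(2)] and KFm = between_bmeas[OF I KF]
  have F0: "between I e B F0" unfolding F0_def by (rule between_mehler[OF I F(2)])
  have U0: "between I d B U0" unfolding U0_def by (rule between_mehler[OF I KF])
  have KF0: "K F0 = U0" unfolding F0_def U0_def by (rule comm[OF cs0(1) Fm])
  obtain L1 where L1: "0 \<le> L1" "lipschitz_l1 I L1 F0" unfolding F0_def using mehler_smooth[OF I Fm cs0(3,2)] by blast
  obtain L H where LH: "0 \<le> L" "0 \<le> H" "lipschitz_l1 I L U0" "taylor_l1 I H U0" unfolding U0_def using mehler_smooth[OF I KFm cs0(3,2)] by blast
  \<comment> \<open>Total error of one step per s^3: the lower estimate for the datum, multiplied by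
    C, plus both errors of the upper estimate for its image.\<close>
  define E where "E = C * (L1 ^ 3 * mom3 I / (6 * e\<^sup>2)) + L ^ 3 * mom3 I / (6 * d\<^sup>2) + H\<^sup>2 * mom4 I / (2 * d)"
  define X where "X = L\<^sup>2 * mom2 I / d"
  have m4: "0 \<le> mom4 I" unfolding mom4_def[OF I] by simp
  have main: "ent I U0 - phi (\<integral>z. K F z \<partial>gauss I) - C * (ent I F0 - phi (\<integral>z. F z \<partial>gauss I))
      \<le> real n * E * s ^ 3 + (1 - s\<^sup>2) ^ n * X" if s: "0 \<le> s" "s \<le> 1" for s :: real and n :: nat
  proof -
    define c where "c = sqrt (1 - s\<^sup>2)"
    have s2: "s\<^sup>2 \<le> 1" using s by (simp add: power_le_one)
    have c2: "c\<^sup>2 = 1 - s\<^sup>2" using s2 by (simp add: c_def)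
    have cs: "c\<^sup>2 + s\<^sup>2 = 1" by (simp add: c2)
    have c0: "0 \<le> c" using s2 by (simp add: c_def)
    have c1: "c \<le> 1" using s2 by (simp add: c_def)
    let ?A = "mehler I (\<lambda>_. c) (\<lambda>_. s)"
    define Fs where "Fs j = (?A ^^ j) F0" for j
    define Us where "Us j = (?A ^^ j) U0" for j
    have Fb: "between I e B (Fs j)" for j by (induction j) (auto simp: Fs_def F0 intro: between_mehler[OF I])
    have Ub: "between I d B (Us j)" for j by (induction j) (auto simp: Us_def U0 intro: between_mehler[OF I])
    have Fc: "cylindrical (Fs j)" for j by (induction j) (auto simp: Fs_def F0_def F intro: cylA)
    have FS: "Fs (Suc j) = ?A (Fs j)" and US: "Us (Suc j) = ?A (Us j)" for j by (simp_all add: Fs_def Us_def)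
    have KU: "K (Fs j) = Us j" for j
    proof (induction j)
      case 0 then show ?case by (simp add: Fs_def Us_def KF0)
    next
      case (Suc j) then show ?case by (simp add: FS US comm[OF cs between_bmeas[OF I Fb]])
    qed
    have Fl: "lipschitz_l1 I (c ^ j * L1) (Fs j)" for j
    proof (induction j)
      case 0 then show ?case by (simp add: Fs_def L1)
    next
      case (Suc j)
      from lipschitz_l1_mehler[OF I between_bmeas[OF I Fb] this c0] c0 L1(1) show ?case by (simp add: FS mult.assoc)
    qed
    have Ul: "lipschitz_l1 I (c ^ j * L) (Us j)" for j
    proof (induction j)
      case 0 then show ?case by (simp add: Us_def LH)
    next
      case (Suc j)
      from lipschitz_l1_mehler[OF I between_bmeas[OF I Ub] this c0] c0 LH(1) show ?case by (simp add: US mult.assoc)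
    qed
    have lw: "lipschitz_l1 I l2 G" if "lipschitz_l1 I l1 G" "l1 \<le> l2" for l1 l2 G
      using that by (meson lipschitz_l1_def mult_right_mono l1norm_nonneg order_trans)
    have cj: "c ^ j * l \<le> l" if "0 \<le> l" for j l using c0 c1 that by (simp add: mult_left_le_one_le power_le_one)
    have Fl': "lipschitz_l1 I L1 (Fs j)" and Ul': "lipschitz_l1 I L (Us j)" for j
      using lw[OF Fl cj[OF L1(1)]] lw[OF Ul cj[OF LH(1)]] by auto
    have Ut: "taylor_l1 I H (Us j)" for j
      by (induction j) (auto simp: Us_def LH US[unfolded Us_def] intro!: taylor_l1_mehler[OF I between_bmeas[OF I Ub[unfolded Us_def]]] c0 c1)
    have step: "ent I (Us j) - ent I (Us (Suc j)) \<le> C * (ent I (Fs j) - ent I (Fs (Suc j))) + E * s ^ 3" for j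
    proof -
      let ?JU = "fisher I (\<lambda>_. c) (\<lambda>_. s) (\<lambda>_. 1) (Us j)" and ?JF = "fisher I (\<lambda>_. c) (\<lambda>_. s) (\<lambda>_. 1) (Fs j)"
      have "ent I (Us j) - ent I (Us (Suc j)) \<le> pi * ?JU + L ^ 3 * s ^ 3 * mom3 I / (6 * d\<^sup>2) + H\<^sup>2 * s ^ 4 * mom4 I / (2 * d)"
        unfolding US by (rule step_upper[OF I cs s(1) Ub d Ul' LH(1) Ut LH(2)])
      moreover have "pi * ?JU \<le> pi * (C * ?JF)"
        using fish[OF cs F(1) Fb Fc, of j] by (intro mult_left_mono) (auto simp: KU)
      moreover have "C * (pi * ?JF - L1 ^ 3 * s ^ 3 * mom3 I / (6 * e\<^sup>2)) \<le> C * (ent I (Fs j) - ent I (Fs (Suc j)))"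
        unfolding FS by (intro mult_left_mono C step_lower[OF I cs s(1) Fb F(1) Fl' L1(1)])
      \<comment> \<open>For s <= 1 the quartic error is merged into the cubic one.\<close>
      moreover have "H\<^sup>2 * s ^ 4 * mom4 I / (2 * d) \<le> H\<^sup>2 * s ^ 3 * mom4 I / (2 * d)"
        using s d m4 by (intro divide_right_mono mult_right_mono mult_left_mono power_decreasing) auto
      moreover have "E * s ^ 3 = C * (L1 ^ 3 * s ^ 3 * mom3 I / (6 * e\<^sup>2)) + L ^ 3 * s ^ 3 * mom3 I / (6 * d\<^sup>2)
         + H\<^sup>2 * s ^ 3 * mom4 I / (2 * d)"
        by (simp add: E_def algebra_simps add_divide_distrib)
      moreover have "C * (pi * ?JF - L1 ^ 3 * s ^ 3 * mom3 I / (6 * e\<^sup>2))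
         = pi * (C * ?JF) - C * (L1 ^ 3 * s ^ 3 * mom3 I / (6 * e\<^sup>2))"
        by (simp only: right_diff_distrib mult.left_commute)
      ultimately show ?thesis by linarith
    qed
    have sum: "ent I U0 - ent I (Us n) \<le> C * (ent I F0 - ent I (Fs n)) + real n * E * s ^ 3" for n
    proof (induction n)
      case 0 then show ?case by (simp add: Us_def Fs_def)
    next
      case (Suc n)
      with step[of n] show ?case by (simp add: algebra_simps)
    qed
    have iF: "(\<integral>z. Fs j z \<partial>gauss I) = (\<integral>z. F z \<partial>gauss I)" for j
    proof (induction j)
      case 0 then show ?case unfolding Fs_def F0_def using integral_mehler[OF I cs0(1) Fm] by simp
    next
      case (Suc j) then show ?case unfolding FS using integral_mehler[OF I cs between_bmeas[OF I Fb]] by simp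
    qed
    have iU: "(\<integral>z. Us j z \<partial>gauss I) = (\<integral>z. K F z \<partial>gauss I)" for j
    proof (induction j)
      case 0 then show ?case unfolding Us_def U0_def using integral_mehler[OF I cs0(1) KFm] by simp
    next
      case (Suc j) then show ?case unfolding US using integral_mehler[OF I cs between_bmeas[OF I Ub]] by simp
    qed
    have "phi (\<integral>z. F z \<partial>gauss I) \<le> ent I (Fs n)"
      using ent_lower[OF I Fb F(1), of n] by (simp add: iF)
    then have "C * (ent I F0 - ent I (Fs n)) \<le> C * (ent I F0 - phi (\<integral>z. F z \<partial>gauss I))"
      using C by (intro mult_left_mono) auto
    \<comment> \<open>After n steps the Lipschitz constant is c^n L, whose square is (1 - s^2)^n
      L^2. The datum requires only Jensen at its end point, because there the remaining entropy
      enters with a favourable sign.\<close>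
    moreover have "ent I (Us n) \<le> phi (\<integral>z. K F z \<partial>gauss I) + (1 - s\<^sup>2) ^ n * X"
    proof -
      have "(c ^ n * L)\<^sup>2 * mom2 I / d = (1 - s\<^sup>2) ^ n * X"
        by (simp add: X_def power_mult_distrib c2[symmetric] power_mult[symmetric] mult.commute)
      then show ?thesis
        using ent_upper_lip[OF I Ub d Ul, of n] c0 LH(1) by (simp add: iU)
    qed
    ultimately show ?thesis using sum[of n] by linarith
  qed
  \<comment> \<open>The choice s = m^(-2) and n = m^5 gives n s^3 = 1/m and n s^2 = m, so both the
    accumulated error and the residual entropy vanish.\<close>
  let ?g = "\<lambda>m. real (m ^ 5) * E * (1 / real m ^ 2) ^ 3 + exp (- real m) * \<bar>X\<bar>"
  have "ent I U0 - phi (\<integral>z. K F z \<partial>gauss I) - C * (ent I F0 - phi (\<integral>z. F z \<partial>gauss I)) \<le> 0"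
  proof (rule LIMSEQ_le_const)
    show "?g \<longlonglongrightarrow> 0" by real_asymp
    show "\<exists>N. \<forall>m\<ge>N. ent I U0 - phi (\<integral>z. K F z \<partial>gauss I) - C * (ent I F0 - phi (\<integral>z. F z \<partial>gauss I)) \<le> ?g m"
    proof (intro exI[of _ 1] allI impI)
      fix m :: nat assume m: "1 \<le> m"
      let ?s = "1 / real m ^ 2"
      have s: "0 \<le> ?s" "?s \<le> 1" using m by auto
      have "(1 - ?s\<^sup>2) ^ (m ^ 5) \<le> exp (- ?s\<^sup>2) ^ (m ^ 5)"
        using s exp_ge_add_one_self[of "- ?s\<^sup>2"] by (intro power_mono) (auto simp: power_le_one)
      also have "\<dots> = exp (- real m)"
        using m by (simp add: exp_of_nat_mult[symmetric] power_divide power_mult[symmetric]) (simp add: eval_nat_numeral)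
      finally have "(1 - ?s\<^sup>2) ^ (m ^ 5) * X \<le> exp (- real m) * \<bar>X\<bar>"
        using s by (intro order_trans[OF mult_left_mono[OF abs_ge_self] mult_right_mono]) (auto simp: power_le_one)
      then show "ent I U0 - phi (\<integral>z. K F z \<partial>gauss I) - C * (ent I F0 - phi (\<integral>z. F z \<partial>gauss I)) \<le> ?g m"
        using main[OF s, of "m ^ 5"] by linarith
    qed
  qed
  then show ?thesis by simp
qed

text \<open>The preliminary smoothing is removed asymmetrically: on the left the entropy converges
  as s tends to 0, while on the right smoothing only lowers the entropy.\<close>

theorem entropy_contraction:
  assumes F: "0 < e" "between I e B F" "cylindrical F"
  shows "ent I (K F) - phi (\<integral>z. K F z \<partial>gauss I) \<le> C * (ent I F - phi (\<integral>z. F z \<partial>gauss I))"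
proof (rule LIMSEQ_le_const2)
  let ?A = "\<lambda>n. mehler I (\<lambda>_. sqrt (1 - (1 / real (Suc n))\<^sup>2)) (\<lambda>_. 1 / real (Suc n))"
  show "(\<lambda>n. ent I (?A n (K F)) - phi (\<integral>z. K F z \<partial>gauss I)) \<longlonglongrightarrow> ent I (K F) - phi (\<integral>z. K F z \<partial>gauss I)"
    by (intro tendsto_intros ent_tendsto[OF bddK[OF F(1,2)]]) (use p F in simp)
  show "\<exists>N. \<forall>n\<ge>N. ent I (?A n (K F)) - phi (\<integral>z. K F z \<partial>gauss I) \<le> C * (ent I F - phi (\<integral>z. F z \<partial>gauss I))"
  proof (intro exI allI impI)
    fix n
    let ?s = "1 / real (Suc n)"
    let ?c = "sqrt (1 - ?s\<^sup>2)"
    have s: "0 < ?s" "?s\<^sup>2 \<le> 1" by (auto simp: power_le_one)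
    then have cs: "?c\<^sup>2 + ?s\<^sup>2 = 1" and c: "0 \<le> ?c" by auto
    have "ent I (?A n (K F)) - phi (\<integral>z. K F z \<partial>gauss I) \<le> C * (ent I (?A n F) - phi (\<integral>z. F z \<partial>gauss I))"
      by (rule contraction_smooth[OF F cs c s(1)])
    also have "\<dots> \<le> C * (ent I F - phi (\<integral>z. F z \<partial>gauss I))"
      using ent_mehler_le[OF I cs F(2,1)] by (intro mult_left_mono C) simp
    finally show "ent I (?A n (K F)) - phi (\<integral>z. K F z \<partial>gauss I) \<le> C * (ent I F - phi (\<integral>z. F z \<partial>gauss I))" .
  qed
qed

end

end

section \<open>Collisions\<close>

lemma rot_apply: "rot i j th z k = (if k = j then z i * sin th + z j * cos th else if k = i then z i * cos th - z j * sin th else z k)"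
  by (simp add: rot_def)

lemma rot_neg_cancel: "i \<noteq> j \<Longrightarrow> rot i j (- th) (rot i j th z) = z"
proof
  fix k assume "i \<noteq> j"
  have s: "a * (sin th)\<^sup>2 + a * (cos th)\<^sup>2 = a" for a :: real
    by (simp add: distrib_left[symmetric])
  then show "rot i j (- th) (rot i j th z) k = z k"
    using \<open>i \<noteq> j\<close> s[of "z i"] s[of "z j"] by (simp add: rot_apply algebra_simps power2_eq_square)
qed

lemma rot_ext: "i \<in> I \<Longrightarrow> j \<in> I \<Longrightarrow> z \<in> extensional I \<Longrightarrow> rot i j th z \<in> extensional I"
  by (auto simp: rot_def extensional_def)

text \<open>Linearity of the rotation, with the same c and s in all coordinates. This is the whole
  reason why collisions commute with Mehler steps.\<close>

lemma rot_mix: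
  assumes "i \<in> I" "j \<in> I"
  shows "rot i j th (mix I (\<lambda>_. c) (\<lambda>_. s) z y) = mix I (\<lambda>_. c) (\<lambda>_. s) (rot i j th z) (rot i j th y)"
  using assms by (auto simp: fun_eq_iff rot_apply mix_def algebra_simps)

lemma integrable_pair_bounded:
  fixes f :: "_ \<Rightarrow> real"
  assumes "prob_space A" "prob_space B" "f \<in> borel_measurable (A \<Otimes>\<^sub>M B)" "\<And>p. p \<in> space (A \<Otimes>\<^sub>M B) \<Longrightarrow> \<bar>f p\<bar> \<le> b"
  shows "integrable (A \<Otimes>\<^sub>M B) f"
proof -
  interpret prob_space "A \<Otimes>\<^sub>M B" using assms by (intro prob_space_pair)
  show ?thesis using assms by (intro integrable_const_bound[of _ b]) (auto intro: AE_I2)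
qed

lemma Fubini_bounded:
  fixes f :: "'a \<Rightarrow> 'b \<Rightarrow> real"
  assumes A: "prob_space A" and B: "prob_space B" and m: "case_prod f \<in> borel_measurable (A \<Otimes>\<^sub>M B)"
    and b: "\<And>x y. x \<in> space A \<Longrightarrow> y \<in> space B \<Longrightarrow> \<bar>f x y\<bar> \<le> b"
  shows "(\<integral>x. \<integral>y. f x y \<partial>B \<partial>A) = (\<integral>y. \<integral>x. f x y \<partial>A \<partial>B)"
    and "integrable A (\<lambda>x. \<integral>y. f x y \<partial>B)"
    and "integrable B (\<lambda>y. \<integral>x. f x y \<partial>A)"
proof -
  interpret A: prob_space A by fact
  interpret B: prob_space B by fact
  interpret P: pair_sigma_finite A B ..
  have i: "integrable (A \<Otimes>\<^sub>M B) (\<lambda>(x, y). f x y)"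
    by (rule integrable_pair_bounded[OF A B, of _ b]) (use m b in \<open>auto simp: space_pair_measure\<close>)
  show "(\<integral>x. \<integral>y. f x y \<partial>B \<partial>A) = (\<integral>y. \<integral>x. f x y \<partial>A \<partial>B)"
    using P.Fubini_integral[OF i] by simp
  show "integrable A (\<lambda>x. \<integral>y. f x y \<partial>B)" using P.integrable_fst[OF i] .
  show "integrable B (\<lambda>y. \<integral>x. f x y \<partial>A)" using P.integrable_snd[OF i] .
qed

text \<open>Integrate the tangent inequality \<open>x\<^sup>2 / y \<ge> 2 t x - t\<^sup>2 y\<close>.\<close>

lemma square_over_jensen:
  fixes x :: "'p \<Rightarrow> 'i \<Rightarrow> 'b \<Rightarrow> real" and y :: "'p \<Rightarrow> 'b \<Rightarrow> real"
  assumes fin: "finite P" "finite I" and W: "\<And>i. i \<in> I \<Longrightarrow> 0 \<le> W i" and w: "\<And>a. a \<in> P \<Longrightarrow> 0 \<le> w a"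
    and xi: "\<And>a i. a \<in> P \<Longrightarrow> i \<in> I \<Longrightarrow> integrable R (x a i)" and yi: "\<And>a. a \<in> P \<Longrightarrow> integrable R (y a)"
    and yp: "\<And>a t. a \<in> P \<Longrightarrow> t \<in> space R \<Longrightarrow> 0 < y a t"
    and gi: "\<And>a. a \<in> P \<Longrightarrow> integrable R (\<lambda>t. (\<Sum>i\<in>I. W i * (x a i t)\<^sup>2) / y a t)"
    and Y: "0 < (\<Sum>a\<in>P. w a * (\<integral>t. y a t \<partial>R))"
  shows "(\<Sum>i\<in>I. W i * (\<Sum>a\<in>P. w a * (\<integral>t. x a i t \<partial>R))\<^sup>2) / (\<Sum>a\<in>P. w a * (\<integral>t. y a t \<partial>R))
    \<le> (\<Sum>a\<in>P. w a * (\<integral>t. (\<Sum>i\<in>I. W i * (x a i t)\<^sup>2) / y a t \<partial>R))"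
proof -
  define Y where "Y = (\<Sum>a\<in>P. w a * (\<integral>t. y a t \<partial>R))"
  define X where "X i = (\<Sum>a\<in>P. w a * (\<integral>t. x a i t \<partial>R))" for i
  \<comment> \<open>The slope at which the tangent inequality is an equality for the averaged pair
    (X i, Y).\<close>
  define r where "r i = X i / Y" for i
  have Yp: "0 < Y" using Y by (simp add: Y_def)
  have tangent: "2 * t * u - t\<^sup>2 * v \<le> u\<^sup>2 / v" if "0 < v" for t u v :: real
  proof -
    have "0 \<le> (u - t * v)\<^sup>2 / v" using that by simp
    also have "\<dots> = u\<^sup>2 / v - (2 * t * u - t\<^sup>2 * v)" using that by (simp add: power2_eq_square field_simps)
    finally show ?thesis by simp
  qed
  have li: "integrable R (\<lambda>t. \<Sum>i\<in>I. W i * (2 * r i * x a i t - (r i)\<^sup>2 * y a t))" if "a \<in> P" for a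
    by (intro Bochner_Integration.integrable_sum integrable_mult_right Bochner_Integration.integrable_diff xi yi that)
  have "(\<Sum>i\<in>I. W i * (X i)\<^sup>2) / Y = (\<Sum>i\<in>I. W i * (2 * r i * X i - (r i)\<^sup>2 * Y))"
    unfolding sum_divide_distrib using Yp by (intro sum.cong) (auto simp: r_def power2_eq_square)
  also have "\<dots> = (\<Sum>i\<in>I. \<Sum>a\<in>P. w a * (W i * (2 * r i * (\<integral>t. x a i t \<partial>R) - (r i)\<^sup>2 * (\<integral>t. y a t \<partial>R))))"
    unfolding X_def Y_def by (intro sum.cong) (auto simp: sum_distrib_left sum_subtractf[symmetric] algebra_simps intro!: sum.cong)
  also have "\<dots> = (\<Sum>a\<in>P. w a * (\<Sum>i\<in>I. W i * (2 * r i * (\<integral>t. x a i t \<partial>R) - (r i)\<^sup>2 * (\<integral>t. y a t \<partial>R))))"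
    by (subst sum.swap) (simp add: sum_distrib_left)
  also have "\<dots> = (\<Sum>a\<in>P. w a * (\<integral>t. (\<Sum>i\<in>I. W i * (2 * r i * x a i t - (r i)\<^sup>2 * y a t)) \<partial>R))"
  proof (intro sum.cong refl arg_cong2[where f="(*)"])
    fix a assume a: "a \<in> P"
    show "(\<Sum>i\<in>I. W i * (2 * r i * (\<integral>t. x a i t \<partial>R) - (r i)\<^sup>2 * (\<integral>t. y a t \<partial>R)))
      = (\<integral>t. (\<Sum>i\<in>I. W i * (2 * r i * x a i t - (r i)\<^sup>2 * y a t)) \<partial>R)"
      using xi[OF a] yi[OF a] by (subst Bochner_Integration.integral_sum) (auto intro!: sum.cong)
  qed
  also have "\<dots> \<le> (\<Sum>a\<in>P. w a * (\<integral>t. (\<Sum>i\<in>I. W i * (x a i t)\<^sup>2) / y a t \<partial>R))"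
  proof (intro sum_mono mult_left_mono w integral_mono gi li)
    fix a t assume "a \<in> P" "t \<in> space R"
    then have v: "0 < y a t" by (rule yp)
    show "(\<Sum>i\<in>I. W i * (2 * r i * x a i t - (r i)\<^sup>2 * y a t)) \<le> (\<Sum>i\<in>I. W i * (x a i t)\<^sup>2) / y a t"
      unfolding sum_divide_distrib times_divide_eq_right[symmetric]
      by (intro sum_mono mult_left_mono W tangent v)
  qed
  finally show ?thesis by (simp add: X_def Y_def)
qed

text \<open>Rates and angle law are kept general. The rates are asked only to be nonnegative with
  sum in (0, 1], so the operator is sub-Markov.\<close>

definition Qop :: "(nat \<times> nat) set \<Rightarrow> (nat \<times> nat \<Rightarrow> real) \<Rightarrow> real measure \<Rightarrow> ((nat \<Rightarrow> real) \<Rightarrow> real) \<Rightarrow> (nat \<Rightarrow> real) \<Rightarrow> real" where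
  "Qop P w R F z = (\<Sum>a\<in>P. w a * (\<integral>th. F (rot (fst a) (snd a) th z) \<partial>R))"

section \<open>Averaging over one random rotation\<close>

context
  fixes I :: "nat set" and P :: "(nat \<times> nat) set" and w :: "nat \<times> nat \<Rightarrow> real" and R :: "real measure"
  assumes I: "finite I" and P: "finite P" "\<And>a. a \<in> P \<Longrightarrow> fst a \<in> I \<and> snd a \<in> I \<and> fst a \<noteq> snd a"
    and w: "\<And>a. a \<in> P \<Longrightarrow> 0 \<le> w a" and wsum: "sum w P \<le> 1" "0 < sum w P"
    and R: "prob_space R" "sets R = sets borel"
begin

interpretation R: prob_space R by (rule R)

lemma measurable_R_eq: "measurable (N \<Otimes>\<^sub>M R) L = measurable (N \<Otimes>\<^sub>M borel) L"
  by (rule measurable_cong_sets) (auto intro!: sets_pair_measure_cong simp: R)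

lemma measurable_rot_pair:
  assumes a: "a \<in> P" and F: "F \<in> borel_measurable (PiM I (\<lambda>_. borel :: real measure))"
  shows "(\<lambda>p. F (rot (fst a) (snd a) (snd p) (fst p))) \<in> borel_measurable (PiM I (\<lambda>_. borel) \<Otimes>\<^sub>M R)"
  unfolding measurable_R_eq
  by (rule measurable_compose[OF measurable_rot F]) (use P(2)[OF a] in auto)

lemma measurable_gauss_pair:
  "f \<in> borel_measurable (PiM I (\<lambda>_. borel) \<Otimes>\<^sub>M R) \<longleftrightarrow> f \<in> borel_measurable (gauss I \<Otimes>\<^sub>M R)"
  by (intro arg_cong2[where f="(\<in>)"] refl measurable_cong_sets sets_pair_measure_cong) (simp_all add: sets_gauss)

lemma integrable_rot:
  assumes a: "a \<in> P" and F: "bmeas I F" and z: "z \<in> extensional I"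
  shows "integrable R (\<lambda>th. F (rot (fst a) (snd a) th z))"
proof -
  from F obtain B where B: "\<forall>z\<in>extensional I. \<bar>F z\<bar> \<le> B" and m: "F \<in> borel_measurable (PiM I (\<lambda>_. borel))"
    by (auto simp: bmeas_def)
  have "(\<lambda>th. F (rot (fst a) (snd a) th z)) \<in> borel_measurable borel"
  proof (rule measurable_compose[OF measurable_rot m])
    show "(\<lambda>_. z) \<in> measurable borel (PiM I (\<lambda>_. borel))" using z by (intro measurable_const) simp
  qed (use P(2)[OF a] in auto)
  then have "(\<lambda>th. F (rot (fst a) (snd a) th z)) \<in> borel_measurable R"
    by (simp add: measurable_cong_sets[OF R(2) refl])
  then show ?thesis
    by (rule R.integrable_const_bound[rotated, of _ B]) (use B rot_ext[OF _ _ z] P(2)[OF a] in \<open>auto intro!: AE_I2\<close>)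
qed

lemma integral_rot_gauss:
  assumes a: "a \<in> P" and F: "f \<in> borel_measurable (gauss I)"
  shows "(\<integral>y. f (rot (fst a) (snd a) th y) \<partial>gauss I) = (\<integral>y. f y \<partial>gauss I :: real)"
proof -
  have m: "rot (fst a) (snd a) th \<in> measurable (gauss I) (gauss I)"
  proof -
    have "rot (fst a) (snd a) th \<in> measurable (PiM I (\<lambda>_. borel)) (PiM I (\<lambda>_. borel))"
      by (rule measurable_rot[where f="\<lambda>x. x"]) (use P(2)[OF a] in auto)
    then show ?thesis by (simp add: measurable_cong_sets[OF sets_gauss sets_gauss])
  qed
  have "(\<integral>y. f y \<partial>gauss I) = (\<integral>y. f y \<partial>distr (gauss I) (gauss I) (rot (fst a) (snd a) th))"
    using distr_rot[OF I, of "fst a" "snd a" th] P(2)[OF a] by simp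
  also have "\<dots> = (\<integral>y. f (rot (fst a) (snd a) th y) \<partial>gauss I)" by (rule integral_distr[OF m F])
  finally show ?thesis ..
qed

text \<open>Lost mass lowers the lower bound by the factor \<open>sum w P\<close>, which stays
  positive; the upper bound survives because B >= 0.\<close>

lemma between_Q:
  assumes e: "0 \<le> e" and F: "between I e B F"
  shows "between I (sum w P * e) B (Qop P w R F)"
  unfolding between_def
proof (intro conjI ballI)
  have m: "F \<in> borel_measurable (PiM I (\<lambda>_. borel))" by (rule between_measurable[OF F])
  have "(\<lambda>z. \<integral>th. F (rot (fst a) (snd a) th z) \<partial>R) \<in> borel_measurable (PiM I (\<lambda>_. borel))" if "a \<in> P" for a
    by (rule R.borel_measurable_lebesgue_integral) (use measurable_rot_pair[OF that m] in \<open>simp add: case_prod_beta'\<close>)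
  then show "Qop P w R F \<in> borel_measurable (PiM I (\<lambda>_. borel))"
    unfolding Qop_def[abs_def] by measurable
  fix z :: "nat \<Rightarrow> real" assume z: "z \<in> extensional I"
  have lu: "e \<le> (\<integral>th. F (rot (fst a) (snd a) th z) \<partial>R) \<and> (\<integral>th. F (rot (fst a) (snd a) th z) \<partial>R) \<le> B" if a: "a \<in> P" for a
  proof -
    note i = integrable_rot[OF a between_bmeas[OF I F] z]
    have "e \<le> F (rot (fst a) (snd a) th z) \<and> F (rot (fst a) (snd a) th z) \<le> B" for th
      using between_range[OF F rot_ext[OF _ _ z]] P(2)[OF a] by auto
    then have "(\<integral>th. e \<partial>R) \<le> (\<integral>th. F (rot (fst a) (snd a) th z) \<partial>R)" "(\<integral>th. F (rot (fst a) (snd a) th z) \<partial>R) \<le> (\<integral>th. B \<partial>R)"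
      using i by (intro integral_mono; simp)+
    then show ?thesis by (simp add: R.prob_space)
  qed
  have B: "0 \<le> B" using between_range[OF F z] e by linarith
  have "sum w P * e \<le> Qop P w R F z" unfolding Qop_def sum_distrib_right
    by (intro sum_mono mult_left_mono w) (use lu in auto)
  moreover have "Qop P w R F z \<le> sum w P * B" unfolding Qop_def sum_distrib_right
    by (intro sum_mono mult_left_mono w) (use lu in auto)
  moreover have "sum w P * B \<le> B" using wsum B by (intro mult_left_le_one_le) auto
  ultimately show "sum w P * e \<le> Qop P w R F z" "Qop P w R F z \<le> B" by auto
qed

lemma bmeas_Q: assumes F: "bmeas I F" shows "bmeas I (Qop P w R F)"
proof -
  from F obtain B where B: "\<forall>z\<in>extensional I. \<bar>F z\<bar> \<le> B" and m: "F \<in> borel_measurable (PiM I (\<lambda>_. borel))"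
    by (auto simp: bmeas_def)
  \<comment> \<open>Shifting F by B makes it nonnegative so that \<open>between_Q\<close> applies;
    the constant is then subtracted with the mass of the rates.\<close>
  have "between I 0 (2 * B) (\<lambda>z. F z + B)" using B m by (auto simp: between_def abs_le_iff)
  from between_Q[OF _ this] have 1: "bmeas I (Qop P w R (\<lambda>z. F z + B))" by (intro between_bmeas[OF I]) simp
  have 2: "bmeas I (\<lambda>z. Qop P w R (\<lambda>z. F z + B) z - sum w P * B)" by (rule bmeas_diff[OF I 1 bmeas_const[OF I]])
  have eq: "Qop P w R (\<lambda>z. F z + B) z - sum w P * B = Qop P w R F z" if "z \<in> extensional I" for z
    unfolding Qop_def sum_distrib_right sum_subtractf[symmetric]
    using integrable_rot[OF _ F that] by (intro sum.cong) (auto simp: R.prob_space algebra_simps)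
  show ?thesis using 2 measurable_cong[of "PiM I (\<lambda>_. borel)" "\<lambda>z. Qop P w R (\<lambda>z. F z + B) z - sum w P * B" "Qop P w R F" borel] eq
    unfolding bmeas_def by auto
qed

text \<open>The rotation passes through the mixture onto z and y, and invariance of the noise y
  absorbs its half.\<close>

lemma integral_mix_rot:
  assumes a: "a \<in> P" and F: "bmeas I F" and f: "integrable (gauss I) f"
  shows "(\<integral>y. F (rot (fst a) (snd a) th (mix I (\<lambda>_. c) (\<lambda>_. s) z y)) * f (rot (fst a) (snd a) th y) \<partial>gauss I)
    = (\<integral>y. F (mix I (\<lambda>_. c) (\<lambda>_. s) (rot (fst a) (snd a) th z) y) * f y \<partial>gauss I)"
proof -
  have "(\<lambda>y. F (mix I (\<lambda>_. c) (\<lambda>_. s) (rot (fst a) (snd a) th z) y) * f y) \<in> borel_measurable (gauss I)"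
    using bmeas_mult_integrable[OF I bmeas_mix[OF I F] f] by simp
  from integral_rot_gauss[OF a this] show ?thesis using P(2)[OF a] by (simp add: rot_mix)
qed

text \<open>The factor f will be an unbounded coordinate, so Fubini is justified by the dominating
  function B |f|.\<close>

lemma Q_swap:
  assumes F: "bmeas I F" and f: "integrable (gauss I) f"
  shows "(\<integral>y. Qop P w R F (mix I (\<lambda>_. c) (\<lambda>_. s) z y) * f y \<partial>gauss I)
    = (\<Sum>a\<in>P. w a * (\<integral>th. \<integral>y. F (rot (fst a) (snd a) th (mix I (\<lambda>_. c) (\<lambda>_. s) z y)) * f y \<partial>gauss I \<partial>R))"
    and "\<And>a. a \<in> P \<Longrightarrow> integrable R (\<lambda>th. \<integral>y. F (rot (fst a) (snd a) th (mix I (\<lambda>_. c) (\<lambda>_. s) z y)) * f y \<partial>gauss I)"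
proof -
  interpret pair_sigma_finite "gauss I" R ..
  let ?m = "mix I (\<lambda>_. c) (\<lambda>_. s) z"
  from F obtain B where B: "\<forall>z\<in>extensional I. \<bar>F z\<bar> \<le> B" and m: "F \<in> borel_measurable (PiM I (\<lambda>_. borel))"
    by (auto simp: bmeas_def)
  have fm: "f \<in> borel_measurable (gauss I)" using f by simp
  have i: "integrable (gauss I \<Otimes>\<^sub>M R) (\<lambda>(y, th). F (rot (fst a) (snd a) th (?m y)) * f y)" if a: "a \<in> P" for a
  proof (rule Bochner_Integration.integrable_bound)
    have fp: "integrable (gauss I \<Otimes>\<^sub>M R) (\<lambda>p. f (fst p))"
      by (rule integrable_distr[where M'="gauss I" and T=fst]) (simp_all add: R.distr_pair_fst f)
    then show "integrable (gauss I \<Otimes>\<^sub>M R) (\<lambda>p. B * f (fst p))" by simp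
    have mm: "?m \<in> measurable (PiM I (\<lambda>_. borel)) (PiM I (\<lambda>_. borel))"
    proof -
      have "(\<lambda>y. mix I (\<lambda>_. c) (\<lambda>_. s) (restrict z I) y) \<in> measurable (PiM I (\<lambda>_. borel)) (PiM I (\<lambda>_. borel))"
        by (rule measurable_mix) (auto intro!: measurable_const)
      then show ?thesis by simp
    qed
    have "(\<lambda>p. (?m (fst p), snd p)) \<in> measurable (gauss I \<Otimes>\<^sub>M R) (PiM I (\<lambda>_. borel) \<Otimes>\<^sub>M R)"
      by (intro measurable_Pair measurable_compose[OF measurable_fst] measurable_snd)
         (use mm in \<open>simp add: measurable_cong_sets[OF sets_gauss refl]\<close>)
    from measurable_compose[OF this measurable_rot_pair[OF a m]]
    show "(\<lambda>(y, th). F (rot (fst a) (snd a) th (?m y)) * f y) \<in> borel_measurable (gauss I \<Otimes>\<^sub>M R)"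
      using fp by (simp add: case_prod_beta')
    show "AE p in gauss I \<Otimes>\<^sub>M R. norm (case p of (y, th) \<Rightarrow> F (rot (fst a) (snd a) th (?m y)) * f y) \<le> norm (B * f (fst p))"
    proof (rule AE_I2, clarsimp simp: abs_mult)
      fix y th
      have "\<bar>F (rot (fst a) (snd a) th (?m y))\<bar> \<le> B" using B rot_ext[of "fst a" I "snd a" "?m y" th] P(2)[OF a] by simp
      then show "\<bar>F (rot (fst a) (snd a) th (?m y))\<bar> * \<bar>f y\<bar> \<le> \<bar>B\<bar> * \<bar>f y\<bar>" by (intro mult_right_mono) auto
    qed
  qed
  show "integrable R (\<lambda>th. \<integral>y. F (rot (fst a) (snd a) th (?m y)) * f y \<partial>gauss I)" if "a \<in> P" for a
    using integrable_snd[OF i[OF that]] by simp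
  have "(\<integral>y. Qop P w R F (?m y) * f y \<partial>gauss I) = (\<integral>y. (\<Sum>a\<in>P. w a * (\<integral>th. F (rot (fst a) (snd a) th (?m y)) * f y \<partial>R)) \<partial>gauss I)"
    unfolding Qop_def sum_distrib_right by (simp add: mult.assoc)
  also have "\<dots> = (\<Sum>a\<in>P. w a * (\<integral>y. (\<integral>th. F (rot (fst a) (snd a) th (?m y)) * f y \<partial>R) \<partial>gauss I))"
    using integrable_fst[OF i] by (subst Bochner_Integration.integral_sum) auto
  also have "\<dots> = (\<Sum>a\<in>P. w a * (\<integral>th. \<integral>y. F (rot (fst a) (snd a) th (?m y)) * f y \<partial>gauss I \<partial>R))"
    using Fubini_integral[OF i] by (intro sum.cong refl arg_cong2[where f="(*)"]) auto
  finally show "(\<integral>y. Qop P w R F (?m y) * f y \<partial>gauss I) = (\<Sum>a\<in>P. w a * (\<integral>th. \<integral>y. F (rot (fst a) (snd a) th (?m y)) * f y \<partial>gauss I \<partial>R))" .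
qed

lemma Q_mehler:
  assumes F: "bmeas I F"
  shows "Qop P w R (mehler I (\<lambda>_. c) (\<lambda>_. s) F) = mehler I (\<lambda>_. c) (\<lambda>_. s) (Qop P w R F)"
proof
  fix z
  have "mehler I (\<lambda>_. c) (\<lambda>_. s) (Qop P w R F) z
    = (\<Sum>a\<in>P. w a * (\<integral>th. \<integral>y. F (rot (fst a) (snd a) th (mix I (\<lambda>_. c) (\<lambda>_. s) z y)) * 1 \<partial>gauss I \<partial>R))"
    using Q_swap(1)[OF F, of "\<lambda>_. 1" c s z] by (simp add: mehler_def)
  also have "\<dots> = Qop P w R (mehler I (\<lambda>_. c) (\<lambda>_. s) F) z"
    unfolding Qop_def mehler_def
    using integral_mix_rot[OF _ F, where f="\<lambda>_. 1" and c=c and s=s and z=z]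
    by (intro sum.cong refl) simp
  finally show "Qop P w R (mehler I (\<lambda>_. c) (\<lambda>_. s) F) z = mehler I (\<lambda>_. c) (\<lambda>_. s) (Qop P w R F) z" ..
qed

text \<open>Write y_k as the k-th entry of the inverse rotation applied to the rotated noise, then
  change variables. The result is the chain rule: the gradient of F composed with a rotation is the
  inverse rotation applied to the gradient at the rotated point.\<close>

lemma hermite_Q:
  assumes F: "bmeas I F" and k: "k \<in> I"
  shows "hermite I (\<lambda>_. c) (\<lambda>_. s) k (Qop P w R F) z
    = (\<Sum>a\<in>P. w a * (\<integral>th. rot (fst a) (snd a) (- th) (\<lambda>i. hermite I (\<lambda>_. c) (\<lambda>_. s) i F (rot (fst a) (snd a) th z)) k \<partial>R))"
    and "\<And>a. a \<in> P \<Longrightarrow> integrable R (\<lambda>th. rot (fst a) (snd a) (- th) (\<lambda>i. hermite I (\<lambda>_. c) (\<lambda>_. s) i F (rot (fst a) (snd a) th z)) k)"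
proof -
  let ?m = "mix I (\<lambda>_. c) (\<lambda>_. s)"
  have eq: "(\<integral>y. F (rot (fst a) (snd a) th (?m z y)) * y k \<partial>gauss I)
     = rot (fst a) (snd a) (- th) (\<lambda>i. hermite I (\<lambda>_. c) (\<lambda>_. s) i F (rot (fst a) (snd a) th z)) k" if a: "a \<in> P" for a th
  proof -
    define z' where "z' = rot (fst a) (snd a) th z"
    have ii: "integrable (gauss I) (\<lambda>y. F (?m z' y) * y i)" if "i \<in> I" for i
      by (rule bmeas_mult_integrable[OF I bmeas_mix[OF I F] integrable_coord[OF I that]])
    note ij = P(2)[OF a]
    have fi: "integrable (gauss I) (\<lambda>y. rot (fst a) (snd a) (- th) y k)"
      using integrable_coord[OF I] ij k by (cases "k = snd a"; cases "k = fst a") (simp_all add: rot_apply)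
    have "(\<integral>y. F (rot (fst a) (snd a) th (?m z y)) * y k \<partial>gauss I)
      = (\<integral>y. F (rot (fst a) (snd a) th (?m z y)) * rot (fst a) (snd a) (- th) (rot (fst a) (snd a) th y) k \<partial>gauss I)"
      using ij by (simp add: rot_neg_cancel)
    also have "\<dots> = (\<integral>y. F (?m z' y) * rot (fst a) (snd a) (- th) y k \<partial>gauss I)"
      unfolding z'_def by (rule integral_mix_rot[OF a F fi])
    also have "\<dots> = rot (fst a) (snd a) (- th) (\<lambda>i. hermite I (\<lambda>_. c) (\<lambda>_. s) i F z') k"
    proof -
      have i: "integrable (gauss I) (\<lambda>y. F (?m z' y) * y i * u)" if "i \<in> I" for i u
        using ii[OF that] by simp
      have e: "(\<integral>y. F (?m z' y) * (y (fst a) * u + y (snd a) * v) \<partial>gauss I)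
          = (\<integral>y. F (?m z' y) * y (fst a) \<partial>gauss I) * u + (\<integral>y. F (?m z' y) * y (snd a) \<partial>gauss I) * v" for u v
        unfolding distrib_left mult.assoc[symmetric]
        using ij by (subst Bochner_Integration.integral_add[OF i i]) auto
      have e': "(\<integral>y. F (?m z' y) * (y (fst a) * u - y (snd a) * v) \<partial>gauss I)
          = (\<integral>y. F (?m z' y) * y (fst a) \<partial>gauss I) * u - (\<integral>y. F (?m z' y) * y (snd a) \<partial>gauss I) * v" for u v
        using e[of u "- v"] by simp
      have e2: "(\<integral>y. F (?m z' y) * (y (snd a) * v - y (fst a) * u) \<partial>gauss I)
          = (\<integral>y. F (?m z' y) * y (snd a) \<partial>gauss I) * v - (\<integral>y. F (?m z' y) * y (fst a) \<partial>gauss I) * u" for u v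
        using e[of "- u" v] by simp
      show ?thesis unfolding rot_apply hermite_def using ij
        by (cases "k = snd a"; cases "k = fst a") (simp_all add: e e' e2)
    qed
    finally show ?thesis unfolding z'_def .
  qed
  note q = Q_swap[where c=c and s=s and z=z, OF F integrable_coord[OF I k]]
  show "hermite I (\<lambda>_. c) (\<lambda>_. s) k (Qop P w R F) z
    = (\<Sum>a\<in>P. w a * (\<integral>th. rot (fst a) (snd a) (- th) (\<lambda>i. hermite I (\<lambda>_. c) (\<lambda>_. s) i F (rot (fst a) (snd a) th z)) k \<partial>R))"
    unfolding hermite_def[of I _ _ k] q(1) by (intro sum.cong refl arg_cong2[where f="(*)"] Bochner_Integration.integral_cong) (simp_all add: eq)
  fix a assume "a \<in> P"
  with q(2)[OF this] eq[OF this] show "integrable R (\<lambda>th. rot (fst a) (snd a) (- th) (\<lambda>i. hermite I (\<lambda>_. c) (\<lambda>_. s) i F (rot (fst a) (snd a) th z)) k)"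
    by simp
qed

text \<open>Joint convexity of x^2 / y moves the average over pairs and angles outside the quotient.
  Rotation invariance removes the rotation of the point, and what is left is a quadratic form in the
  gradient of F alone, which the assumption \<open>quad\<close> bounds.\<close>

lemma fisher_Q:
  assumes F: "0 < e" "between I e B F" and W: "\<And>i. i \<in> I \<Longrightarrow> 0 \<le> W i"
    and quad: "\<And>x. (\<Sum>a\<in>P. w a * (\<integral>th. (\<Sum>i\<in>I. W i * (rot (fst a) (snd a) (- th) x i)\<^sup>2) \<partial>R)) \<le> (\<Sum>i\<in>I. W' i * (x i)\<^sup>2)"
  shows "fisher I (\<lambda>_. c) (\<lambda>_. s) W (Qop P w R F) \<le> fisher I (\<lambda>_. c) (\<lambda>_. s) W' F"
proof -
  let ?c = "\<lambda>_::nat. c" and ?s = "\<lambda>_::nat. s"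
  note Fm = between_bmeas[OF I F(2)]
  let ?A = "mehler I ?c ?s F" and ?h = "\<lambda>z i. hermite I ?c ?s i F z"
  define g where "g a th z = (\<Sum>i\<in>I. W i * (rot (fst a) (snd a) (- th) (?h z) i)\<^sup>2) / ?A z" for a th z
  obtain Hb where Hb: "\<And>i z. i \<in> I \<Longrightarrow> z \<in> extensional I \<Longrightarrow> \<bar>?h z i\<bar> \<le> Hb"
  proof -
    have "\<forall>i\<in>I. \<exists>b. \<forall>z\<in>extensional I. \<bar>?h z i\<bar> \<le> b" using bmeas_hermite[OF I Fm] by (auto simp: bmeas_def)
    from bchoice[OF this] obtain b where b: "\<forall>i\<in>I. \<forall>z\<in>extensional I. \<bar>?h z i\<bar> \<le> b i" by auto
    have "b i \<le> (\<Sum>i\<in>I. \<bar>b i\<bar>)" if "i \<in> I" for i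
      using member_le_sum[OF that, of "\<lambda>i. \<bar>b i\<bar>"] I by force
    with b show ?thesis by (intro that[of "\<Sum>i\<in>I. \<bar>b i\<bar>"]) force
  qed
  have rb: "\<bar>rot (fst a) (snd a) th (?h z) i\<bar> \<le> 2 * Hb" if "a \<in> P" "i \<in> I" "z \<in> extensional I" for a th z i
  proof -
    have t: "\<bar>u * cos th\<bar> \<le> \<bar>u\<bar>" "\<bar>u * sin th\<bar> \<le> \<bar>u\<bar>" for u
      unfolding abs_mult by (auto intro: mult_right_le_one_le)
    note P(2)[OF that(1)]
    then show ?thesis
      using Hb[OF that(2,3)] Hb[of "fst a" z] Hb[of "snd a" z] that(3)
        t(1)[of "?h z (fst a)"] t(2)[of "?h z (fst a)"] t(1)[of "?h z (snd a)"] t(2)[of "?h z (snd a)"]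
      unfolding rot_apply by (auto simp: abs_le_iff split: if_splits)
  qed
  define G where "G = (\<Sum>i\<in>I. W i * (2 * Hb)\<^sup>2) / e"
  have g0: "0 \<le> g a th z" if "z \<in> extensional I" for a th z
    unfolding g_def using mehler_mono_const[OF I F(2), of ?c ?s z] F(1) W
    by (intro divide_nonneg_nonneg sum_nonneg mult_nonneg_nonneg) auto
  have gG: "g a th z \<le> G" if "a \<in> P" "z \<in> extensional I" for a th z
    unfolding g_def G_def
  proof (intro frac_le sum_nonneg sum_mono mult_left_mono mult_nonneg_nonneg W)
    fix i assume "i \<in> I"
    show "(rot (fst a) (snd a) (- th) (?h z) i)\<^sup>2 \<le> (2 * Hb)\<^sup>2"
    proof -
      have "\<bar>rot (fst a) (snd a) (- th) (?h z) i\<bar> \<le> 2 * Hb" by (rule rb[OF that(1) \<open>i \<in> I\<close> that(2)])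
      from power_mono[OF this abs_ge_zero, of 2] show ?thesis by (simp only: power2_abs)
    qed
  qed (use F mehler_mono_const[OF I F(2), of ?c ?s z] in auto)
  have gb: "\<bar>g a th z\<bar> \<le> G" if "a \<in> P" "z \<in> extensional I" for a th z
    using g0[OF that(2), of a th] gG[OF that, of th] by simp
  have hm: "(\<lambda>z. ?h z i) \<in> borel_measurable (PiM I (\<lambda>_. borel))" if "i \<in> I" for i
    using bmeas_hermite[OF I Fm that] by (simp add: bmeas_def)
  have Am: "?A \<in> borel_measurable (PiM I (\<lambda>_. borel))" using bmeas_mehler[OF I Fm] by (simp add: bmeas_def)
  have gm: "(\<lambda>p. g a (snd p) (fst p)) \<in> borel_measurable (PiM I (\<lambda>_. borel) \<Otimes>\<^sub>M R)" if a: "a \<in> P" for a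
  proof -
    note [measurable] = Am hm P(2)[OF a, THEN conjunct1, THEN hm] P(2)[OF a, THEN conjunct2, THEN conjunct1, THEN hm]
    show ?thesis unfolding measurable_R_eq g_def rot_apply
      by measurable
  qed
  have grm: "(\<lambda>p. g a (snd p) (rot (fst a) (snd a) (snd p) (fst p))) \<in> borel_measurable (PiM I (\<lambda>_. borel) \<Otimes>\<^sub>M R)" if a: "a \<in> P" for a
  proof -
    have "(\<lambda>p. (rot (fst a) (snd a) (snd p) (fst p), snd p)) \<in> measurable (PiM I (\<lambda>_. borel) \<Otimes>\<^sub>M R) (PiM I (\<lambda>_. borel) \<Otimes>\<^sub>M R)"
    proof (rule measurable_Pair)
      show "(\<lambda>p. rot (fst a) (snd a) (snd p) (fst p)) \<in> measurable (PiM I (\<lambda>_. borel) \<Otimes>\<^sub>M R) (PiM I (\<lambda>_. borel))"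
        unfolding measurable_R_eq by (rule measurable_rot) (use P(2)[OF a] in auto)
    qed measurable
    from measurable_compose[OF this gm[OF a]] show ?thesis by simp
  qed
  have re: "rot (fst a) (snd a) th z \<in> extensional I" if "a \<in> P" "z \<in> extensional I" for a th z
    using P(2)[OF that(1)] that(2) by (intro rot_ext) auto
  have fub1: "(\<integral>z. \<integral>th. g a th (rot (fst a) (snd a) th z) \<partial>R \<partial>gauss I) = (\<integral>th. \<integral>z. g a th (rot (fst a) (snd a) th z) \<partial>gauss I \<partial>R)"
    and int1: "integrable (gauss I) (\<lambda>z. \<integral>th. g a th (rot (fst a) (snd a) th z) \<partial>R)" if a: "a \<in> P" for a
    using grm[OF a] gb[OF a re[OF a]]
    by (intro Fubini_bounded[OF prob_space_gauss R(1), of "\<lambda>z th. g a th (rot (fst a) (snd a) th z)" I G]; simp add: case_prod_beta' measurable_gauss_pair space_gauss)+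
  have fub2: "(\<integral>z. \<integral>th. g a th z \<partial>R \<partial>gauss I) = (\<integral>th. \<integral>z. g a th z \<partial>gauss I \<partial>R)"
    and int2: "integrable (gauss I) (\<lambda>z. \<integral>th. g a th z \<partial>R)" if a: "a \<in> P" for a
    using gm[OF a] gb[OF a]
    by (intro Fubini_bounded[OF prob_space_gauss R(1), of "\<lambda>z th. g a th z" I G]; simp add: case_prod_beta' measurable_gauss_pair space_gauss)+
  have QF: "between I (sum w P * e) B (Qop P w R F)" by (rule between_Q) (use F in auto)
  have Qe: "0 < sum w P * e" using wsum F by simp
  have "fisher I ?c ?s W (Qop P w R F) \<le> (\<integral>z. (\<Sum>a\<in>P. w a * (\<integral>th. g a th (rot (fst a) (snd a) th z) \<partial>R)) \<partial>gauss I)"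
    unfolding fisher_def
  proof (rule integral_mono)
    show "integrable (gauss I) (\<lambda>z. (\<Sum>i\<in>I. W i * (hermite I ?c ?s i (Qop P w R F) z)\<^sup>2) / mehler I ?c ?s (Qop P w R F) z)"
      by (rule bmeas_integrable[OF I fisher_integrable[OF I QF Qe]])
    show "integrable (gauss I) (\<lambda>z. \<Sum>a\<in>P. w a * (\<integral>th. g a th (rot (fst a) (snd a) th z) \<partial>R))"
      by (intro Bochner_Integration.integrable_sum integrable_mult_right int1)
    fix z assume "z \<in> space (gauss I)"
    then have z: "z \<in> extensional I" by (simp add: space_gauss)
    have Y: "mehler I ?c ?s (Qop P w R F) z = (\<Sum>a\<in>P. w a * (\<integral>th. ?A (rot (fst a) (snd a) th z) \<partial>R))"
      unfolding Q_mehler[OF Fm, symmetric] Qop_def ..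
    have X: "hermite I ?c ?s i (Qop P w R F) z = (\<Sum>a\<in>P. w a * (\<integral>th. rot (fst a) (snd a) (- th) (?h (rot (fst a) (snd a) th z)) i \<partial>R))" if "i \<in> I" for i
      by (rule hermite_Q(1)[OF Fm that])
    have "(\<Sum>i\<in>I. W i * (hermite I ?c ?s i (Qop P w R F) z)\<^sup>2) / mehler I ?c ?s (Qop P w R F) z
      = (\<Sum>i\<in>I. W i * (\<Sum>a\<in>P. w a * (\<integral>th. rot (fst a) (snd a) (- th) (?h (rot (fst a) (snd a) th z)) i \<partial>R))\<^sup>2)
         / (\<Sum>a\<in>P. w a * (\<integral>th. ?A (rot (fst a) (snd a) th z) \<partial>R))"
      unfolding Y using X by (intro arg_cong2[where f="(/)"] sum.cong) auto
    also have "\<dots> \<le> (\<Sum>a\<in>P. w a * (\<integral>th. (\<Sum>i\<in>I. W i * (rot (fst a) (snd a) (- th) (?h (rot (fst a) (snd a) th z)) i)\<^sup>2) / ?A (rot (fst a) (snd a) th z) \<partial>R))"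
    proof (rule square_over_jensen[OF P(1) I W w])
      fix a i assume "a \<in> P" "i \<in> I"
      then show "integrable R (\<lambda>th. rot (fst a) (snd a) (- th) (?h (rot (fst a) (snd a) th z)) i)" by (intro hermite_Q(2)[OF Fm])
    next
      fix a assume a: "a \<in> P"
      show "integrable R (\<lambda>th. ?A (rot (fst a) (snd a) th z))" by (rule integrable_rot[OF a bmeas_mehler[OF I Fm] z])
      show "0 < ?A (rot (fst a) (snd a) th z)" for th using mehler_mono_const[OF I F(2), of ?c ?s "rot (fst a) (snd a) th z"] F(1) by linarith
      have "integrable R (\<lambda>th. g a th (rot (fst a) (snd a) th z))"
      proof (rule R.integrable_const_bound[of _ G])
        have "z \<in> space (PiM I (\<lambda>_. borel :: real measure))" using z by simp
        from measurable_compose[OF measurable_Pair1'[OF this] grm[OF a]]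
        show "(\<lambda>th. g a th (rot (fst a) (snd a) th z)) \<in> borel_measurable R" by simp
      qed (use gb[OF a re[OF a z]] in \<open>auto intro!: AE_I2\<close>)
      then show "integrable R (\<lambda>th. (\<Sum>i\<in>I. W i * (rot (fst a) (snd a) (- th) (?h (rot (fst a) (snd a) th z)) i)\<^sup>2) / ?A (rot (fst a) (snd a) th z))"
        by (simp add: g_def)
    next
      show "0 < (\<Sum>a\<in>P. w a * (\<integral>th. ?A (rot (fst a) (snd a) th z) \<partial>R))"
        unfolding Y[symmetric] using mehler_mono_const[OF I QF, of ?c ?s z] Qe by linarith
    qed
    finally show "(\<Sum>i\<in>I. W i * (hermite I ?c ?s i (Qop P w R F) z)\<^sup>2) / mehler I ?c ?s (Qop P w R F) z
      \<le> (\<Sum>a\<in>P. w a * (\<integral>th. g a th (rot (fst a) (snd a) th z) \<partial>R))" by (simp add: g_def)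
  qed
  also have "\<dots> = (\<Sum>a\<in>P. w a * (\<integral>z. \<integral>th. g a th (rot (fst a) (snd a) th z) \<partial>R \<partial>gauss I))"
    using int1 by (subst Bochner_Integration.integral_sum) auto
  also have "\<dots> = (\<Sum>a\<in>P. w a * (\<integral>z. \<integral>th. g a th z \<partial>R \<partial>gauss I))"
  proof (intro sum.cong refl arg_cong2[where f="(*)"])
    fix a assume a: "a \<in> P"
    \<comment> \<open>At a fixed angle the point is rotated back under the integral; the inverse
      rotation acting on the gradient vector remains.\<close>
    have "(\<integral>z. g a th (rot (fst a) (snd a) th z) \<partial>gauss I) = (\<integral>z. g a th z \<partial>gauss I)" if "th \<in> space R" for th
    proof (rule integral_rot_gauss[OF a])
      from measurable_compose[OF measurable_Pair2'[OF that] gm[OF a]]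
      show "g a th \<in> borel_measurable (gauss I)" by (simp add: measurable_cong_sets[OF sets_gauss refl])
    qed
    then show "(\<integral>z. \<integral>th. g a th (rot (fst a) (snd a) th z) \<partial>R \<partial>gauss I) = (\<integral>z. \<integral>th. g a th z \<partial>R \<partial>gauss I)"
      unfolding fub1[OF a] fub2[OF a] by (rule Bochner_Integration.integral_cong[OF refl])
  qed
  also have "\<dots> = (\<integral>z. (\<Sum>a\<in>P. w a * (\<integral>th. g a th z \<partial>R)) \<partial>gauss I)"
    using int2 by (subst Bochner_Integration.integral_sum) auto
  also have "\<dots> \<le> fisher I ?c ?s W' F"
    unfolding fisher_def
  proof (rule integral_mono)
    show "integrable (gauss I) (\<lambda>z. \<Sum>a\<in>P. w a * (\<integral>th. g a th z \<partial>R))"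
      by (intro Bochner_Integration.integrable_sum integrable_mult_right int2)
    show "integrable (gauss I) (\<lambda>z. (\<Sum>i\<in>I. W' i * (?h z i)\<^sup>2) / ?A z)"
      by (rule bmeas_integrable[OF I fisher_integrable[OF I F(2,1)]])
    fix z
    have "(\<Sum>a\<in>P. w a * (\<integral>th. g a th z \<partial>R)) = (\<Sum>a\<in>P. w a * (\<integral>th. (\<Sum>i\<in>I. W i * (rot (fst a) (snd a) (- th) (?h z) i)\<^sup>2) \<partial>R)) / ?A z"
      unfolding g_def by (simp only: integral_divide_zero times_divide_eq_right sum_divide_distrib[symmetric])
    also have "\<dots> \<le> (\<Sum>i\<in>I. W' i * (?h z i)\<^sup>2) / ?A z"
      using mehler_mono_const[OF I F(2), of ?c ?s z] F(1) by (intro divide_right_mono quad) linarith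
    finally show "(\<Sum>a\<in>P. w a * (\<integral>th. g a th z \<partial>R)) \<le> (\<Sum>i\<in>I. W' i * (?h z i)\<^sup>2) / ?A z" .
  qed
  finally show ?thesis .
qed

end

section \<open>Averaging over the reservoir, and the weights\<close>

text \<open>Serves both as mixing coefficients that separate v from w and as the diagonal of the
  form a |v|^2 + b |w|^2.\<close>

definition split_wt :: "nat \<Rightarrow> real \<Rightarrow> real \<Rightarrow> nat \<Rightarrow> real" where
  "split_wt M a b i = (if i < M then a else b)"

text \<open>Integrating out w is the Mehler-type operator that keeps v and fully resamples w. It
  thereby inherits measurability, bounds and invariance from \<open>mehler\<close>.\<close>

definition reservoir_avg :: "nat \<Rightarrow> nat set \<Rightarrow> ((nat \<Rightarrow> real) \<Rightarrow> real) \<Rightarrow> (nat \<Rightarrow> real) \<Rightarrow> real" where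
  "reservoir_avg M I F = mehler I (split_wt M 1 0) (split_wt M 0 1) F"

definition cylindrical :: "nat \<Rightarrow> ((nat \<Rightarrow> real) \<Rightarrow> real) \<Rightarrow> bool" where
  "cylindrical M F \<longleftrightarrow> (\<forall>x y. (\<forall>i<M. x i = y i) \<longrightarrow> F x = F y)"

lemma cylindrical_mehler:
  assumes F: "cylindrical M F" and M: "{..<M} \<subseteq> I"
  shows "cylindrical M (mehler I c s F)"
  unfolding cylindrical_def
proof (intro allI impI)
  fix x y :: "nat \<Rightarrow> real" assume xy: "\<forall>i<M. x i = y i"
  have "F (mix I c s x t) = F (mix I c s y t)" for t
  proof -
    have "\<forall>i<M. mix I c s x t i = mix I c s y t i" using xy M by (auto simp: mix_def)
    then show ?thesis using F unfolding cylindrical_def by blast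
  qed
  then show "mehler I c s F x = mehler I c s F y" by (simp add: mehler_def)
qed

lemma cylindrical_reservoir_avg: "{..<M} \<subseteq> I \<Longrightarrow> cylindrical M (reservoir_avg M I F)"
  unfolding cylindrical_def reservoir_avg_def
proof (intro allI impI)
  fix x y :: "nat \<Rightarrow> real" assume xy: "\<forall>i<M. x i = y i"
  have "mix I (split_wt M 1 0) (split_wt M 0 1) x t = mix I (split_wt M 1 0) (split_wt M 0 1) y t" for t
    using xy by (auto simp: mix_def split_wt_def fun_eq_iff)
  then show "mehler I (split_wt M 1 0) (split_wt M 0 1) F x = mehler I (split_wt M 1 0) (split_wt M 0 1) F y" by (simp add: mehler_def)
qed

context
  fixes I :: "nat set" and M :: nat
  assumes I: "finite I" and M: "{..<M} \<subseteq> I"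
begin

text \<open>Both sides are the integral of one function of a single Gaussian vector V: its v-part is
  the noise of the Mehler step and its w-part is the reservoir after that step.\<close>

lemma integral_mix_reservoir_avg:
  assumes F: "bmeas I F" and f: "integrable (gauss I) f" and cs: "c\<^sup>2 + s\<^sup>2 = 1"
    and dep: "\<And>x y. (\<And>i. i < M \<Longrightarrow> x i = y i) \<Longrightarrow> f x = f y"
  shows "(\<integral>y. reservoir_avg M I F (mix I (\<lambda>_. c) (\<lambda>_. s) z y) * f y \<partial>gauss I)
    = reservoir_avg M I (\<lambda>z. \<integral>y. F (mix I (\<lambda>_. c) (\<lambda>_. s) z y) * f y \<partial>gauss I) z"
proof -
  define H where "H V = F (mix I (split_wt M c 0) (split_wt M s 1) z V) * f V" for V
  have Hi: "integrable (gauss I) H"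
    unfolding H_def by (rule bmeas_mult_integrable[OF I bmeas_mix[OF I F] f])
  have "(\<integral>y. reservoir_avg M I F (mix I (\<lambda>_. c) (\<lambda>_. s) z y) * f y \<partial>gauss I)
      = (\<integral>y. \<integral>t. H (mix I (split_wt M 1 0) (split_wt M 0 1) y t) \<partial>gauss I \<partial>gauss I)"
  proof (intro Bochner_Integration.integral_cong refl)
    fix y
    have "F (mix I (split_wt M 1 0) (split_wt M 0 1) (mix I (\<lambda>_. c) (\<lambda>_. s) z y) t) * f y = H (mix I (split_wt M 1 0) (split_wt M 0 1) y t)" for t
    proof -
      have "mix I (split_wt M 1 0) (split_wt M 0 1) (mix I (\<lambda>_. c) (\<lambda>_. s) z y) t = mix I (split_wt M c 0) (split_wt M s 1) z (mix I (split_wt M 1 0) (split_wt M 0 1) y t)"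
        by (auto simp: mix_def split_wt_def fun_eq_iff)
      moreover have "f y = f (mix I (split_wt M 1 0) (split_wt M 0 1) y t)"
        by (rule dep) (use M in \<open>auto simp: mix_def split_wt_def\<close>)
      ultimately show ?thesis by (simp add: H_def)
    qed
    then show "reservoir_avg M I F (mix I (\<lambda>_. c) (\<lambda>_. s) z y) * f y = (\<integral>t. H (mix I (split_wt M 1 0) (split_wt M 0 1) y t) \<partial>gauss I)"
      unfolding reservoir_avg_def mehler_def by (simp flip: integral_mult_left_zero)
  qed
  also have "\<dots> = (\<integral>V. H V \<partial>gauss I)"
    by (rule integral_mix(1)[OF I _ Hi]) (auto simp: split_wt_def)
  \<comment> \<open>The same V decomposed differently: the v-part comes from y, while the w-part is
    c t + s y, which is Gaussian because c^2 + s^2 = 1.\<close>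
  also have "\<dots> = (\<integral>t. \<integral>y. H (mix I (split_wt M 0 c) (split_wt M 1 s) t y) \<partial>gauss I \<partial>gauss I)"
    by (rule integral_mix(1)[symmetric, OF I _ Hi]) (use cs in \<open>auto simp: split_wt_def\<close>)
  also have "\<dots> = reservoir_avg M I (\<lambda>z. \<integral>y. F (mix I (\<lambda>_. c) (\<lambda>_. s) z y) * f y \<partial>gauss I) z"
    unfolding reservoir_avg_def mehler_def[of I "split_wt M 1 0"]
  proof (intro Bochner_Integration.integral_cong refl)
    fix t y
    have "mix I (split_wt M c 0) (split_wt M s 1) z (mix I (split_wt M 0 c) (split_wt M 1 s) t y) = mix I (\<lambda>_. c) (\<lambda>_. s) (mix I (split_wt M 1 0) (split_wt M 0 1) z t) y"
      by (auto simp: mix_def split_wt_def fun_eq_iff)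
    moreover have "f (mix I (split_wt M 0 c) (split_wt M 1 s) t y) = f y"
      by (rule dep) (use M in \<open>auto simp: mix_def split_wt_def\<close>)
    ultimately show "H (mix I (split_wt M 0 c) (split_wt M 1 s) t y) = F (mix I (\<lambda>_. c) (\<lambda>_. s) (mix I (split_wt M 1 0) (split_wt M 0 1) z t) y) * f y"
      by (simp add: H_def)
  qed
  finally show ?thesis .
qed

lemma reservoir_avg_mehler:
  assumes F: "bmeas I F" and cs: "c\<^sup>2 + s\<^sup>2 = 1"
  shows "reservoir_avg M I (mehler I (\<lambda>_. c) (\<lambda>_. s) F) = mehler I (\<lambda>_. c) (\<lambda>_. s) (reservoir_avg M I F)"
proof
  fix z
  have e: "mehler I (\<lambda>_. c) (\<lambda>_. s) G = (\<lambda>z. \<integral>y. G (mix I (\<lambda>_. c) (\<lambda>_. s) z y) * 1 \<partial>gauss I)" for G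
    by (simp add: mehler_def fun_eq_iff)
  show "reservoir_avg M I (mehler I (\<lambda>_. c) (\<lambda>_. s) F) z = mehler I (\<lambda>_. c) (\<lambda>_. s) (reservoir_avg M I F) z"
    unfolding e by (rule integral_mix_reservoir_avg[symmetric, OF F _ cs]) auto
qed

lemma hermite_reservoir_avg:
  assumes F: "bmeas I F" and cs: "c\<^sup>2 + s\<^sup>2 = 1" and i: "i < M"
  shows "hermite I (\<lambda>_. c) (\<lambda>_. s) i (reservoir_avg M I F) z = reservoir_avg M I (hermite I (\<lambda>_. c) (\<lambda>_. s) i F) z"
proof -
  have "integrable (gauss I) (\<lambda>y. y i)" by (rule integrable_coord[OF I]) (use M i in auto)
  from integral_mix_reservoir_avg[where z=z, OF F this cs] i show ?thesis by (simp add: hermite_def[abs_def])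
qed

text \<open>Reflecting a reservoir coordinate of the noise leaves F unchanged and reverses the sign
  of the integrand.\<close>

lemma hermite_cylindrical:
  assumes F: "bmeas I F" "cylindrical M F" and i: "i \<in> I" "\<not> i < M"
  shows "hermite I c s i F z = 0"
  unfolding hermite_def
proof (rule integral_coord_flip[OF I i(1)])
  show "integrable (gauss I) (\<lambda>y. F (mix I c s z y) * y i)"
    by (rule bmeas_mult_integrable[OF I bmeas_mix[OF I F(1)] integrable_coord[OF I i(1)]])
  fix y
  have "mix I c s z (\<lambda>k\<in>I. if k = i then - y k else y k) k = mix I c s z y k" if "k < M" for k
    using that M i(2) by (auto simp: mix_def)
  then show "F (mix I c s z (\<lambda>k\<in>I. if k = i then - y k else y k)) = F (mix I c s z y)"
    using F(2) unfolding cylindrical_def by blast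
qed

text \<open>The weight b on the reservoir is arbitrary. This is used at both ends of the chain of
  estimates: to discard w for the output and to read off only the first coefficient for the
  input.\<close>

lemma fisher_cylindrical:
  assumes F: "bmeas I F" "cylindrical M F"
  shows "fisher I c s (split_wt M a b) F = a * fisher I c s (\<lambda>_. 1) F"
proof -
  have "(\<Sum>i\<in>I. split_wt M a b i * (hermite I c s i F z)\<^sup>2) = a * (\<Sum>i\<in>I. 1 * (hermite I c s i F z)\<^sup>2)" for z
    unfolding sum_distrib_left
  proof (rule sum.cong[OF refl])
    fix i assume "i \<in> I"
    then show "split_wt M a b i * (hermite I c s i F z)\<^sup>2 = a * (1 * (hermite I c s i F z)\<^sup>2)"
      using hermite_cylindrical[OF F, of i c s z] by (auto simp: split_wt_def)
  qed
  then show ?thesis unfolding fisher_def by (simp only: times_divide_eq_right[symmetric] integral_mult_right_zero)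
qed

text \<open>Convexity again, now for the reservoir average in place of the rotations. The weights
  vanish on w since the averaged function has no gradient there.\<close>

lemma fisher_reservoir_avg:
  assumes F: "0 < e" "between I e B F" and cs: "c\<^sup>2 + s\<^sup>2 = 1"
  shows "fisher I (\<lambda>_. c) (\<lambda>_. s) (split_wt M 1 0) (reservoir_avg M I F) \<le> fisher I (\<lambda>_. c) (\<lambda>_. s) (split_wt M 1 0) F"
proof -
  let ?c = "\<lambda>_::nat. c" and ?s = "\<lambda>_::nat. s" and ?m = "mix I (split_wt M 1 0) (split_wt M 0 1)"
  note Fm = between_bmeas[OF I F(2)]
  define g where "g z = (\<Sum>i\<in>I. split_wt M 1 0 i * (hermite I ?c ?s i F z)\<^sup>2) / mehler I ?c ?s F z" for z
  have gb: "bmeas I g" unfolding g_def by (rule fisher_integrable[OF I F(2,1)])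
  have CF: "between I e B (reservoir_avg M I F)" unfolding reservoir_avg_def by (rule between_mehler[OF I F(2)])
  have "fisher I ?c ?s (split_wt M 1 0) (reservoir_avg M I F) \<le> (\<integral>z. mehler I (split_wt M 1 0) (split_wt M 0 1) g z \<partial>gauss I)"
    unfolding fisher_def
  proof (rule integral_mono)
    show "integrable (gauss I) (\<lambda>z. (\<Sum>i\<in>I. split_wt M 1 0 i * (hermite I ?c ?s i (reservoir_avg M I F) z)\<^sup>2) / mehler I ?c ?s (reservoir_avg M I F) z)"
      by (rule bmeas_integrable[OF I fisher_integrable[OF I CF F(1)]])
    show "integrable (gauss I) (mehler I (split_wt M 1 0) (split_wt M 0 1) g)" by (rule bmeas_integrable[OF I bmeas_mehler[OF I gb]])
    fix z
    have Y: "mehler I ?c ?s (reservoir_avg M I F) z = (\<integral>t. mehler I ?c ?s F (?m z t) \<partial>gauss I)"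
      unfolding reservoir_avg_mehler[OF Fm cs, symmetric] unfolding reservoir_avg_def mehler_def[of I "split_wt M 1 0"] ..
    have X: "split_wt M 1 0 i * (hermite I ?c ?s i (reservoir_avg M I F) z)\<^sup>2 = split_wt M 1 0 i * (\<integral>t. hermite I ?c ?s i F (?m z t) \<partial>gauss I)\<^sup>2" for i
    proof (cases "i < M")
      case True
      then show ?thesis unfolding hermite_reservoir_avg[OF Fm cs True] unfolding reservoir_avg_def mehler_def[of I "split_wt M 1 0"] by simp
    qed (simp add: split_wt_def)
    have Yp: "0 < mehler I ?c ?s F x" for x using mehler_mono_const[OF I F(2), of ?c ?s x] F(1) by linarith
    \<comment> \<open>The one-point index set reduces the convexity lemma for weighted families to a
      single integral.\<close>
    have "(\<Sum>i\<in>I. split_wt M 1 0 i * (hermite I ?c ?s i (reservoir_avg M I F) z)\<^sup>2) / mehler I ?c ?s (reservoir_avg M I F) z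
      = (\<Sum>i\<in>I. split_wt M 1 0 i * (\<Sum>a\<in>{()}. 1 * (\<integral>t. hermite I ?c ?s i F (?m z t) \<partial>gauss I))\<^sup>2) / (\<Sum>a\<in>{()}. 1 * (\<integral>t. mehler I ?c ?s F (?m z t) \<partial>gauss I))"
      unfolding X Y by simp
    also have "\<dots> \<le> (\<Sum>a\<in>{()}. 1 * (\<integral>t. (\<Sum>i\<in>I. split_wt M 1 0 i * (hermite I ?c ?s i F (?m z t))\<^sup>2) / mehler I ?c ?s F (?m z t) \<partial>gauss I))"
    proof (rule square_over_jensen)
      show "integrable (gauss I) (\<lambda>t. hermite I ?c ?s i F (?m z t))" if "i \<in> I" for i
        by (rule bmeas_integrable[OF I bmeas_mix[OF I bmeas_hermite[OF I Fm that]]])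
      show "integrable (gauss I) (\<lambda>t. mehler I ?c ?s F (?m z t))"
        by (rule bmeas_integrable[OF I bmeas_mix[OF I bmeas_mehler[OF I Fm]]])
      show "integrable (gauss I) (\<lambda>t. (\<Sum>i\<in>I. split_wt M 1 0 i * (hermite I ?c ?s i F (?m z t))\<^sup>2) / mehler I ?c ?s F (?m z t))"
        using bmeas_integrable[OF I bmeas_mix[OF I gb]] by (simp add: g_def)
      have "0 < mehler I ?c ?s (reservoir_avg M I F) z" using mehler_mono_const[OF I CF, of ?c ?s z] F(1) by linarith
      then show "0 < (\<Sum>a\<in>{()}. 1 * (\<integral>t. mehler I ?c ?s F (?m z t) \<partial>gauss I))" by (simp add: Y)
    qed (use I Yp in \<open>auto simp: split_wt_def\<close>)
    also have "\<dots> = mehler I (split_wt M 1 0) (split_wt M 0 1) g z" by (simp add: mehler_def[of I "split_wt M 1 0"] g_def)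
    finally show "(\<Sum>i\<in>I. split_wt M 1 0 i * (hermite I ?c ?s i (reservoir_avg M I F) z)\<^sup>2) / mehler I ?c ?s (reservoir_avg M I F) z \<le> mehler I (split_wt M 1 0) (split_wt M 0 1) g z" .
  qed
  also have "\<dots> = (\<integral>z. g z \<partial>gauss I)" by (rule integral_mehler[OF I _ gb]) (auto simp: split_wt_def)
  finally show ?thesis by (simp add: fisher_def g_def)
qed

end

section \<open>Sums over pairs and the recursion for the two weights\<close>

lemma sum_pairs: "(\<Sum>a\<in>pairs D. f a) = (\<Sum>j<D. \<Sum>i<j. f (i, j))"
proof -
  have "(\<Sum>j<D. \<Sum>i<j. f (i, j)) = (\<Sum>p\<in>(SIGMA j:{..<D}. {..<j}). f (snd p, fst p))"
    by (subst sum.Sigma) (auto simp: case_prod_beta')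
  also have "\<dots> = (\<Sum>a\<in>pairs D. f a)"
    by (rule sum.reindex_bij_witness[of _ "\<lambda>a. (snd a, fst a)" "\<lambda>p. (snd p, fst p)"]) (auto simp: pairs_def)
  finally show ?thesis ..
qed

lemma finite_pairs: "finite (pairs D)"
  by (rule finite_subset[of _ "{..<D} \<times> {..<D}"]) (auto simp: pairs_def)

lemma sum_split_MN:
  fixes f :: "nat \<Rightarrow> real"
  shows "(\<Sum>i<M + N. f i) = (\<Sum>i<M. f i) + (\<Sum>i=M..<M+N. f i)"
  by (simp add: lessThan_atLeast0 sum.atLeastLessThan_concat)

text \<open>The three pieces are the collisions inside the system, between system and reservoir, and
  inside the reservoir, which is how the rates are distinguished.\<close>

lemma sum_pairs_split:
  fixes f :: "nat \<times> nat \<Rightarrow> real"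
  shows "(\<Sum>a\<in>pairs (M + N). f a) = (\<Sum>j<M. \<Sum>i<j. f (i, j))
     + (\<Sum>j=M..<M+N. (\<Sum>i<M. f (i, j)) + (\<Sum>i=M..<j. f (i, j)))"
proof -
  have "(\<Sum>i<j. f (i, j)) = (\<Sum>i<M. f (i, j)) + (\<Sum>i=M..<j. f (i, j))" if "j \<in> {M..<M+N}" for j
    using that sum.atLeastLessThan_concat[of 0 M j "\<lambda>i. f (i, j)"] by (simp add: lessThan_atLeast0)
  then have "(\<Sum>j=M..<M+N. \<Sum>i<j. f (i, j)) = (\<Sum>j=M..<M+N. (\<Sum>i<M. f (i, j)) + (\<Sum>i=M..<j. f (i, j)))"
    by (rule sum.cong[OF refl])
  then show ?thesis unfolding sum_pairs sum_split_MN by simp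
qed

lemma sum_lessThan_real: "(\<Sum>j<n. real j) = real n * (real n - 1) / 2"
  by (induction n) (auto simp: field_simps)

lemma sum_shift_real: "(\<Sum>j=M..<M+N. real (j - M)) = (\<Sum>j<N. real j)"
  by (rule sum.reindex_bij_witness[of _ "\<lambda>j. j + M" "\<lambda>j. j - M"]) auto

text \<open>The averaged rotation maps the quadratic form \<open>a |v|\<^sup>2 + b |w|\<^sup>2\<close> to one of the same shape; the
  coefficients follow this recursion with \<open>t = relax\<close> and \<open>r = M / N\<close>.\<close>

fun wt_iter :: "real \<Rightarrow> real \<Rightarrow> nat \<Rightarrow> real \<times> real" where
  "wt_iter t r 0 = (1, 0)"
| "wt_iter t r (Suc k) = (let (a, b) = wt_iter t r k in (a - t * (a - b), b + t * r * (a - b)))"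

text \<open>The difference a - b is multiplied by 1 - t - t r = 1 - t (N + M) / N at each step,
  while M a + N b keeps its initial value M. Hence both weights tend towards M / (N + M) when that
  ratio is less than 1 in modulus, which explains the shape of the constant.\<close>

lemma wt_iter_closed:
  assumes "r = M / N" "0 < N" "0 \<le> M"
  shows "fst (wt_iter t r k) = M / (N + M) + N / (N + M) * (1 - t * (N + M) / N) ^ k"
    and "snd (wt_iter t r k) = fst (wt_iter t r k) - (1 - t * (N + M) / N) ^ k"
proof -
  define x where "x = 1 - t * (N + M) / N"
  have NM: "0 < N + M" using assms by linarith
  have x': "x = 1 - t - t * r" using assms by (simp add: x_def field_simps)
  have d: "fst (wt_iter t r k) - snd (wt_iter t r k) = x ^ k" for k
  proof (induction k)
    case (Suc k)
    have "fst (wt_iter t r (Suc k)) - snd (wt_iter t r (Suc k)) = (1 - t - t * r) * (fst (wt_iter t r k) - snd (wt_iter t r k))"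
      by (simp add: case_prod_beta' Let_def algebra_simps)
    then show ?case by (simp only: Suc x'[symmetric] power_Suc)
  qed simp
  then show "snd (wt_iter t r k) = fst (wt_iter t r k) - (1 - t * (N + M) / N) ^ k"
    unfolding x_def[symmetric] by (simp flip: d)
  have "fst (wt_iter t r k) * (N + M) = M + N * x ^ k"
  proof (induction k)
    case (Suc k)
    have tN: "t * (N + M) = N * (1 - x)" using assms by (simp add: x_def)
    have "fst (wt_iter t r (Suc k)) * (N + M) = fst (wt_iter t r k) * (N + M) - (t * (N + M)) * (fst (wt_iter t r k) - snd (wt_iter t r k))"
      by (simp add: case_prod_beta' Let_def algebra_simps)
    also have "\<dots> = M + N * x ^ Suc k" unfolding Suc tN d by (simp add: algebra_simps)
    finally show ?case .
  qed simp
  then show "fst (wt_iter t r k) = M / (N + M) + N / (N + M) * (1 - t * (N + M) / N) ^ k"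
    unfolding x_def[symmetric] using NM by (simp add: eq_divide_eq add_divide_distrib[symmetric])
qed

text \<open>Each new weight is a convex combination of the old ones, with proportions t and t r. The
  bound r <= 1 will come from M <= N.\<close>

lemma wt_iter_nonneg:
  assumes "0 \<le> t" "t \<le> 1" "0 \<le> r" "r \<le> 1"
  shows "0 \<le> fst (wt_iter t r k) \<and> 0 \<le> snd (wt_iter t r k)"
proof (induction k)
  case (Suc k)
  obtain a b where ab: "wt_iter t r k = (a, b)" by fastforce
  have "t * r \<le> 1" using assms by (simp add: mult_le_one)
  then have "0 \<le> (1 - t) * a + t * b" "0 \<le> (1 - t * r) * b + t * r * a"
    using Suc assms by (auto simp: ab)
  then show ?case by (simp add: ab algebra_simps)
qed simp

section \<open>Collision rates and the averaged quadratic form\<close>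

context
  fixes M N :: nat and lS lR mu :: real and R :: "real measure"
  assumes MN: "1 \<le> M" "M \<le> N" and pos: "0 < lS" "0 < lR" "0 < mu"
    and R: "prob_space R" "sets R = sets borel"
    and sc: "(\<integral>th. sin th * cos th \<partial>R) = 0"
begin

interpretation R: prob_space R by (rule R)

abbreviation (input) "wt \<equiv> lam M N lS lR mu"
abbreviation (input) "LL \<equiv> Lam M N lS lR mu"
text \<open>The quotient of mu_rho by Lambda: the weight that a system coordinate exchanges with the
  reservoir in one collision.\<close>

definition relax :: real where "relax = mu * (\<integral>th. (sin th)\<^sup>2 \<partial>R) / LL"

lemma LL_pos: "0 < LL"
  unfolding Lam_def using MN pos by (intro add_pos_pos) auto

lemma mu_le_LL: "mu * real M \<le> LL"
  unfolding Lam_def using MN pos by simp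

lemma wt_nonneg: "a \<in> pairs (M + N) \<Longrightarrow> 0 \<le> wt a"
  unfolding lam_def using MN pos LL_pos by (auto intro!: divide_nonneg_nonneg mult_nonneg_nonneg)

text \<open>Only an inequality: for \<open>M = 1\<close> the denominator \<open>M - 1\<close> vanishes, and the missing mass
  \<open>lS M / (2 LL)\<close> is lost (likewise for \<open>N = 1\<close>).\<close>

lemma wt_sum: "sum wt (pairs (M + N)) \<le> 1" "0 < sum wt (pairs (M + N))"
proof -
  define qS where "qS = lS / (LL * (real M - 1))"
  define qR where "qR = lR / (LL * (real N - 1))"
  define qm where "qm = mu / (LL * real N)"
  have M1: "real M \<ge> 1" "real N \<ge> 1" using MN by auto
  have "sum wt (pairs (M + N)) = (\<Sum>j<M. \<Sum>i<j. qS) + (\<Sum>j=M..<M+N. (\<Sum>i<M. qm) + (\<Sum>i=M..<j. qR))"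
    unfolding sum_pairs_split
    by (intro arg_cong2[where f="(+)"] sum.cong refl) (auto simp: lam_def qS_def qR_def qm_def)
  also have "\<dots> = qS * (\<Sum>j<M. real j) + (real N * real M * qm + qR * (\<Sum>j=M..<M+N. real (j - M)))"
    by (simp add: sum.distrib sum_distrib_left mult_ac)
  also have "\<dots> = qS * (real M * (real M - 1) / 2) + (real N * real M * qm + qR * (real N * (real N - 1) / 2))"
    by (simp only: sum_shift_real sum_lessThan_real)
  finally have eq: "sum wt (pairs (M + N)) = qS * (real M * (real M - 1) / 2) + real N * real M * qm + qR * (real N * (real N - 1) / 2)" by simp
  have aux: "l / (LL * (n - 1)) * (n * (n - 1) / 2) \<le> l * n / 2 / LL \<and> 0 \<le> l / (LL * (n - 1)) * (n * (n - 1) / 2)"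
    if "1 \<le> n" "0 < l" for l n :: real
    using that LL_pos by (cases "n = 1") (auto simp: field_simps)
  have m: "real N * real M * qm = mu * real M / LL" using M1 LL_pos by (simp add: qm_def)
  have "sum wt (pairs (M + N)) \<le> lS * real M / 2 / LL + mu * real M / LL + lR * real N / 2 / LL"
    unfolding eq m using aux[OF M1(1) pos(1)] aux[OF M1(2) pos(2)] unfolding qS_def qR_def by linarith
  also have "\<dots> = 1" unfolding add_divide_distrib[symmetric] using LL_pos by (simp add: Lam_def)
  finally show "sum wt (pairs (M + N)) \<le> 1" .
  have "0 < mu * real M / LL" using M1 LL_pos pos by simp
  then show "0 < sum wt (pairs (M + N))"
    unfolding eq m using aux[OF M1(1) pos(1)] aux[OF M1(2) pos(2)] unfolding qS_def qR_def by linarith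
qed

lemma trig_integrable: "integrable R (\<lambda>th. sin th * cos th)" "integrable R (\<lambda>th. (sin th)\<^sup>2)"
proof -
  have m: "(\<lambda>th. sin th * cos th) \<in> borel_measurable R" "(\<lambda>th. (sin th)\<^sup>2 :: real) \<in> borel_measurable R"
    by (simp_all add: measurable_cong_sets[OF R(2) refl])
  show "integrable R (\<lambda>th. sin th * cos th)"
    by (rule R.integrable_const_bound[of _ 1, OF AE_I2 m(1)]) (simp add: abs_mult mult_le_one)
  show "integrable R (\<lambda>th. (sin th)\<^sup>2)"
    by (rule R.integrable_const_bound[of _ 1, OF AE_I2 m(2)]) (simp add: abs_square_le_1)
qed

lemma relax_bounds: "0 \<le> relax" "relax \<le> 1"
proof -
  have "(\<integral>th. (sin th)\<^sup>2 \<partial>R) \<le> (\<integral>th. 1 \<partial>R)"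
    by (intro integral_mono trig_integrable) (auto simp: abs_square_le_1)
  then have s: "0 \<le> (\<integral>th. (sin th)\<^sup>2 \<partial>R)" "(\<integral>th. (sin th)\<^sup>2 \<partial>R) \<le> 1" by (auto simp: R.prob_space)
  show "0 \<le> relax" unfolding relax_def using s pos LL_pos by simp
  have "mu * (\<integral>th. (sin th)\<^sup>2 \<partial>R) \<le> mu * real M" using s pos MN by (intro mult_left_mono) auto
  then show "relax \<le> 1" unfolding relax_def using mu_le_LL LL_pos by simp
qed

text \<open>A rotation of the pair (p, q) changes the form by the difference of the two weights
  times the mean of sin^2 times x_q^2 - x_p^2, which vanishes inside a block. Each system coordinate
  meets N reservoir partners at rate mu / (Lambda N), each reservoir coordinate M system partners;
  hence the factor M / N between the two transfers. The result is an inequality because the total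
  rate multiplying the unchanged form is at most 1.\<close>

lemma quad_form:
  assumes ab: "0 \<le> a" "0 \<le> b"
  shows "(\<Sum>p\<in>pairs (M + N). wt p * (\<integral>th. (\<Sum>i<M + N. split_wt M a b i * (rot (fst p) (snd p) (- th) x i)\<^sup>2) \<partial>R))
     \<le> (\<Sum>i<M + N. split_wt M (a - relax * (a - b)) (b + relax * (real M / real N) * (a - b)) i * (x i)\<^sup>2)"
proof -
  define S where "S = (\<Sum>i<M + N. split_wt M a b i * (x i)\<^sup>2)"
  define sg where "sg = (\<integral>th. (sin th)\<^sup>2 \<partial>R)"
  define XM where "XM = (\<Sum>i<M. (x i)\<^sup>2)"
  define XN where "XN = (\<Sum>i=M..<M+N. (x i)\<^sup>2)"
  have Seq: "(\<Sum>i<M + N. split_wt M a b i * (x i)\<^sup>2) = a * XM + b * XN" for a b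
    unfolding sum_split_MN XM_def XN_def sum_distrib_left
    by (intro arg_cong2[where f="(+)"] sum.cong) (auto simp: split_wt_def)
  have S0: "0 \<le> S" unfolding S_def using ab by (intro sum_nonneg) (auto simp: split_wt_def)
  have inner: "(\<integral>th. (\<Sum>i<M + N. split_wt M a b i * (rot p q (- th) x i)\<^sup>2) \<partial>R)
     = S + (split_wt M a b p - split_wt M a b q) * sg * ((x q)\<^sup>2 - (x p)\<^sup>2)" if pq: "p < q" "q < M + N" for p q
  proof -
    let ?W = "split_wt M a b"
    have c2: "(cos th)\<^sup>2 = 1 - (sin th)\<^sup>2" for th :: real by (simp add: cos_squared_eq)
    have "(\<Sum>i<M + N. ?W i * (rot p q (- th) x i)\<^sup>2)
       = S + ((?W p - ?W q) * ((x q)\<^sup>2 - (x p)\<^sup>2)) * (sin th)\<^sup>2 + (2 * (?W p - ?W q) * x p * x q) * (sin th * cos th)" for th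
    proof -
      have f: "finite {..<M + N}" "p \<in> {..<M + N}" "q \<in> {..<M + N} - {p}" using pq by auto
      have r: "(\<Sum>i<M + N. g i) = g p + g q + (\<Sum>i\<in>{..<M + N} - {p} - {q}. g i)" for g :: "nat \<Rightarrow> real"
        using f by (simp add: sum.remove[of _ p] sum.remove[of _ q])
      have rest: "(\<Sum>i\<in>{..<M + N} - {p} - {q}. ?W i * (rot p q (- th) x i)\<^sup>2) = (\<Sum>i\<in>{..<M + N} - {p} - {q}. ?W i * (x i)\<^sup>2)"
        by (intro sum.cong) (auto simp: rot_apply)
      have A: "(rot p q (- th) x p)\<^sup>2 = (x p)\<^sup>2 + ((x q)\<^sup>2 - (x p)\<^sup>2) * (sin th)\<^sup>2 + 2 * x p * x q * (sin th * cos th)"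
        using pq arg_cong[OF c2[of th], of "\<lambda>u. (x p)\<^sup>2 * u"] by (simp add: rot_apply power2_eq_square algebra_simps)
      have B: "(rot p q (- th) x q)\<^sup>2 = (x q)\<^sup>2 - ((x q)\<^sup>2 - (x p)\<^sup>2) * (sin th)\<^sup>2 - 2 * x p * x q * (sin th * cos th)"
        using pq arg_cong[OF c2[of th], of "\<lambda>u. (x q)\<^sup>2 * u"] by (simp add: rot_apply power2_eq_square algebra_simps)
      show ?thesis unfolding S_def r[of "\<lambda>i. ?W i * (rot p q (- th) x i)\<^sup>2"] r[of "\<lambda>i. ?W i * (x i)\<^sup>2"] rest A B
        by (simp add: algebra_simps)
    qed
    moreover have "(\<integral>th. S + U * (sin th)\<^sup>2 + V * (sin th * cos th) \<partial>R) = S + U * sg" for U V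
      using trig_integrable sc by (simp add: sg_def R.prob_space)
    ultimately have "(\<integral>th. (\<Sum>i<M + N. ?W i * (rot p q (- th) x i)\<^sup>2) \<partial>R)
        = S + ((?W p - ?W q) * ((x q)\<^sup>2 - (x p)\<^sup>2)) * sg" by simp
    then show ?thesis by simp
  qed
  have "(\<Sum>p\<in>pairs (M + N). wt p * (\<integral>th. (\<Sum>i<M + N. split_wt M a b i * (rot (fst p) (snd p) (- th) x i)\<^sup>2) \<partial>R))
    = (\<Sum>p\<in>pairs (M + N). wt p * S + wt p * ((split_wt M a b (fst p) - split_wt M a b (snd p)) * sg * ((x (snd p))\<^sup>2 - (x (fst p))\<^sup>2)))"
    by (intro sum.cong refl) (auto simp: pairs_def inner algebra_simps)
  also have "\<dots> = sum wt (pairs (M + N)) * S + (\<Sum>p\<in>pairs (M + N). wt p * ((split_wt M a b (fst p) - split_wt M a b (snd p)) * sg * ((x (snd p))\<^sup>2 - (x (fst p))\<^sup>2)))"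
    by (simp add: sum.distrib sum_distrib_right)
  also have "(\<Sum>p\<in>pairs (M + N). wt p * ((split_wt M a b (fst p) - split_wt M a b (snd p)) * sg * ((x (snd p))\<^sup>2 - (x (fst p))\<^sup>2)))
    = (\<Sum>j=M..<M+N. \<Sum>i<M. (mu / (LL * real N)) * ((a - b) * sg * ((x j)\<^sup>2 - (x i)\<^sup>2)))"
  proof -
    have z1: "(\<Sum>j<M. \<Sum>i<j. wt (i, j) * ((split_wt M a b i - split_wt M a b j) * sg * ((x j)\<^sup>2 - (x i)\<^sup>2))) = 0"
      by (intro sum.neutral ballI) (auto simp: split_wt_def)
    have z2: "(\<Sum>i=M..<j. wt (i, j) * ((split_wt M a b i - split_wt M a b j) * sg * ((x j)\<^sup>2 - (x i)\<^sup>2))) = 0" for j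
      by (intro sum.neutral ballI) (auto simp: split_wt_def)
    show ?thesis unfolding sum_pairs_split fst_conv snd_conv z1 z2
      by (auto simp: split_wt_def lam_def intro!: sum.cong)
  qed
  also have "\<dots> = (mu / (LL * real N)) * ((a - b) * sg) * (\<Sum>j=M..<M+N. \<Sum>i<M. (x j)\<^sup>2 - (x i)\<^sup>2)"
    by (simp only: sum_distrib_left mult.assoc)
  also have "(\<Sum>j=M..<M+N. \<Sum>i<M. (x j)\<^sup>2 - (x i)\<^sup>2) = real M * XN - real N * XM"
    by (simp add: sum_subtractf sum_distrib_left XM_def XN_def)
  also have "(mu / (LL * real N)) * ((a - b) * sg) * (real M * XN - real N * XM)
     = - relax * (a - b) * XM + relax * (real M / real N) * (a - b) * XN"
    using MN LL_pos by (simp add: relax_def sg_def field_simps)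
  also have "sum wt (pairs (M + N)) * S \<le> S" using wt_sum S0 by (intro mult_left_le_one_le) auto
  finally have "(\<Sum>p\<in>pairs (M + N). wt p * (\<integral>th. (\<Sum>i<M + N. split_wt M a b i * (rot (fst p) (snd p) (- th) x i)\<^sup>2) \<partial>R))
    \<le> S + (- relax * (a - b) * XM + relax * (real M / real N) * (a - b) * XN)" by simp
  also have "\<dots> = (\<Sum>i<M + N. split_wt M (a - relax * (a - b)) (b + relax * (real M / real N) * (a - b)) i * (x i)\<^sup>2)"
    unfolding S_def Seq by (simp add: algebra_simps)
  finally show ?thesis .
qed

abbreviation (input) "QQ \<equiv> Qop (pairs (M + N)) wt R"

lemma pairs_in: "a \<in> pairs (M + N) \<Longrightarrow> fst a \<in> {..<M + N} \<and> snd a \<in> {..<M + N} \<and> fst a \<noteq> snd a"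
  by (auto simp: pairs_def)

lemmas Q_facts = finite_lessThan[of "M + N"] finite_pairs pairs_in wt_nonneg wt_sum R

lemma between_Qpow: "0 < e \<Longrightarrow> between {..<M + N} e B F \<Longrightarrow> between {..<M + N} (sum wt (pairs (M + N)) ^ k * e) B ((QQ ^^ k) F)"
proof (induction k)
  case (Suc k)
  have "0 \<le> sum wt (pairs (M + N)) ^ k * e" using wt_sum Suc by simp
  from between_Q[OF Q_facts this Suc.IH[OF Suc.prems]] show ?case by (simp add: mult.assoc)
qed simp

lemma bmeas_Qpow: "bmeas {..<M + N} F \<Longrightarrow> bmeas {..<M + N} ((QQ ^^ k) F)"
  by (induction k) (simp_all add: bmeas_Q[OF Q_facts])

lemma Qpow_mehler: "bmeas {..<M + N} F \<Longrightarrow> (QQ ^^ k) (mehler {..<M + N} (\<lambda>_. c) (\<lambda>_. s) F) = mehler {..<M + N} (\<lambda>_. c) (\<lambda>_. s) ((QQ ^^ k) F)"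
  by (induction k) (simp_all add: Q_mehler[OF Q_facts] bmeas_Qpow)

text \<open>The form |v|^2 is attached to the outermost function and transported inward through one
  factor of Q after another. The induction therefore generalises over F and e and removes the
  innermost factor.\<close>

lemma fisher_Qpow:
  assumes "0 < e" "between {..<M + N} e B F"
  shows "fisher {..<M + N} (\<lambda>_. c) (\<lambda>_. s) (split_wt M 1 0) ((QQ ^^ k) F)
    \<le> fisher {..<M + N} (\<lambda>_. c) (\<lambda>_. s) (split_wt M (fst (wt_iter relax (real M / real N) k)) (snd (wt_iter relax (real M / real N) k))) F"
  using assms
proof (induction k arbitrary: F e)
  case (Suc k)
  let ?e = "sum wt (pairs (M + N)) * e"
  let ?a = "fst (wt_iter relax (real M / real N) k)" and ?b = "snd (wt_iter relax (real M / real N) k)"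
  have e: "0 < ?e" using wt_sum Suc by simp
  have Qb: "between {..<M + N} ?e B (QQ F)" by (rule between_Q[OF Q_facts]) (use Suc in auto)
  have r: "0 \<le> real M / real N" "real M / real N \<le> 1" using MN by auto
  have nn: "0 \<le> ?a" "0 \<le> ?b" using wt_iter_nonneg[OF relax_bounds r, of k] by auto
  have "(QQ ^^ Suc k) F = (QQ ^^ k) (QQ F)" by (simp add: funpow_swap1)
  then have "fisher {..<M + N} (\<lambda>_. c) (\<lambda>_. s) (split_wt M 1 0) ((QQ ^^ Suc k) F) \<le> fisher {..<M + N} (\<lambda>_. c) (\<lambda>_. s) (split_wt M ?a ?b) (QQ F)"
    using Suc.IH[OF e Qb] by simp
  also have "\<dots> \<le> fisher {..<M + N} (\<lambda>_. c) (\<lambda>_. s) (split_wt M (?a - relax * (?a - ?b)) (?b + relax * (real M / real N) * (?a - ?b))) F"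
    by (rule fisher_Q[OF Q_facts Suc.prems _ quad_form[OF nn]]) (use nn in \<open>auto simp: split_wt_def\<close>)
  finally show ?case by (simp add: case_prod_beta' Let_def)
qed simp

text \<open>The chain of Fisher estimates starts and ends with cylindrical functions, so the weight
  on w is irrelevant at both ends and the constant is the first component of
  \<open>wt_iter\<close>.\<close>

theorem entropy_kac_bounded:
  fixes k :: nat
  assumes F: "0 < e" "between {..<M + N} e B F" "cylindrical M F"
  defines "KF \<equiv> reservoir_avg M {..<M + N} ((QQ ^^ k) F)"
  shows "ent {..<M + N} KF - phi (\<integral>z. KF z \<partial>gauss {..<M + N})
    \<le> (real M / real (N + M) + real N / real (N + M) * (1 - relax * real (N + M) / real N) ^ k)
       * (ent {..<M + N} F - phi (\<integral>z. F z \<partial>gauss {..<M + N}))"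
proof -
  let ?I = "{..<M + N}"
  have I: "finite ?I" and MI: "{..<M} \<subseteq> ?I" by auto
  have r: "0 \<le> real M / real N" "real M / real N \<le> 1" using MN by auto
  let ?C = "fst (wt_iter relax (real M / real N) k)"
  have C0: "0 \<le> ?C" using wt_iter_nonneg[OF relax_bounds r, of k] by auto
  have "ent ?I KF - phi (\<integral>z. KF z \<partial>gauss ?I) \<le> ?C * (ent ?I F - phi (\<integral>z. F z \<partial>gauss ?I))"
    unfolding KF_def
  proof (rule entropy_contraction[OF I, where K="\<lambda>F. reservoir_avg M ?I ((QQ ^^ k) F)" and cylindrical="cylindrical M" and p="sum wt (pairs (M + N)) ^ k"])
    show "0 < sum wt (pairs (M + N)) ^ k" using wt_sum by simp
    show "0 \<le> ?C" by fact
    show "between ?I (sum wt (pairs (M + N)) ^ k * e) B (reservoir_avg M ?I ((QQ ^^ k) F))" if "0 < e" "between ?I e B F" for F e B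
      unfolding reservoir_avg_def by (rule between_mehler[OF I between_Qpow[OF that]])
    show "reservoir_avg M ?I ((QQ ^^ k) (mehler ?I (\<lambda>_. c) (\<lambda>_. s) F)) = mehler ?I (\<lambda>_. c) (\<lambda>_. s) (reservoir_avg M ?I ((QQ ^^ k) F))"
      if "c\<^sup>2 + s\<^sup>2 = 1" "bmeas ?I F" for c s F
      using Qpow_mehler[OF that(2)] reservoir_avg_mehler[OF I MI bmeas_Qpow[OF that(2)] that(1)] by simp
    show "cylindrical M (mehler ?I (\<lambda>_. c) (\<lambda>_. s) F)" if "cylindrical M F" for c s F by (rule cylindrical_mehler[OF that MI])
    show "fisher ?I (\<lambda>_. c) (\<lambda>_. s) (\<lambda>_. 1) (reservoir_avg M ?I ((QQ ^^ k) F)) \<le> ?C * fisher ?I (\<lambda>_. c) (\<lambda>_. s) (\<lambda>_. 1) F"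
      if h: "c\<^sup>2 + s\<^sup>2 = 1" "0 < e" "between ?I e B F" "cylindrical M F" for c s F e B
    proof -
      note Qb = between_Qpow[OF h(2,3), of k]
      have Qe: "0 < sum wt (pairs (M + N)) ^ k * e" using wt_sum h by simp
      have "fisher ?I (\<lambda>_. c) (\<lambda>_. s) (\<lambda>_. 1) (reservoir_avg M ?I ((QQ ^^ k) F)) = fisher ?I (\<lambda>_. c) (\<lambda>_. s) (split_wt M 1 0) (reservoir_avg M ?I ((QQ ^^ k) F))"
        using fisher_cylindrical[OF I MI _ cylindrical_reservoir_avg[OF MI], of "(QQ ^^ k) F" "\<lambda>_. c" "\<lambda>_. s" 1 0] bmeas_mehler[OF I between_bmeas[OF I Qb]]
        by (simp add: reservoir_avg_def)
      also have "\<dots> \<le> fisher ?I (\<lambda>_. c) (\<lambda>_. s) (split_wt M 1 0) ((QQ ^^ k) F)"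
        by (rule fisher_reservoir_avg[OF I MI Qe Qb h(1)])
      also have "\<dots> \<le> fisher ?I (\<lambda>_. c) (\<lambda>_. s) (split_wt M ?C (snd (wt_iter relax (real M / real N) k))) F"
        by (rule fisher_Qpow[OF h(2,3)])
      also have "\<dots> = ?C * fisher ?I (\<lambda>_. c) (\<lambda>_. s) (\<lambda>_. 1) F"
        by (rule fisher_cylindrical[OF I MI between_bmeas[OF I h(3)] h(4)])
      finally show ?thesis .
    qed
  qed (fact F)+
  also have "?C = real M / real (N + M) + real N / real (N + M) * (1 - relax * real (N + M) / real N) ^ k"
    using wt_iter_closed(1)[of "real M / real N" "real M" "real N" relax k] MN by simp
  finally show ?thesis .
qed

end

section \<open>The iterated collision operator\<close>

lemma rot_prod_inv_cong:
  "(\<And>l. l < k \<Longrightarrow> a l = a' l) \<Longrightarrow> (\<And>l. l < k \<Longrightarrow> th l = th' l) \<Longrightarrow> rot_prod_inv k a th z = rot_prod_inv k a' th' z"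
  by (induction k arbitrary: z) auto

lemma rot_prod_inv_ext:
  "(\<And>l. l < k \<Longrightarrow> a l \<in> pairs D) \<Longrightarrow> z \<in> extensional {..<D} \<Longrightarrow> rot_prod_inv k a th z \<in> extensional {..<D}"
proof (induction k arbitrary: z)
  case (Suc k)
  have "a k \<in> pairs D" by (rule Suc) simp
  then have "rot (fst (a k)) (snd (a k)) (th k) z \<in> extensional {..<D}"
    using Suc.prems(2) by (intro rot_ext) (auto simp: pairs_def)
  with Suc show ?case by simp
qed simp

lemma measurable_rot_prod_inv:
  assumes "\<And>l. l < k \<Longrightarrow> a l \<in> pairs D" "\<And>l. l < k \<Longrightarrow> (\<lambda>x. th x l) \<in> borel_measurable L"
    and "z \<in> measurable L (PiM {..<D} (\<lambda>_. borel))"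
  shows "(\<lambda>x. rot_prod_inv k a (th x) (z x)) \<in> measurable L (PiM {..<D} (\<lambda>_. borel))"
  using assms
proof (induction k arbitrary: z)
  case (Suc k)
  have a: "fst (a k) \<in> {..<D}" "snd (a k) \<in> {..<D}" using Suc.prems(1)[of k] by (auto simp: pairs_def)
  have "(\<lambda>x. rot (fst (a k)) (snd (a k)) (th x k) (z x)) \<in> measurable L (PiM {..<D} (\<lambda>_. borel))"
    by (rule measurable_rot[OF a Suc.prems(2,3)]) simp
  with Suc show ?case by simp
qed simp

lemma distr_gauss_restrict:
  assumes "J \<subseteq> I"
  shows "distr (gauss I) (gauss J) (\<lambda>x. restrict x J) = gauss J"
  unfolding gauss_def using distr_PiM_reindex[of I "\<lambda>_. gauss1" "\<lambda>i. i" J] assms prob_space_gauss1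
  by (auto simp: restrict_def)

lemma integral_gauss_restrict:
  fixes f :: "(nat \<Rightarrow> real) \<Rightarrow> real"
  assumes J: "J \<subseteq> I" and f: "f \<in> borel_measurable (gauss J)"
  shows "(\<integral>x. f (restrict x J) \<partial>gauss I) = (\<integral>x. f x \<partial>gauss J)"
    and "integrable (gauss I) (\<lambda>x. f (restrict x J)) \<longleftrightarrow> integrable (gauss J) f"
proof -
  have m: "(\<lambda>x. restrict x J) \<in> measurable (gauss I) (gauss J)"
    unfolding gauss_def by (rule measurable_restrict_subset[OF J])
  show "(\<integral>x. f (restrict x J) \<partial>gauss I) = (\<integral>x. f x \<partial>gauss J)"
    using integral_distr[OF m f] by (simp add: distr_gauss_restrict[OF J])
  show "integrable (gauss I) (\<lambda>x. f (restrict x J)) \<longleftrightarrow> integrable (gauss J) f"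
    using integrable_distr_eq[OF m f] by (simp add: distr_gauss_restrict[OF J])
qed

text \<open>The last index is split off because \<open>rot_prod_inv\<close> applies the rotation
  with the largest index to the point first.\<close>

lemma sum_PiE_Suc:
  fixes f :: "(nat \<Rightarrow> 'a) \<Rightarrow> real"
  assumes "finite P"
  shows "(\<Sum>a\<in>PiE {..<Suc k} (\<lambda>_. P). f a) = (\<Sum>b\<in>P. \<Sum>a\<in>PiE {..<k} (\<lambda>_. P). f (a(k := b)))"
proof -
  have "(\<Sum>b\<in>P. \<Sum>a\<in>PiE {..<k} (\<lambda>_. P). f (a(k := b))) = (\<Sum>p\<in>P \<times> PiE {..<k} (\<lambda>_. P). f ((snd p)(k := fst p)))"
    by (simp add: sum.cartesian_product case_prod_beta')
  also have "\<dots> = (\<Sum>a\<in>PiE {..<Suc k} (\<lambda>_. P). f a)"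
  proof (rule sum.reindex_bij_witness[of _ "\<lambda>a. (a k, restrict a {..<k})" "\<lambda>p. (snd p)(k := fst p)"])
    fix p assume p: "p \<in> P \<times> PiE {..<k} (\<lambda>_. P)"
    then show "(((snd p)(k := fst p)) k, restrict ((snd p)(k := fst p)) {..<k}) = p"
      by (cases p) (auto simp: PiE_def extensional_def fun_eq_iff)
    show "(snd p)(k := fst p) \<in> PiE {..<Suc k} (\<lambda>_. P)"
      using p by (auto simp: PiE_def extensional_def Pi_def less_Suc_eq)
  next
    fix a assume a: "a \<in> PiE {..<Suc k} (\<lambda>_. P)"
    then show "(snd (a k, restrict a {..<k}))(k := fst (a k, restrict a {..<k})) = a"
      by (auto simp: PiE_def extensional_def fun_eq_iff less_Suc_eq)
    show "(a k, restrict a {..<k}) \<in> P \<times> PiE {..<k} (\<lambda>_. P)"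
      using a by (auto simp: PiE_def Pi_def)
  qed simp
  finally show ?thesis ..
qed

section \<open>The law of the angles and the expansion of the powers of Q\<close>

context
  fixes M N :: nat and lS lR mu :: real and \<rho> :: "real \<Rightarrow> real"
  assumes MN: "1 \<le> M" "M \<le> N" and pos: "0 < lS" "0 < lR" "0 < mu"
    and rho: "\<forall>th\<in>{-pi..pi}. 0 \<le> \<rho> th" "set_integrable lborel {-pi..pi} \<rho>" "(LINT th:{-pi..pi}|lborel. \<rho> th) = 1"
    and sc: "(LINT th:{-pi..pi}|lborel. \<rho> th * sin th * cos th) = 0"
begin

text \<open>The density extended by zero to the line; it makes the angle law a probability measure
  on all of R, as the collision operator expects.\<close>

definition rho' :: "real \<Rightarrow> real" where "rho' th = indicator {-pi..pi} th * \<rho> th"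
definition angle :: "real measure" where "angle = density lborel (\<lambda>th. ennreal (rho' th))"
definition angles :: "nat \<Rightarrow> (nat \<Rightarrow> real) measure" where "angles k = PiM {..<k} (\<lambda>_. angle)"

lemma rho'_nonneg: "0 \<le> rho' th"
  using rho(1) by (auto simp: rho'_def indicator_def)

lemma rho'_integrable: "integrable lborel rho'" and rho'_integral: "(\<integral>th. rho' th \<partial>lborel) = 1"
  using rho(2,3) by (simp_all add: rho'_def[abs_def] set_integrable_def set_lebesgue_integral_def)

lemma rho'_measurable [measurable]: "rho' \<in> borel_measurable borel"
  using rho'_integrable by simp

lemma R_sets [simp]: "sets angle = sets borel" and R_space [simp]: "space angle = UNIV"
  by (simp_all add: angle_def)

lemma R_prob: "prob_space angle"
proof (rule prob_spaceI)
  have "emeasure angle (space angle) = (\<integral>\<^sup>+th. ennreal (rho' th) \<partial>lborel)"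
    unfolding angle_def by (simp add: emeasure_density)
  also have "\<dots> = ennreal 1"
    using nn_integral_eq_integral[OF rho'_integrable] rho'_nonneg rho'_integral by simp
  finally show "emeasure angle (space angle) = 1" by simp
qed

interpretation angle: prob_space angle by (rule R_prob)
interpretation anglesP: product_sigma_finite "\<lambda>_::nat. angle" ..

lemma RP_prob: "prob_space (angles k)"
  unfolding angles_def by (rule prob_space_PiM) (rule R_prob)

interpretation angles: prob_space "angles k" for k by (rule RP_prob)

lemma integral_R:
  assumes [measurable]: "f \<in> borel_measurable borel"
  shows "(\<integral>th. f th \<partial>angle) = (LINT th:{-pi..pi}|lborel. \<rho> th * f th)"
proof -
  have "(\<integral>th. f th \<partial>angle) = (\<integral>th. rho' th * f th \<partial>lborel)"
    unfolding angle_def using rho'_nonneg by (subst integral_density) auto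
  then show ?thesis by (simp add: rho'_def set_lebesgue_integral_def mult.assoc)
qed

lemma R_sc: "(\<integral>th. sin th * cos th \<partial>angle) = 0"
  using integral_R[of "\<lambda>th. sin th * cos th"] sc by (simp add: mult.assoc)

lemmas K_facts = MN pos R_prob R_sets R_sc

lemma RP_density: "angles k = density (PiM {..<k} (\<lambda>_. lborel)) (\<lambda>th. ennreal (\<Prod>l<k. rho' (th l)))"
proof -
  have "angles k = density (PiM {..<k} (\<lambda>_. lborel)) (\<lambda>th. \<Prod>l<k. ennreal (rho' (th l)))"
    unfolding angles_def angle_def
  proof (rule PiM_density[symmetric, OF _ product_sigma_finite_lborel])
    show "product_sigma_finite (\<lambda>_::nat. density lborel (\<lambda>x. ennreal (rho' x)))"
      unfolding angle_def[symmetric] ..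
  qed auto
  then show ?thesis using rho'_nonneg by (simp add: prod_ennreal)
qed

lemma sets_RP: "sets (angles k) = sets (PiM {..<k} (\<lambda>_. borel))"
  unfolding angles_def by (rule sets_PiM_cong) auto

lemma coord_RP: "l < k \<Longrightarrow> (\<lambda>th. th l) \<in> borel_measurable (angles k)"
  unfolding measurable_cong_sets[OF sets_RP refl] by measurable

lemma integral_RP:
  assumes f: "f \<in> borel_measurable (angles k)"
  shows "(\<integral>th. (\<Prod>l<k. indicator {-pi..pi} (th l) * \<rho> (th l)) * f th \<partial>PiM {..<k} (\<lambda>_. lborel)) = (\<integral>th. f th \<partial>angles k :: real)"
proof -
  have e: "sets (angles k) = sets (PiM {..<k} (\<lambda>_. lborel :: real measure))"
    unfolding angles_def by (rule sets_PiM_cong) auto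
  have [measurable]: "f \<in> borel_measurable (PiM {..<k} (\<lambda>_. lborel))"
    using f by (simp add: measurable_cong_sets[OF e refl])
  show ?thesis
    unfolding RP_density by (subst integral_density) (auto simp: rho'_nonneg prod_nonneg rho'_def[symmetric])
qed

abbreviation (input) "DD \<equiv> {..<M + N}"
abbreviation (input) "PP \<equiv> pairs (M + N)"
abbreviation (input) "ww \<equiv> lam M N lS lR mu"
abbreviation (input) "AA k \<equiv> PiE {..<k} (\<lambda>_. PP)"
abbreviation (input) "mx \<equiv> mix DD (split_wt M 1 0) (split_wt M 0 1)"
abbreviation (input) "QR \<equiv> Qop PP ww angle"

lemma AA_pairs: "a \<in> AA k \<Longrightarrow> l < k \<Longrightarrow> a l \<in> PP"
  by (auto simp: PiE_def Pi_def)

lemma measurable_T: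
  assumes a: "a \<in> AA k" and z: "z \<in> measurable L (PiM DD (\<lambda>_. borel))" and th: "th \<in> measurable L (angles k)"
    and F: "F \<in> borel_measurable (PiM DD (\<lambda>_. borel))"
  shows "(\<lambda>x. F (rot_prod_inv k a (th x) (z x))) \<in> borel_measurable L"
proof (rule measurable_compose[OF measurable_rot_prod_inv F])
  show "(\<lambda>x. th x l) \<in> borel_measurable L" if "l < k" for l
    by (rule measurable_compose[OF th coord_RP[OF that]])
qed (use AA_pairs[OF a] z in auto)

text \<open>The rotation with index k acts on z first, so it corresponds to the outermost factor of
  Q. Boundedness of F allows the angle t to be moved outside the other k angles by Fubini.\<close>

lemma Qpow_eq:
  assumes F: "bmeas DD F" and z: "z \<in> extensional DD"
  shows "(QR ^^ k) F z = (\<Sum>a\<in>AA k. (\<Prod>l<k. ww (a l)) * (\<integral>th. F (rot_prod_inv k a th z) \<partial>angles k))"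
  using z
proof (induction k arbitrary: z)
  case 0
  \<comment> \<open>With no angles left, the product measure is a unit point mass.\<close>
  then show ?case by (simp add: angles_def PiM_empty integral_count_space_nat lebesgue_integral_count_space_finite)
next
  case (Suc k)
  from F obtain B where B: "\<forall>z\<in>extensional DD. \<bar>F z\<bar> \<le> B" and Fm: "F \<in> borel_measurable (PiM DD (\<lambda>_. borel))"
    by (auto simp: bmeas_def)
  have main: "(\<integral>th. F (rot_prod_inv (Suc k) (a(k := b)) th z) \<partial>angles (Suc k))
     = (\<integral>t. \<integral>th. F (rot_prod_inv k a th (rot (fst b) (snd b) t z)) \<partial>angles k \<partial>angle)"
    and int: "integrable angle (\<lambda>t. \<integral>th. F (rot_prod_inv k a th (rot (fst b) (snd b) t z)) \<partial>angles k)"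
    if a: "a \<in> AA k" and b: "b \<in> PP" for a b
  proof -
    have a': "a(k := b) \<in> AA (Suc k)" using a b by (auto simp: PiE_def extensional_def Pi_def less_Suc_eq)
    have re: "rot (fst b) (snd b) t z \<in> extensional DD" for t
      using b Suc.prems by (intro rot_ext) (auto simp: pairs_def)
    have Bd: "\<bar>F (rot_prod_inv k a th (rot (fst b) (snd b) t z))\<bar> \<le> B" for th t
    proof -
      have "rot_prod_inv k a th (rot (fst b) (snd b) t z) \<in> extensional DD"
        by (rule rot_prod_inv_ext[OF _ re]) (rule AA_pairs[OF a])
      with B show ?thesis by blast
    qed
    have mz: "(\<lambda>_. z) \<in> measurable L (PiM DD (\<lambda>_. borel :: real measure))" for L :: "'x measure"
      using Suc.prems by (intro measurable_const) simp
    have m: "(\<lambda>th. F (rot_prod_inv (Suc k) (a(k := b)) th z)) \<in> borel_measurable (angles (Suc k))"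
      by (rule measurable_T[OF a' mz _ Fm]) simp
    have "integrable (angles (Suc k)) (\<lambda>th. F (rot_prod_inv (Suc k) (a(k := b)) th z))"
    proof (rule angles.integrable_const_bound[of _ B, OF _ m], rule AE_I2)
      fix th :: "nat \<Rightarrow> real"
      have "rot_prod_inv (Suc k) (a(k := b)) th z \<in> extensional DD"
        by (rule rot_prod_inv_ext[OF _ Suc.prems]) (rule AA_pairs[OF a'])
      with B show "norm (F (rot_prod_inv (Suc k) (a(k := b)) th z)) \<le> B" by (simp del: rot_prod_inv.simps)
    qed
    then have "(\<integral>th. F (rot_prod_inv (Suc k) (a(k := b)) th z) \<partial>angles (Suc k))
      = (\<integral>th. \<integral>t. F (rot_prod_inv (Suc k) (a(k := b)) (th(k := t)) z) \<partial>angle \<partial>angles k)"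
      unfolding angles_def lessThan_Suc by (intro anglesP.product_integral_insert) auto
    also have "\<dots> = (\<integral>th. \<integral>t. F (rot_prod_inv k a th (rot (fst b) (snd b) t z)) \<partial>angle \<partial>angles k)"
      using rot_prod_inv_cong[of k "a(k := b)" a] by (simp add: rot_prod_inv_cong[of k "a(k := b)" a "_(k := _)"])
    finally have 1: "(\<integral>th. F (rot_prod_inv (Suc k) (a(k := b)) th z) \<partial>angles (Suc k))
      = (\<integral>th. \<integral>t. F (rot_prod_inv k a th (rot (fst b) (snd b) t z)) \<partial>angle \<partial>angles k)" .
    have "(\<lambda>p. F (rot_prod_inv k a (fst p) (rot (fst b) (snd b) (snd p) z))) \<in> borel_measurable (angles k \<Otimes>\<^sub>M angle)"
    proof (rule measurable_T[OF a _ measurable_fst Fm], rule measurable_rot)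
      show "snd \<in> borel_measurable (angles k \<Otimes>\<^sub>M angle)"
        using measurable_snd[of "angles k" angle] by (simp add: measurable_cong_sets[OF refl R_sets])
    qed (use b mz in \<open>auto simp: pairs_def\<close>)
    note f = Fubini_bounded[OF RP_prob R_prob, of "\<lambda>th t. F (rot_prod_inv k a th (rot (fst b) (snd b) t z))" k B]
    show "integrable angle (\<lambda>t. \<integral>th. F (rot_prod_inv k a th (rot (fst b) (snd b) t z)) \<partial>angles k)"
      using f(3) Bd \<open>_ \<in> borel_measurable (angles k \<Otimes>\<^sub>M angle)\<close> by (simp add: case_prod_beta')
    show "(\<integral>th. F (rot_prod_inv (Suc k) (a(k := b)) th z) \<partial>angles (Suc k))
     = (\<integral>t. \<integral>th. F (rot_prod_inv k a th (rot (fst b) (snd b) t z)) \<partial>angles k \<partial>angle)"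
      unfolding 1 using f(1) Bd \<open>_ \<in> borel_measurable (angles k \<Otimes>\<^sub>M angle)\<close> by (simp add: case_prod_beta')
  qed
  have "(QR ^^ Suc k) F z = (\<Sum>b\<in>PP. ww b * (\<integral>t. (\<Sum>a\<in>AA k. (\<Prod>l<k. ww (a l)) * (\<integral>th. F (rot_prod_inv k a th (rot (fst b) (snd b) t z)) \<partial>angles k)) \<partial>angle))"
    unfolding funpow.simps comp_apply Qop_def[of PP ww angle "(QR ^^ k) F"]
  proof (intro sum.cong refl arg_cong2[where f="(*)"] Bochner_Integration.integral_cong)
    fix b t assume "b \<in> PP"
    then have "rot (fst b) (snd b) t z \<in> extensional DD"
      using Suc.prems by (intro rot_ext) (auto simp: pairs_def)
    then show "(QR ^^ k) F (rot (fst b) (snd b) t z) = (\<Sum>a\<in>AA k. (\<Prod>l<k. ww (a l)) * (\<integral>th. F (rot_prod_inv k a th (rot (fst b) (snd b) t z)) \<partial>angles k))"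
      by (rule Suc.IH)
  qed
  also have "\<dots> = (\<Sum>b\<in>PP. ww b * (\<Sum>a\<in>AA k. (\<Prod>l<k. ww (a l)) * (\<integral>th. F (rot_prod_inv (Suc k) (a(k := b)) th z) \<partial>angles (Suc k))))"
    using int by (intro sum.cong refl arg_cong2[where f="(*)"])
      (subst Bochner_Integration.integral_sum; auto simp: main intro!: sum.cong simp del: rot_prod_inv.simps)
  also have "\<dots> = (\<Sum>a\<in>AA (Suc k). (\<Prod>l<Suc k. ww (a l)) * (\<integral>th. F (rot_prod_inv (Suc k) a th z) \<partial>angles (Suc k)))"
    unfolding sum_PiE_Suc[OF finite_pairs] sum_distrib_left
    by (intro sum.cong refl) (simp add: mult_ac del: rot_prod_inv.simps)
  finally show ?case .
qed

section \<open>The functions h_k in operator form, and their approximation\<close>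

definition lift :: "((nat \<Rightarrow> real) \<Rightarrow> real) \<Rightarrow> (nat \<Rightarrow> real) \<Rightarrow> real" where
  "lift h z = h (restrict z {..<M})"

lemma measurable_lift:
  assumes "h \<in> borel_measurable (PiM {..<M} (\<lambda>_. borel))"
  shows "lift h \<in> borel_measurable (PiM DD (\<lambda>_. borel))"
  unfolding lift_def[abs_def]
  by (rule measurable_compose[OF measurable_restrict_subset assms]) simp

lemma mx_measurable:
  assumes "t \<in> measurable L (gauss DD)"
  shows "(\<lambda>x. mx v (t x)) \<in> measurable L (PiM DD (\<lambda>_. borel))"
proof -
  have "(\<lambda>x. mx (restrict v DD) (t x)) \<in> measurable L (PiM DD (\<lambda>_. borel))"
    by (rule measurable_mix) (use assms in \<open>auto intro!: measurable_const simp: measurable_cong_sets[OF refl sets_gauss]\<close>)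
  then show ?thesis by simp
qed

text \<open>The reservoir integral is rewritten over all M + N coordinates; \<open>mix\<close>
  discards the extra first M of them. This is the bridge from the literal definition to the Gaussian
  operators, valid for unbounded data as well.\<close>

lemma hk_eq:
  assumes h: "h \<in> borel_measurable (PiM {..<M} (\<lambda>_. borel))"
  shows "hk M N lS lR mu \<rho> h k v
    = (\<Sum>a\<in>AA k. (\<Prod>l<k. ww (a l)) * (\<integral>th. \<integral>t. lift h (rot_prod_inv k a th (mx v t)) \<partial>gauss DD \<partial>angles k))"
  unfolding hk_def
proof (intro sum.cong refl arg_cong2[where f="(*)"])
  fix a assume a: "a \<in> AA k"
  let ?J = "{M..<M + N}"
  have inner: "(\<integral>w. h (restrict (rot_prod_inv k a th (\<lambda>i. if i < M then v i else w i)) {..<M}) * gauss_w ?J w \<partial>PiM ?J (\<lambda>_. lborel))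
      = (\<integral>t. lift h (rot_prod_inv k a th (mx v t)) \<partial>gauss DD)" for th
  proof -
    let ?v = "\<lambda>w i. if i < M then v i else w i"
    let ?g = "\<lambda>w. lift h (rot_prod_inv k a th (mx v w))"
    have mv: "(\<lambda>w. mx v w) = (\<lambda>w. \<lambda>i\<in>DD. if i < M then v i else w i)"
      by (auto simp: mix_def split_wt_def fun_eq_iff)
    have "(\<lambda>w. mx v w) \<in> measurable (PiM ?J (\<lambda>_. borel)) (PiM DD (\<lambda>_. borel :: real measure))"
      unfolding mv
    proof (rule measurable_restrict)
      fix i assume "i \<in> DD"
      then show "(\<lambda>w. if i < M then v i else w i) \<in> borel_measurable (PiM ?J (\<lambda>_. borel))"
        by (cases "i < M") auto
    qed
    then have gm: "?g \<in> borel_measurable (PiM ?J (\<lambda>_. borel))"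
      by (intro measurable_compose[OF measurable_rot_prod_inv[where th="\<lambda>_. th"] measurable_lift[OF h]])
         (use AA_pairs[OF a] in auto)
    have "(\<integral>w. h (restrict (rot_prod_inv k a th (?v w)) {..<M}) * gauss_w ?J w \<partial>PiM ?J (\<lambda>_. lborel))
       = (\<integral>w. ?g w * gauss_w ?J w \<partial>PiM ?J (\<lambda>_. lborel))"
    proof (rule Bochner_Integration.integral_cong[OF refl])
      fix w :: "nat \<Rightarrow> real" assume "w \<in> space (PiM ?J (\<lambda>_. lborel))"
      then have "w \<in> extensional ?J" by (simp add: space_PiM PiE_def)
      \<comment> \<open>Off the M + N coordinates both sides are \<open>undefined\<close>, the left
        one because w is extensional.\<close>
      then have "?v w = mx v w" by (auto simp: mix_def split_wt_def fun_eq_iff extensional_def)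
      then show "h (restrict (rot_prod_inv k a th (?v w)) {..<M}) * gauss_w ?J w = ?g w * gauss_w ?J w"
        by (simp add: lift_def)
    qed
    also have "\<dots> = (\<integral>w. ?g w \<partial>gauss ?J)" by (rule integral_gauss(1)[OF _ gm]) simp
    also have "\<dots> = (\<integral>t. ?g (restrict t ?J) \<partial>gauss DD)"
      by (rule integral_gauss_restrict(1)[symmetric]) (use gm in \<open>auto simp: measurable_PiM_gauss\<close>)
    also have "\<dots> = (\<integral>t. ?g t \<partial>gauss DD)"
    proof -
      have "mx v (restrict t ?J) = mx v t" for t by (auto simp: mix_def split_wt_def fun_eq_iff)
      then show ?thesis by simp
    qed
    finally show ?thesis .
  qed
  show "(\<integral>th. (\<Prod>l<k. indicator {-pi..pi} (th l) * \<rho> (th l)) *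
          (\<integral>w. h (restrict (rot_prod_inv k a th (\<lambda>i. if i < M then v i else w i)) {..<M}) * gauss_w ?J w \<partial>PiM ?J (\<lambda>_. lborel))
        \<partial>PiM {..<k} (\<lambda>_. lborel)) = (\<integral>th. \<integral>t. lift h (rot_prod_inv k a th (mx v t)) \<partial>gauss DD \<partial>angles k)"
    unfolding inner
  proof (rule integral_RP, rule gauss.borel_measurable_lebesgue_integral)
    show "(\<lambda>(th, t). lift h (rot_prod_inv k a th (mx v t))) \<in> borel_measurable (angles k \<Otimes>\<^sub>M gauss DD)"
      unfolding case_prod_beta'
      by (rule measurable_T[OF a mx_measurable[OF measurable_snd] measurable_fst measurable_lift[OF h]])
  qed
qed


lemma cylindrical_lift: "cylindrical M (lift h)"
  unfolding cylindrical_def lift_def by (metis (no_types, lifting) lessThan_iff restrict_ext)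

lemma between_lift: "between {..<M} e B h \<Longrightarrow> between DD e B (lift h)"
  unfolding between_def using measurable_lift by (auto simp: lift_def)

text \<open>The definition integrates the reservoir inside the angles, the operator form does the
  opposite; for bounded data Fubini exchanges them.\<close>

lemma hk_bounded:
  assumes h: "between {..<M} e B h"
  shows "hk M N lS lR mu \<rho> h k v = reservoir_avg M DD ((QR ^^ k) (lift h)) v"
proof -
  have hm: "h \<in> borel_measurable (PiM {..<M} (\<lambda>_. borel))" by (rule between_measurable[OF h])
  note L = between_lift[OF h]
  note Lm = between_bmeas[OF _ L, simplified]
  have Bd: "\<bar>lift h (rot_prod_inv k a th (mx v t))\<bar> \<le> \<bar>e\<bar> + \<bar>B\<bar>" if a: "a \<in> AA k" for a th t
  proof -
    have "rot_prod_inv k a th (mx v t) \<in> extensional DD"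
      by (rule rot_prod_inv_ext[OF AA_pairs[OF a]]) auto
    from between_range[OF L this] show ?thesis by linarith
  qed
  have m: "(\<lambda>p. lift h (rot_prod_inv k a (fst p) (mx v (snd p)))) \<in> borel_measurable (angles k \<Otimes>\<^sub>M gauss DD)" if "a \<in> AA k" for a
    by (rule measurable_T[OF that mx_measurable[OF measurable_snd] measurable_fst measurable_lift[OF hm]])
  have fub: "(\<integral>th. \<integral>t. lift h (rot_prod_inv k a th (mx v t)) \<partial>gauss DD \<partial>angles k) = (\<integral>t. \<integral>th. lift h (rot_prod_inv k a th (mx v t)) \<partial>angles k \<partial>gauss DD)"
    and int: "integrable (gauss DD) (\<lambda>t. \<integral>th. lift h (rot_prod_inv k a th (mx v t)) \<partial>angles k)" if a: "a \<in> AA k" for a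
    using Fubini_bounded[OF RP_prob prob_space_gauss, of "\<lambda>th t. lift h (rot_prod_inv k a th (mx v t))" k DD "\<bar>e\<bar> + \<bar>B\<bar>"] m[OF a] Bd[OF a]
    by (simp_all add: case_prod_beta')
  have "reservoir_avg M DD ((QR ^^ k) (lift h)) v
     = (\<integral>t. (\<Sum>a\<in>AA k. (\<Prod>l<k. ww (a l)) * (\<integral>th. lift h (rot_prod_inv k a th (mx v t)) \<partial>angles k)) \<partial>gauss DD)"
    unfolding reservoir_avg_def mehler_def by (intro Bochner_Integration.integral_cong refl Qpow_eq[OF Lm]) simp
  also have "\<dots> = (\<Sum>a\<in>AA k. (\<Prod>l<k. ww (a l)) * (\<integral>t. \<integral>th. lift h (rot_prod_inv k a th (mx v t)) \<partial>angles k \<partial>gauss DD))"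
    using int by (subst Bochner_Integration.integral_sum) auto
  also have "\<dots> = hk M N lS lR mu \<rho> h k v"
    unfolding hk_eq[OF hm] by (intro sum.cong refl) (simp add: fub)
  finally show ?thesis ..
qed

lemma nn_integral_T:
  assumes a: "\<And>l. l < k \<Longrightarrow> a l \<in> PP" and G: "G \<in> borel_measurable (gauss DD)"
  shows "(\<integral>\<^sup>+z. G (rot_prod_inv k a th z) \<partial>gauss DD) = (\<integral>\<^sup>+z. G z \<partial>gauss DD)"
  using a
proof (induction k)
  case (Suc k)
  have b: "fst (a k) \<in> DD" "snd (a k) \<in> DD" "fst (a k) \<noteq> snd (a k)" using Suc.prems[of k] by (auto simp: pairs_def)
  have "(\<lambda>z. rot_prod_inv k a th z) \<in> measurable (gauss DD) (PiM DD (\<lambda>_. borel))"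
    by (rule measurable_rot_prod_inv[where th="\<lambda>_. th"]) (use Suc.prems in \<open>auto simp: measurable_cong_sets[OF sets_gauss refl]\<close>)
  then have "(\<lambda>z. G (rot_prod_inv k a th z)) \<in> borel_measurable (gauss DD)"
    by (rule measurable_compose) (use G in \<open>simp add: measurable_cong_sets[OF sets_gauss refl]\<close>)
  from nn_integral_gauss_rot[OF _ b this, of "th k"] Suc show ?case by simp
qed simp

text \<open>By Tonelli the total mass over z, angles and reservoir equals the Gaussian integral of
  the lifted datum, since resampling and rotations preserve the measure. Finiteness of the total
  gives integrability for almost every z.\<close>

lemma integrable_section:
  assumes h: "h \<in> borel_measurable (PiM {..<M} (\<lambda>_. borel))" "integrable (gauss {..<M}) h" "\<And>v. v \<in> extensional {..<M} \<Longrightarrow> 0 \<le> h v"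
    and a: "a \<in> AA k"
  shows "AE z in gauss DD. integrable (angles k \<Otimes>\<^sub>M gauss DD) (\<lambda>p. lift h (rot_prod_inv k a (fst p) (mx z (snd p))))"
proof -
  let ?B = "angles k \<Otimes>\<^sub>M gauss DD"
  interpret B: prob_space ?B by (intro prob_space_pair RP_prob prob_space_gauss)
  interpret P: pair_sigma_finite "gauss DD" ?B ..
  interpret P2: pair_sigma_finite "gauss DD" "angles k" ..
  note Lm = measurable_lift[OF h(1)]
  let ?f = "\<lambda>q. lift h (rot_prod_inv k a (fst (snd q)) (mx (fst q) (snd (snd q))))"
  have mxm: "(\<lambda>x. mx (u x) (t x)) \<in> measurable L (PiM DD (\<lambda>_. borel))"
    if "u \<in> measurable L (gauss DD)" "t \<in> measurable L (gauss DD)" for u t and L :: "'x measure"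
    using that by (intro measurable_mix) (simp_all add: measurable_cong_sets[OF refl sets_gauss])
  have m: "?f \<in> borel_measurable (gauss DD \<Otimes>\<^sub>M ?B)"
    by (rule measurable_T[OF a mxm _ Lm]) measurable
  have m2: "(\<lambda>q. lift h (rot_prod_inv k a (snd (fst q)) (mx (fst (fst q)) (snd q)))) \<in> borel_measurable ((gauss DD \<Otimes>\<^sub>M angles k) \<Otimes>\<^sub>M gauss DD)"
    by (rule measurable_T[OF a mxm _ Lm]) measurable
  have nn: "0 \<le> lift h x" for x by (simp add: lift_def h(3))
  have "(\<integral>\<^sup>+q. ennreal (?f q) \<partial>(gauss DD \<Otimes>\<^sub>M ?B)) = (\<integral>\<^sup>+z. \<integral>\<^sup>+th. \<integral>\<^sup>+t. ennreal (lift h (rot_prod_inv k a th (mx z t))) \<partial>gauss DD \<partial>angles k \<partial>gauss DD)"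
  proof -
    have "(\<integral>\<^sup>+q. ennreal (?f q) \<partial>(gauss DD \<Otimes>\<^sub>M ?B)) = (\<integral>\<^sup>+z. \<integral>\<^sup>+p. ennreal (?f (z, p)) \<partial>?B \<partial>gauss DD)"
      by (subst B.nn_integral_fst) (use m in auto)
    also have "\<dots> = (\<integral>\<^sup>+z. \<integral>\<^sup>+th. \<integral>\<^sup>+t. ennreal (lift h (rot_prod_inv k a th (mx z t))) \<partial>gauss DD \<partial>angles k \<partial>gauss DD)"
    proof (rule nn_integral_cong)
      fix z assume z: "z \<in> space (gauss DD)"
      have "(\<lambda>p. ?f (z, p)) \<in> borel_measurable ?B" by (rule measurable_compose[OF measurable_Pair1'[OF z] m])
      then show "(\<integral>\<^sup>+p. ennreal (?f (z, p)) \<partial>?B) = (\<integral>\<^sup>+th. \<integral>\<^sup>+t. ennreal (lift h (rot_prod_inv k a th (mx z t))) \<partial>gauss DD \<partial>angles k)"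
        by (subst gauss.nn_integral_fst[symmetric]) auto
    qed
    finally show ?thesis .
  qed
  also have "\<dots> = (\<integral>\<^sup>+th. \<integral>\<^sup>+z. \<integral>\<^sup>+t. ennreal (lift h (rot_prod_inv k a th (mx z t))) \<partial>gauss DD \<partial>gauss DD \<partial>angles k)"
  proof (rule P2.Fubini'[symmetric])
    show "(\<lambda>(z, th). \<integral>\<^sup>+t. ennreal (lift h (rot_prod_inv k a th (mx z t))) \<partial>gauss DD) \<in> borel_measurable (gauss DD \<Otimes>\<^sub>M angles k)"
      unfolding case_prod_beta'
      by (rule gauss.borel_measurable_nn_integral) (use m2 in \<open>simp add: case_prod_beta'\<close>)
  qed
  also have "\<dots> = (\<integral>\<^sup>+th. (\<integral>\<^sup>+z. ennreal (lift h z) \<partial>gauss DD) \<partial>angles k)"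
  proof (rule nn_integral_cong)
    fix th assume "th \<in> space (angles k)"
    let ?H = "\<lambda>z. ennreal (lift h (rot_prod_inv k a th z))"
    have mT: "(\<lambda>z. lift h (rot_prod_inv k a th z)) \<in> borel_measurable (PiM DD (\<lambda>_. borel))"
      by (rule measurable_compose[OF measurable_rot_prod_inv[where th="\<lambda>_. th"] Lm]) (use AA_pairs[OF a] in auto)
    then have Hm: "?H \<in> borel_measurable (gauss DD)" by (simp add: measurable_PiM_gauss)
    have mm: "(\<lambda>p. mx (fst p) (snd p)) \<in> measurable (gauss DD \<Otimes>\<^sub>M gauss DD) (gauss DD)"
      using mxm[of fst "gauss DD \<Otimes>\<^sub>M gauss DD" snd] by (simp add: measurable_cong_sets[OF refl sets_gauss])
    have d: "distr (gauss DD \<Otimes>\<^sub>M gauss DD) (gauss DD) (\<lambda>p. mx (fst p) (snd p)) = gauss DD"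
      using distr_mix[of DD "split_wt M 1 0" "split_wt M 0 1"] by (simp add: case_prod_beta' split_wt_def)
    have "(\<integral>\<^sup>+z. \<integral>\<^sup>+t. ?H (mx z t) \<partial>gauss DD \<partial>gauss DD) = (\<integral>\<^sup>+p. ?H (mx (fst p) (snd p)) \<partial>(gauss DD \<Otimes>\<^sub>M gauss DD))"
      using measurable_compose[OF mm Hm] by (subst gauss.nn_integral_fst[symmetric]) auto
    also have "\<dots> = (\<integral>\<^sup>+z. ?H z \<partial>gauss DD)"
      using nn_integral_distr[OF mm, of ?H] Hm by (simp add: d)
    also have "\<dots> = (\<integral>\<^sup>+z. ennreal (lift h z) \<partial>gauss DD)"
      by (rule nn_integral_T[OF AA_pairs[OF a], where G="\<lambda>z. ennreal (lift h z)"]) (use Lm in \<open>simp_all add: measurable_PiM_gauss\<close>)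
    finally show "(\<integral>\<^sup>+z. \<integral>\<^sup>+t. ?H (mx z t) \<partial>gauss DD \<partial>gauss DD) = (\<integral>\<^sup>+z. ennreal (lift h z) \<partial>gauss DD)" .
  qed
  also have "\<dots> < \<infinity>"
  proof -
    have "integrable (gauss DD) (lift h)"
      unfolding lift_def[abs_def] using integral_gauss_restrict(2)[of "{..<M}" DD h] h(1,2) by (simp add: measurable_PiM_gauss)
    from integrableD(2)[OF this] nn show ?thesis by (simp add: angles.emeasure_space_1 less_top)
  qed
  finally have "integrable (gauss DD \<Otimes>\<^sub>M ?B) ?f"
    by (intro integrableI_bounded m) (simp add: nn)
  from P.AE_integrable_fst'[OF this] show ?thesis by simp
qed

text \<open>Dominated convergence with h + 1 at each z where all sections are integrable; there are
  finitely many choices of pairs, so the exceptional sets still form a null set.\<close>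

lemma hk_tendsto:
  assumes h: "h \<in> borel_measurable (PiM {..<M} (\<lambda>_. borel))" "integrable (gauss {..<M}) h" "\<And>v. v \<in> extensional {..<M} \<Longrightarrow> 0 \<le> h v"
    and hn: "\<And>n. hn n \<in> borel_measurable (PiM {..<M} (\<lambda>_. borel))"
    and lim: "\<And>v. v \<in> extensional {..<M} \<Longrightarrow> (\<lambda>n. hn n v) \<longlonglongrightarrow> h v"
    and dom: "\<And>n v. v \<in> extensional {..<M} \<Longrightarrow> \<bar>hn n v\<bar> \<le> h v + 1"
  shows "AE z in gauss DD. (\<lambda>n. hk M N lS lR mu \<rho> (hn n) k z) \<longlonglongrightarrow> hk M N lS lR mu \<rho> h k z"
proof -
  have fin: "finite (AA k)" by (intro finite_PiE finite_pairs) simp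
  have "AE z in gauss DD. \<forall>a\<in>AA k. integrable (angles k \<Otimes>\<^sub>M gauss DD) (\<lambda>p. lift h (rot_prod_inv k a (fst p) (mx z (snd p))))"
    using integrable_section[OF h] by (intro AE_finite_allI[OF fin]) auto
  then show ?thesis
  proof eventually_elim
    case (elim z)
    let ?B = "angles k \<Otimes>\<^sub>M gauss DD"
    interpret B: prob_space ?B by (intro prob_space_pair RP_prob prob_space_gauss)
    interpret P: pair_sigma_finite "angles k" "gauss DD" ..
    let ?T = "\<lambda>a p. rot_prod_inv k a (fst p) (mx z (snd p))"
    have m: "(\<lambda>p. lift g (?T a p)) \<in> borel_measurable ?B"
      if "g \<in> borel_measurable (PiM {..<M} (\<lambda>_. borel))" "a \<in> AA k" for a g
      by (rule measurable_T[OF that(2) mx_measurable[OF measurable_snd] measurable_fst measurable_lift[OF that(1)]])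
    have i1: "integrable ?B (\<lambda>p. lift h (?T a p) + 1)" if "a \<in> AA k" for a using elim that by simp
    have i2: "integrable ?B (\<lambda>p. lift (hn n) (?T a p))" if "a \<in> AA k" for a n
      by (rule Bochner_Integration.integrable_bound[OF i1[OF that] m[OF hn that]])
         (use dom h(3) in \<open>auto simp: lift_def intro!: AE_I2\<close>)
    have "(\<lambda>n. \<integral>p. lift (hn n) (?T a p) \<partial>?B) \<longlonglongrightarrow> (\<integral>p. lift h (?T a p) \<partial>?B)" if a: "a \<in> AA k" for a
    proof (rule integral_dominated_convergence[OF m[OF h(1) a] m[OF hn a] i1[OF a]])
      show "AE p in ?B. (\<lambda>n. lift (hn n) (?T a p)) \<longlonglongrightarrow> lift h (?T a p)"
        using lim by (intro AE_I2) (simp add: lift_def)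
      show "AE p in ?B. norm (lift (hn n) (?T a p)) \<le> lift h (?T a p) + 1" for n
        using dom by (intro AE_I2) (simp add: lift_def)
    qed
    then have l: "(\<lambda>n. \<integral>th. \<integral>t. lift (hn n) (rot_prod_inv k a th (mx z t)) \<partial>gauss DD \<partial>angles k) \<longlonglongrightarrow> (\<integral>th. \<integral>t. lift h (rot_prod_inv k a th (mx z t)) \<partial>gauss DD \<partial>angles k)"
      if a: "a \<in> AA k" for a
      using that P.integral_fst'[OF i2[OF a]] P.integral_fst'[OF bspec[OF elim a]] by simp
    show ?case unfolding hk_eq[OF h(1)] hk_eq[OF hn]
      by (intro tendsto_sum tendsto_mult_left l)
  qed
qed

lemma hk_restrict:
  assumes "h \<in> borel_measurable (PiM {..<M} (\<lambda>_. borel))"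
  shows "hk M N lS lR mu \<rho> h k (restrict z {..<M}) = hk M N lS lR mu \<rho> h k z"
proof -
  have "mx (restrict z {..<M}) t = mx z t" for t by (auto simp: mix_def split_wt_def fun_eq_iff)
  then show ?thesis unfolding hk_eq[OF assms] by simp
qed

lemma measurable_hk:
  assumes h: "h \<in> borel_measurable (PiM {..<M} (\<lambda>_. borel))"
  shows "hk M N lS lR mu \<rho> h k \<in> borel_measurable (PiM {..<M} (\<lambda>_. borel))"
proof -
  let ?V = "PiM {..<M} (\<lambda>_. borel :: real measure)"
  have "(\<lambda>v. \<integral>th. \<integral>t. lift h (rot_prod_inv k a th (mx v t)) \<partial>gauss DD \<partial>angles k) \<in> borel_measurable ?V" if a: "a \<in> AA k" for a
  proof (rule angles.borel_measurable_lebesgue_integral)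
    have mv: "mx v t = (\<lambda>i\<in>DD. if i < M then v i else t i)" for v t
      by (auto simp: mix_def split_wt_def fun_eq_iff)
    have mxm: "(\<lambda>q. mx (fst (fst q)) (snd q)) \<in> measurable ((?V \<Otimes>\<^sub>M angles k) \<Otimes>\<^sub>M gauss DD) (PiM DD (\<lambda>_. borel))"
      unfolding mv
    proof (rule measurable_restrict)
      fix i assume i: "i \<in> DD"
      show "(\<lambda>q. if i < M then fst (fst q) i else snd q i) \<in> borel_measurable ((?V \<Otimes>\<^sub>M angles k) \<Otimes>\<^sub>M gauss DD)"
      proof (cases "i < M")
        case True
        have "(\<lambda>q. fst (fst q)) \<in> measurable ((?V \<Otimes>\<^sub>M angles k) \<Otimes>\<^sub>M gauss DD) ?V" by measurable
        from measurable_compose[OF this measurable_component_singleton[of i]] True show ?thesis by simp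
      next
        case False
        have "(\<lambda>q. snd q i) \<in> borel_measurable ((?V \<Otimes>\<^sub>M angles k) \<Otimes>\<^sub>M gauss DD)"
          by (rule measurable_compose[OF measurable_snd coord_measurable[OF _ i]]) simp
        with False show ?thesis by simp
      qed
    qed
    have "(\<lambda>q. lift h (rot_prod_inv k a (snd (fst q)) (mx (fst (fst q)) (snd q)))) \<in> borel_measurable ((?V \<Otimes>\<^sub>M angles k) \<Otimes>\<^sub>M gauss DD)"
      by (rule measurable_T[OF a mxm _ measurable_lift[OF h]]) measurable
    then have "(\<lambda>q. \<integral>t. lift h (rot_prod_inv k a (snd q) (mx (fst q) t)) \<partial>gauss DD) \<in> borel_measurable (?V \<Otimes>\<^sub>M angles k)"
      by (intro gauss.borel_measurable_lebesgue_integral) (simp add: case_prod_beta')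
    then show "(\<lambda>(v, th). \<integral>t. lift h (rot_prod_inv k a th (mx v t)) \<partial>gauss DD) \<in> borel_measurable (?V \<Otimes>\<^sub>M angles k)"
      by (simp add: case_prod_beta')
  qed
  then show ?thesis
    unfolding hk_eq[OF h, abs_def] by (intro borel_measurable_sum borel_measurable_times) auto
qed

lemma hk_nonneg:
  assumes h: "h \<in> borel_measurable (PiM {..<M} (\<lambda>_. borel))" "\<And>v. v \<in> extensional {..<M} \<Longrightarrow> 0 \<le> h v"
  shows "0 \<le> hk M N lS lR mu \<rho> h k v"
  unfolding hk_eq[OF h(1)]
  by (intro sum_nonneg mult_nonneg_nonneg prod_nonneg ballI integral_nonneg_AE AE_I2 wt_nonneg[OF K_facts])
     (auto simp: lift_def h(2) PiE_def Pi_def)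

end

section \<open>General initial data\<close>

text \<open>Only the end point 0 requires the limit of x ln x. It matters because the limit of the
  truncations may vanish.\<close>

lemma continuous_on_phi: "continuous_on {0..} phi"
proof (rule continuous_on_eq_continuous_within[THEN iffD2], intro ballI)
  fix x :: real assume x: "x \<in> {0..}"
  show "continuous (at x within {0..}) phi"
  proof (cases "x = 0")
    case True
    have "((\<lambda>x::real. x * ln x) \<longlongrightarrow> 0) (at_right 0)" by real_asymp
    then show ?thesis using True by (simp add: continuous_within at_within_Ici_at_right phi_def[abs_def])
  next
    case False
    then have "isCont phi x" using x unfolding phi_def[abs_def] by (intro continuous_intros) auto
    then show ?thesis by (rule continuous_at_imp_continuous_within)
  qed
qed

lemma tendsto_phi: "f \<longlonglongrightarrow> l \<Longrightarrow> (\<And>n. 0 \<le> f n) \<Longrightarrow> (\<lambda>n. phi (f n)) \<longlonglongrightarrow> phi l"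
  by (rule continuous_on_tendsto_compose[OF continuous_on_phi]) (auto intro: LIMSEQ_le_const)

lemma phi_ge: "0 \<le> x \<Longrightarrow> - 1 \<le> phi x"
  using phi_tangent[of x 1] by (simp add: phi_def)

lemma phi_nonpos: "0 \<le> x \<Longrightarrow> x \<le> 1 \<Longrightarrow> phi x \<le> 0"
  unfolding phi_def by (cases "x = 0") (auto intro!: mult_nonneg_nonpos)

lemma phi_mono: "1 \<le> x \<Longrightarrow> x \<le> y \<Longrightarrow> 0 \<le> phi x \<and> phi x \<le> phi y"
  unfolding phi_def by (auto intro!: mult_mono)

text \<open>A clamp to [1/(n+1), n+1]. The index n + 1 makes 1 a point of every interval, so the
  lower value is at most 1 and the upper at least 1.\<close>

definition trunc :: "nat \<Rightarrow> real \<Rightarrow> real" where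
  "trunc n x = max (1 / real (Suc n)) (min (real (Suc n)) x)"

lemma trunc_bounds: "1 / real (Suc n) \<le> trunc n x" "trunc n x \<le> real (Suc n)" "0 < trunc n x"
proof -
  show l: "1 / real (Suc n) \<le> trunc n x" by (simp add: trunc_def)
  have "0 < 1 / real (Suc n)" by simp
  from less_le_trans[OF this l] show "0 < trunc n x" .
  have "1 / real (Suc n) \<le> 1" "1 \<le> real (Suc n)" by auto
  then have "1 / real (Suc n) \<le> real (Suc n)" by linarith
  then show "trunc n x \<le> real (Suc n)" by (simp add: trunc_def)
qed

lemma trunc_le: "0 \<le> x \<Longrightarrow> trunc n x \<le> x + 1"
proof -
  assume "0 \<le> x"
  moreover have "1 / real (Suc n) \<le> 1" by simp
  ultimately show ?thesis unfolding trunc_def by linarith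
qed

text \<open>Clamping from below lands in (0, 1], where \<open>phi\<close> lies between -1 and 0;
  clamping from above lands where \<open>phi\<close> is nonnegative and increasing. This is the
  dominating function for the entropies of the truncations.\<close>

lemma phi_trunc: "0 \<le> x \<Longrightarrow> \<bar>phi (trunc n x)\<bar> \<le> \<bar>phi x\<bar> + 1"
proof -
  assume x: "0 \<le> x"
  have s: "1 / real (Suc n) \<le> 1" "1 \<le> real (Suc n)" by auto
  consider "x < 1 / real (Suc n)" | "1 / real (Suc n) \<le> x" "x \<le> real (Suc n)" | "real (Suc n) < x" by linarith
  then show ?thesis
  proof cases
    case 1
    then have "trunc n x = 1 / real (Suc n)" using s by (auto simp: trunc_def)
    then show ?thesis using phi_ge[of "1 / real (Suc n)"] phi_nonpos[of "1 / real (Suc n)"] s by (simp add: abs_le_iff)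
  next
    case 2
    then have "trunc n x = x" by (auto simp: trunc_def)
    then show ?thesis by simp
  next
    case 3
    then have "trunc n x = real (Suc n)" using s unfolding trunc_def by linarith
    then show ?thesis using phi_mono[OF s(2), of x] 3 by simp
  qed
qed

lemma trunc_tendsto: "0 \<le> x \<Longrightarrow> (\<lambda>n. trunc n x) \<longlonglongrightarrow> x"
proof -
  assume x: "0 \<le> x"
  obtain K where K: "x \<le> real K" using real_arch_simple by blast
  have e: "eventually (\<lambda>n. trunc n x = max (1 / real (Suc n)) x) sequentially"
    using eventually_ge_at_top[of K] by eventually_elim (use K in \<open>auto simp: trunc_def min_def\<close>)
  have "(\<lambda>n. max (1 / real (Suc n)) x) \<longlonglongrightarrow> max 0 x"
    by (intro tendsto_max tendsto_const LIMSEQ_inverse_real_of_nat[unfolded inverse_eq_divide])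
  then show ?thesis using x by (simp add: tendsto_cong[OF e] max_def split: if_splits)
qed

context
  fixes M N :: nat and lS lR mu :: real and \<rho> :: "real \<Rightarrow> real"
  assumes MN: "1 \<le> M" "M \<le> N" and pos: "0 < lS" "0 < lR" "0 < mu"
    and rho: "\<forall>th\<in>{-pi..pi}. 0 \<le> \<rho> th" "set_integrable lborel {-pi..pi} \<rho>" "(LINT th:{-pi..pi}|lborel. \<rho> th) = 1"
    and sc: "(LINT th:{-pi..pi}|lborel. \<rho> th * sin th * cos th) = 0"
begin

lemmas A_facts = MN pos rho sc
lemmas C_facts = K_facts[OF A_facts]

abbreviation (input) "D \<equiv> {..<M + N}"
abbreviation (input) "Rm \<equiv> angle \<rho>"
abbreviation (input) "HK \<equiv> hk M N lS lR mu \<rho>"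
abbreviation (input) "pw \<equiv> sum (lam M N lS lR mu) (pairs (M + N))"

text \<open>Each collision multiplies the mean by the total rate \<open>pw\<close>. This evaluates
  the mean relative to which the entropy of the evolved function is measured.\<close>

lemma integral_Qpow:
  assumes F: "bmeas D F"
  shows "(\<integral>z. (Qop (pairs (M + N)) (lam M N lS lR mu) Rm ^^ k) F z \<partial>gauss D) = pw ^ k * (\<integral>z. F z \<partial>gauss D)"
proof (induction k)
  case (Suc k)
  let ?Q = "Qop (pairs (M + N)) (lam M N lS lR mu) Rm"
  define G where "G = (?Q ^^ k) F"
  have G: "bmeas D G" unfolding G_def by (rule bmeas_Qpow[OF C_facts F])
  interpret R: prob_space Rm by (rule R_prob[OF A_facts])
  let ?z = "\<lambda>_::nat. 0::real"
  \<comment> \<open>Integration is the Mehler operator with c = 0 and s = 1, so the commutation with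
    Q also yields its action on means.\<close>
  have m: "mehler D (\<lambda>_. 0) (\<lambda>_. 1) H z = (\<integral>y. H y \<partial>gauss D)" for H z
    unfolding mehler_def
    by (intro Bochner_Integration.integral_cong refl arg_cong[where f=H])
       (auto simp: mix_def space_gauss extensional_def fun_eq_iff)
  have "(\<integral>z. ?Q G z \<partial>gauss D) = ?Q (mehler D (\<lambda>_. 0) (\<lambda>_. 1) G) ?z"
    by (simp only: Q_mehler[OF Q_facts[OF C_facts] G] m)
  also have "\<dots> = pw * (\<integral>z. G z \<partial>gauss D)"
    unfolding Qop_def m by (simp add: sum_distrib_right R.prob_space)
  finally show ?case using Suc by (simp add: G_def)
qed simp

text \<open>The truncated data do not have mean 1, so the bounded inequality is used with its terms
  \<open>phi (m n)\<close> and \<open>phi (pw ^ k * m n)\<close>, which converge. The right side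
  passes to the limit by dominated convergence, the left by Fatou, which also yields integrability
  of the limit.\<close>

theorem entropy_hk:
  fixes k :: nat
  assumes h: "h \<in> borel_measurable (PiM {..<M} (\<lambda>_. borel))" "integrable (gauss {..<M}) h" "\<And>v. v \<in> extensional {..<M} \<Longrightarrow> 0 \<le> h v"
    and one: "(\<integral>v. h v \<partial>gauss {..<M}) = 1" and S: "integrable (gauss {..<M}) (\<lambda>v. phi (h v))"
  defines "C \<equiv> real M / real (N + M) + real N / real (N + M) * (1 - relax M N lS lR mu Rm * real (N + M) / real N) ^ k"
  shows "integrable (gauss {..<M}) (\<lambda>v. phi (HK h k v)) \<and> (\<integral>v. phi (HK h k v) \<partial>gauss {..<M}) \<le> C * (\<integral>v. phi (h v) \<partial>gauss {..<M})"
proof -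
  let ?M = "{..<M}"
  have MD: "?M \<subseteq> D" and fD: "finite D" by auto
  define hn where "hn n v = trunc n (h v)" for n v
  have hnm: "hn n \<in> borel_measurable (PiM ?M (\<lambda>_. borel))" for n
    unfolding hn_def[abs_def] trunc_def using h(1) by measurable
  have hnb: "between ?M (1 / real (Suc n)) (real (Suc n)) (hn n)" for n
    unfolding between_def using hnm trunc_bounds by (auto simp: hn_def)
  have dom: "\<bar>hn n v\<bar> \<le> h v + 1" if "v \<in> extensional ?M" for n v
    using trunc_le[OF h(3)[OF that]] trunc_bounds(3)[of n "h v"] by (simp add: hn_def)
  have lim: "(\<lambda>n. hn n v) \<longlonglongrightarrow> h v" if "v \<in> extensional ?M" for v
    unfolding hn_def by (rule trunc_tendsto[OF h(3)[OF that]])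
  note Lb = between_lift[OF A_facts hnb]
  have gm: "f \<in> borel_measurable (gauss J) \<longleftrightarrow> f \<in> borel_measurable (PiM J (\<lambda>_. borel))" for f :: "(nat \<Rightarrow> real) \<Rightarrow> real" and J
    by (simp add: measurable_PiM_gauss)
  have liftint: "(\<integral>z. g (lift M f z) \<partial>gauss D) = (\<integral>v. g (f v) \<partial>gauss ?M)"
    if "f \<in> borel_measurable (PiM ?M (\<lambda>_. borel))" "g \<in> borel_measurable borel" for f and g :: "real \<Rightarrow> real"
    using integral_gauss_restrict(1)[OF MD, of "\<lambda>v. g (f v)"] measurable_compose[OF that] by (simp add: lift_def[OF A_facts] gm)
  define fn where "fn n = reservoir_avg M D ((Qop (pairs (M + N)) (lam M N lS lR mu) Rm ^^ k) (lift M (hn n)))" for n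
  have fn_eq: "HK (hn n) k z = fn n z" for n z
    unfolding fn_def by (rule hk_bounded[OF A_facts hnb])
  have fnb: "between D (pw ^ k * (1 / real (Suc n))) (real (Suc n)) (fn n)" for n
    unfolding fn_def reservoir_avg_def by (rule between_mehler[OF fD between_Qpow[OF C_facts _ Lb]]) simp
  note pw = wt_sum[OF C_facts]
  have fnn: "0 \<le> fn n z" for n z
    unfolding fn_eq[symmetric] by (rule hk_nonneg[OF A_facts hnm]) (simp add: hn_def less_imp_le trunc_bounds)
  have phin: "integrable (gauss D) (\<lambda>z. phi (fn n z))" for n
    by (rule bmeas_integrable[OF fD bmeas_phi[OF fD between_bmeas[OF fD fnb] fnn]])
  define m where "m n = (\<integral>v. hn n v \<partial>gauss ?M)" for n
  define E where "E n = (\<integral>v. phi (hn n v) \<partial>gauss ?M)" for n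
  have fnint: "(\<integral>z. fn n z \<partial>gauss D) = pw ^ k * m n" for n
  proof -
    have "(\<integral>z. fn n z \<partial>gauss D) = (\<integral>z. (Qop (pairs (M + N)) (lam M N lS lR mu) Rm ^^ k) (lift M (hn n)) z \<partial>gauss D)"
      unfolding fn_def reservoir_avg_def
      by (rule integral_mehler[OF fD _ bmeas_Qpow[OF C_facts between_bmeas[OF fD Lb]]]) (auto simp: split_wt_def)
    also have "\<dots> = pw ^ k * m n"
      unfolding integral_Qpow[OF between_bmeas[OF fD Lb]] m_def using liftint[OF hnm, of "\<lambda>x. x"] by simp
    finally show ?thesis .
  qed
  have bound: "ent D (fn n) \<le> C * (E n - phi (m n)) + phi (pw ^ k * m n)" for n
  proof -
    have "ent D (fn n) - phi (\<integral>z. fn n z \<partial>gauss D) \<le> C * (ent D (lift M (hn n)) - phi (\<integral>z. lift M (hn n) z \<partial>gauss D))"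
      unfolding fn_def C_def by (rule entropy_kac_bounded[OF C_facts _ Lb cylindrical_lift[OF A_facts]]) simp
    moreover have "ent D (lift M (hn n)) = E n" unfolding ent_def E_def by (rule liftint[OF hnm measurable_phi])
    moreover have "(\<integral>z. lift M (hn n) z \<partial>gauss D) = m n" unfolding m_def using liftint[OF hnm, of "\<lambda>x. x"] by simp
    ultimately show ?thesis by (simp add: fnint)
  qed
  have mlim: "m \<longlonglongrightarrow> 1"
    unfolding m_def one[symmetric]
  proof (rule integral_dominated_convergence[where w="\<lambda>v. h v + 1"])
    show "AE v in gauss ?M. (\<lambda>n. hn n v) \<longlonglongrightarrow> h v" using lim by (intro AE_I2) (simp add: space_gauss)
    show "AE v in gauss ?M. norm (hn n v) \<le> h v + 1" for n using dom by (intro AE_I2) (simp add: space_gauss)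
  qed (use h hnm in \<open>simp_all add: gm\<close>)
  define E0 where "E0 = (\<integral>v. phi (h v) \<partial>gauss ?M)"
  have Elim: "E \<longlonglongrightarrow> E0"
    unfolding E_def E0_def
  proof (rule integral_dominated_convergence[where w="\<lambda>v. \<bar>phi (h v)\<bar> + 1"])
    show "AE v in gauss ?M. (\<lambda>n. phi (hn n v)) \<longlonglongrightarrow> phi (h v)"
      using lim by (intro AE_I2 tendsto_phi) (auto simp: space_gauss hn_def less_imp_le trunc_bounds)
    show "AE v in gauss ?M. norm (phi (hn n v)) \<le> \<bar>phi (h v)\<bar> + 1" for n
      using phi_trunc h(3) by (intro AE_I2) (simp add: space_gauss hn_def)
    show "(\<lambda>v. phi (h v)) \<in> borel_measurable (gauss ?M)" using S by simp
    show "(\<lambda>v. phi (hn n v)) \<in> borel_measurable (gauss ?M)" for n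
      using measurable_compose[OF hnm measurable_phi] by (simp add: gm)
  qed (use S in simp)
  have m0: "0 \<le> m n" for n unfolding m_def hn_def by (intro integral_nonneg_AE AE_I2) (simp add: less_imp_le trunc_bounds)
  \<comment> \<open>The limit of the bounds, with \<open>phi 1 = 0\<close>; the added 1 matches the
    shift that makes the integrands nonnegative.\<close>
  define X where "X = C * E0 + phi (pw ^ k) + 1"
  have Xlim: "(\<lambda>n. C * (E n - phi (m n)) + phi (pw ^ k * m n) + 1) \<longlonglongrightarrow> X"
  proof -
    have "(\<lambda>n. C * (E n - phi (m n)) + phi (pw ^ k * m n) + 1) \<longlonglongrightarrow> C * (E0 - phi 1) + phi (pw ^ k * 1) + 1"
      using pw m0 by (intro tendsto_intros Elim mlim tendsto_phi) auto
    then show ?thesis by (simp add: X_def phi_def)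
  qed
  define f where "f = HK h k"
  have f0: "0 \<le> f z" for z unfolding f_def by (rule hk_nonneg[OF A_facts h(1,3)])
  have fM: "f \<in> borel_measurable (PiM ?M (\<lambda>_. borel))" unfolding f_def by (rule measurable_hk[OF A_facts h(1)])
  have fl: "lift M f = f" unfolding lift_def[OF A_facts] f_def fun_eq_iff by (simp add: hk_restrict[OF A_facts h(1)])
  have fD': "f \<in> borel_measurable (gauss D)" using measurable_lift[OF A_facts fM] by (simp add: gm fl)
  have ae: "AE z in gauss D. (\<lambda>n. fn n z) \<longlonglongrightarrow> f z"
    unfolding f_def fn_eq[symmetric] by (rule hk_tendsto[OF A_facts h hnm lim dom])
  \<comment> \<open>Since \<open>phi\<close> is at least -1, adding 1 makes Fatou's lemma
    applicable, and the Gaussian being a probability measure allows the 1 to be removed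
    later.\<close>
  have "(\<integral>\<^sup>+z. ennreal (phi (f z) + 1) \<partial>gauss D) = (\<integral>\<^sup>+z. liminf (\<lambda>n. ennreal (phi (fn n z) + 1)) \<partial>gauss D)"
  proof (rule nn_integral_cong_AE)
    show "AE z in gauss D. ennreal (phi (f z) + 1) = liminf (\<lambda>n. ennreal (phi (fn n z) + 1))"
      using ae
    proof eventually_elim
      case (elim z)
      have "(\<lambda>n. ennreal (phi (fn n z) + 1)) \<longlonglongrightarrow> ennreal (phi (f z) + 1)"
        by (intro tendsto_ennrealI tendsto_intros tendsto_phi elim fnn)
      from lim_imp_Liminf[OF _ this] show ?case by simp
    qed
  qed
  also have "\<dots> \<le> liminf (\<lambda>n. \<integral>\<^sup>+z. ennreal (phi (fn n z) + 1) \<partial>gauss D)"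
  proof (rule nn_integral_liminf)
    fix n
    have "integrable (gauss D) (\<lambda>z. phi (fn n z) + 1)" using phin by simp
    from measurable_compose[OF borel_measurable_integrable[OF this] measurable_ennreal]
    show "(\<lambda>z. ennreal (phi (fn n z) + 1)) \<in> borel_measurable (gauss D)" .
  qed
  also have "\<dots> \<le> liminf (\<lambda>n. ennreal (C * (E n - phi (m n)) + phi (pw ^ k * m n) + 1))"
  proof (intro Liminf_mono always_eventually allI)
    fix n
    have "(\<integral>\<^sup>+z. ennreal (phi (fn n z) + 1) \<partial>gauss D) = ennreal (\<integral>z. phi (fn n z) + 1 \<partial>gauss D)"
    proof (intro nn_integral_eq_integral AE_I2)
      fix z show "0 \<le> phi (fn n z) + 1" using phi_ge[OF fnn, of n z] by linarith
    qed (use phin in simp)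
    also have "\<dots> \<le> ennreal (C * (E n - phi (m n)) + phi (pw ^ k * m n) + 1)"
      using bound[of n] phin by (intro ennreal_leI) (simp add: ent_def gauss.prob_space)
    finally show "(\<integral>\<^sup>+z. ennreal (phi (fn n z) + 1) \<partial>gauss D) \<le> ennreal (C * (E n - phi (m n)) + phi (pw ^ k * m n) + 1)" .
  qed
  also have "\<dots> = ennreal X"
    by (rule lim_imp_Liminf) (auto intro: tendsto_ennrealI Xlim)
  finally have le: "(\<integral>\<^sup>+z. ennreal (phi (f z) + 1) \<partial>gauss D) \<le> ennreal X" .
  have p1: "0 \<le> phi (f z) + 1" for z using phi_ge[OF f0, of z] by linarith
  have X0: "0 \<le> X"
  proof (rule LIMSEQ_le_const[OF Xlim], intro exI allI impI)
    fix n
    have "(\<integral>z. -1 \<partial>gauss D) \<le> ent D (fn n)" unfolding ent_def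
      by (intro integral_mono phin phi_ge fnn) simp
    then show "0 \<le> C * (E n - phi (m n)) + phi (pw ^ k * m n) + 1" using bound[of n] by (simp add: gauss.prob_space)
  qed
  have pm: "(\<lambda>z. phi (f z) + 1) \<in> borel_measurable (gauss D)" using fD' by measurable
  have int1: "integrable (gauss D) (\<lambda>z. phi (f z) + 1)"
    using le p1 pm by (intro integrableI_bounded) (auto simp: less_top[symmetric] top_unique intro: le_less_trans)
  have "integrable (gauss D) (\<lambda>z. (phi (f z) + 1) - 1)" using int1 by (intro Bochner_Integration.integrable_diff) auto
  then have int: "integrable (gauss D) (\<lambda>z. phi (f z))" by simp
  have "ennreal (\<integral>z. phi (f z) + 1 \<partial>gauss D) \<le> ennreal X"
    using le nn_integral_eq_integral[OF int1] p1 by simp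
  then have "(\<integral>z. phi (f z) + 1 \<partial>gauss D) \<le> X" using X0 by (simp add: ennreal_le_iff)
  then have "(\<integral>z. phi (f z) \<partial>gauss D) \<le> C * E0 + phi (pw ^ k)" using int by (simp add: X_def gauss.prob_space)
  \<comment> \<open>Here the possible loss of mass is absorbed: pw^k lies in [0, 1], where
    \<open>phi\<close> is at most 0.\<close>
  also have "\<dots> \<le> C * E0" using phi_nonpos[of "pw ^ k"] pw by (simp add: power_le_one)
  finally have ub: "(\<integral>z. phi (f z) \<partial>gauss D) \<le> C * E0" .
  have fz: "f (restrict z ?M) = f z" for z using fl[unfolded lift_def[OF A_facts]] by (metis fl lift_def[OF A_facts])
  have pM: "(\<lambda>v. phi (f v)) \<in> borel_measurable (gauss ?M)" using measurable_compose[OF fM measurable_phi] by (simp add: gm)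
  have "integrable (gauss ?M) (\<lambda>v. phi (f v))"
    using int integral_gauss_restrict(2)[OF MD pM] by (simp add: fz)
  moreover have "(\<integral>v. phi (f v) \<partial>gauss ?M) \<le> C * E0"
    using ub integral_gauss_restrict(1)[OF MD pM] by (simp add: fz)
  ultimately show ?thesis by (simp add: f_def E0_def)
qed

end

theorem theorem5p1:
  fixes M N :: nat and lS lR mu :: real and \<rho> :: "real \<Rightarrow> real"
    and h0 :: "(nat \<Rightarrow> real) \<Rightarrow> real" and k :: nat
  assumes "1 \<le> M" and "M \<le> N"
    and "lS > 0" and "lR > 0" and "mu > 0"
    and "\<forall>th\<in>{-pi..pi}. 0 \<le> \<rho> th"
    and "set_integrable lborel {-pi..pi} \<rho>"
    and "(LINT th:{-pi..pi}|lborel. \<rho> th) = 1"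
    and "(\<lambda>n. norm (fourier_coeff \<rho> n)) summable_on (UNIV :: int set)"
    and "(LINT th:{-pi..pi}|lborel. \<rho> th * sin th * cos th) = 0"
    and "h0 \<in> borel_measurable (PiM {..<M} (\<lambda>_. lborel))"
    and "\<forall>v\<in>space (PiM {..<M} (\<lambda>_. lborel)). 0 \<le> h0 v"
    and "(\<integral>v. h0 v * gauss_w {..<M} v \<partial>(PiM {..<M} (\<lambda>_. lborel))) = 1"
    and "integrable (PiM {..<M} (\<lambda>_. lborel)) (\<lambda>v. h0 v * ln (h0 v) * gauss_w {..<M} v)"
  shows "integrable (PiM {..<M} (\<lambda>_. lborel))
           (\<lambda>v. hk M N lS lR mu \<rho> h0 k v * ln (hk M N lS lR mu \<rho> h0 k v) * gauss_w {..<M} v)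
       \<and> entropy M (hk M N lS lR mu \<rho> h0 k)
         \<le> (real M / real (N + M) + real N / real (N + M) *
              (1 - mu * (LINT th:{-pi..pi}|lborel. \<rho> th * (sin th)\<^sup>2) * real (N + M)
                     / (real N * Lam M N lS lR mu)) ^ k) * entropy M h0"
proof -
  note A = assms(1-8,10)
  let ?M = "{..<M}"
  have e: "sets (PiM ?M (\<lambda>_. lborel)) = sets (PiM ?M (\<lambda>_. borel :: real measure))"
    by (rule sets_PiM_cong) auto
  have hm: "h0 \<in> borel_measurable (PiM ?M (\<lambda>_. borel))"
    using assms(11) by (simp add: measurable_cong_sets[OF e refl])
  have h0: "\<And>v. v \<in> extensional ?M \<Longrightarrow> 0 \<le> h0 v" using assms(12) by (simp add: space_PiM PiE_def)
  have one: "(\<integral>v. h0 v \<partial>gauss ?M) = 1" using assms(13) integral_gauss(1)[OF _ hm] by simp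
  \<comment> \<open>A function that is not integrable has Bochner integral 0, so the normalisation
    to 1 already implies integrability.\<close>
  then have hi: "integrable (gauss ?M) h0" using not_integrable_integral_eq by fastforce
  have ent: "entropy M h = (\<integral>v. phi (h v) \<partial>gauss ?M)"
    and inti: "integrable (PiM ?M (\<lambda>_. lborel)) (\<lambda>v. h v * ln (h v) * gauss_w ?M v) \<longleftrightarrow> integrable (gauss ?M) (\<lambda>v. phi (h v))"
    if "h \<in> borel_measurable (PiM ?M (\<lambda>_. borel))" for h
    using integral_gauss[OF _ measurable_compose[OF that measurable_phi]] by (simp_all add: entropy_def phi_def)
  note kM = measurable_hk[OF A hm, of k]
  have S: "integrable (gauss ?M) (\<lambda>v. phi (h0 v))" using assms(14) inti[OF hm] by simp
  have relax: "relax M N lS lR mu (angle \<rho>) * real (N + M) / real N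
     = mu * (LINT th:{-pi..pi}|lborel. \<rho> th * (sin th)\<^sup>2) * real (N + M) / (real N * Lam M N lS lR mu)"
    unfolding relax_def[OF K_facts[OF A]] by (simp add: integral_R[OF A] mult_ac)
  show ?thesis
    using entropy_hk[OF A hm hi h0 one S, of k] unfolding ent[OF hm] ent[OF kM] inti[OF kM] relax .
qed

end
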